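(* Let $a<b$ be real numbers, let $p>1$, let $k\in\mathbb{N}$ with $k\ge 2$, and let $h(t)=\sin\bigl(k\pi (t-a)/(b-a)\bigr)$ for $t\in[a,b]$. Then there exists $\mu^{**}>0$ such that for every $\mu>\mu^{**}$ the Dirichlet problem $$u''+\bigl(h^{+}(t)-\mu h^{-}(t)\bigr)|u|^{p-1}u=0 \ \text{ on } [a,b],\qquad u(a)=0=u(b),$$ admits exactly $2^{m}-1$ positive solutions, where $m$ is the integer part of $(k+1)/2$. Moreover, all these positive solutions are non-degenerate.
   Context: Here $h^{+}=(|h|+h)/2$ and $h^{-}=(|h|-h)/2$ denote the positive and negative parts of $h$. A solution $u$ is positive if $u(t)>0$ for all $t\in(a,b)$. A positive solution $u$ is non-degenerate if the linearized problem $w''+\bigl(h^{+}(t)-\mu h^{-}(t)\bigr)\,p\,u(t)^{p-1}w=0$ on $[a,b]$, $w(a)=0=w(b)$, has only the trivial solution $w\equiv 0$. *)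

theory Defs
  imports "HOL-Analysis.Analysis"
begin

definition pos_part :: "(real \<Rightarrow> real) \<Rightarrow> real \<Rightarrow> real" where
  "pos_part h t = (\<bar>h t\<bar> + h t) / 2"

definition neg_part :: "(real \<Rightarrow> real) \<Rightarrow> real \<Rightarrow> real" where
  "neg_part h t = (\<bar>h t\<bar> - h t) / 2"

definition weight :: "(real \<Rightarrow> real) \<Rightarrow> real \<Rightarrow> real \<Rightarrow> real" where
  "weight h \<mu> t = pos_part h t - \<mu> * neg_part h t"

text \<open>Classical solutions of \<open>u'' + f(t, u) = 0\<close> on \<open>[a, b]\<close> with \<open>u(a) = 0 = u(b)\<close>.
  The derivatives are one-sided at the end points; \<open>v\<close> is \<open>u'\<close>. When \<open>f\<close> is continuous on
  \<open>[a, b] \<times> \<real>\<close>, such a \<open>u\<close> is automatically of class \<open>C\<^sup>2\<close> on \<open>[a, b]\<close>.\<close>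

definition dirichlet_solution ::
    "real \<Rightarrow> real \<Rightarrow> (real \<Rightarrow> real \<Rightarrow> real) \<Rightarrow> (real \<Rightarrow> real) \<Rightarrow> bool" where
  "dirichlet_solution a b f u \<longleftrightarrow>
     (\<exists>v. \<forall>t\<in>{a..b}.
        (u has_real_derivative v t) (at t within {a..b}) \<and>
        (\<exists>v'. (v has_real_derivative v') (at t within {a..b}) \<and> v' + f t (u t) = 0)) \<and>
     u a = 0 \<and> u b = 0"

definition positive_solution ::
    "real \<Rightarrow> real \<Rightarrow> real \<Rightarrow> (real \<Rightarrow> real) \<Rightarrow> real \<Rightarrow> (real \<Rightarrow> real) \<Rightarrow> bool" where
  "positive_solution a b p h \<mu> u \<longleftrightarrow>
     dirichlet_solution a b (\<lambda>t x. weight h \<mu> t * \<bar>x\<bar> powr (p - 1) * x) u \<and>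
     (\<forall>t\<in>{a<..<b}. u t > 0)"

text \<open>A solution is a function on \<open>[a, b]\<close> only, so for counting we fix its values outside
  \<open>[a, b]\<close> by extensionality.\<close>

definition positive_solutions ::
    "real \<Rightarrow> real \<Rightarrow> real \<Rightarrow> (real \<Rightarrow> real) \<Rightarrow> real \<Rightarrow> (real \<Rightarrow> real) set" where
  "positive_solutions a b p h \<mu> = {u \<in> extensional {a..b}. positive_solution a b p h \<mu> u}"

definition nondegenerate ::
    "real \<Rightarrow> real \<Rightarrow> real \<Rightarrow> (real \<Rightarrow> real) \<Rightarrow> real \<Rightarrow> (real \<Rightarrow> real) \<Rightarrow> bool" where
  "nondegenerate a b p h \<mu> u \<longleftrightarrow>
     (\<forall>w. dirichlet_solution a b (\<lambda>t x. weight h \<mu> t * p * u t powr (p - 1) * x) w \<longrightarrow>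
          (\<forall>t\<in>{a..b}. w t = 0))"

end

theory Submission
  imports Defs
begin

text \<open>Let \<open>l = (b - a) / k\<close>. On each hump of \<open>h\<close> of positive sign a positive solution is bounded independently
  of \<open>\<mu>\<close>, and for large \<open>\<mu>\<close> it is tiny at the interior zeros of \<open>h\<close>, since otherwise it would blow up on the
  adjacent negative hump. Hence on each positive hump it is either below a small threshold \<open>\<epsilon>\<close>, or close to
  the positive Dirichlet solution of the problem on that hump. The latter is unique and non-degenerate: it is
  even by an energy comparison, and the linearised equation is compared with \<open>u'\<close> and with \<open>t u' + c u\<close>.

  A solution is determined by the set of positive humps on which it exceeds \<open>\<epsilon>\<close>, and it is non-degenerate. For
  both claims one considers \<open>w'' + (h\<^sup>+ - \<mu> h\<^sup>-) c w = 0\<close>, where \<open>c\<close> is the difference quotient of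
  \<open>x\<^sup>p\<close> between two solutions with the same set, and normalises \<open>w\<close> to have maximum 1. Next to a hump where the
  solutions are large, \<open>\<mu> h\<^sup>- c\<close> is so large in a boundary layer that \<open>w\<close> is small at the end of
  the hump; non-degeneracy on the hump then keeps the maximum away from it, and elsewhere \<open>w\<close> is almost
  convex where it is positive, so it cannot descend from 1 to a small value. The set is nonempty for the same reason.

  Every nonempty set of positive humps occurs. Shooting from \<open>a\<close> with initial slope \<open>\<alpha>\<close>, a solution whose maximum
  over a positive hump is exactly \<open>\<epsilon>\<close> blows up on the next negative hump. The intermediate value theorem
  therefore splits an interval of slopes, from solutions that have become negative to solutions that blow up,
  into one on which the next maximum is at most \<open>\<epsilon>\<close> and one on which it is at least \<open>\<epsilon>\<close>.
  There are \<open>(k + 1) div 2\<close> positive humps.\<close>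

section \<open>Second-order equations\<close>

text \<open>The obstacle is that the weight is unbounded in \<mu> on the negative humps. Compactness
  is therefore used only on the positive humps, where the equation does not contain \<mu>, and only
  for initial data at the left end of a hump. On negative humps the arguments use convexity and
  comparison with the solution itself; the size of \<mu> enters solely through
  \<open>blow_up\<close>.

  Constants are chosen in this order: the hump length and \<open>p\<close> fix the a priori bound
  \<open>M0\<close>; \<open>R\<close> lies above it, so that the truncation is invisible to positive
  solutions; \<epsilon> depends on \<open>p\<close>, \<open>k\<close> and the hump length;
  compactness then yields a tolerance \<delta>, and \<mu> comes last. The threshold \<epsilon> has
  two tasks: a solution with maximum \<epsilon> on a hump must not return close to 0 before the hump
  ends, and a function with maximum 1 and second derivative at least -\<open>g \<epsilon>\<close>
  must lose less than 1/2 over the whole interval.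

  Shooting cannot rely on monotone dependence on the slope. Instead a segment of slopes is passed on
  from hump to hump, whose end points may stand in either order.\<close>

definition c2_on :: "real \<Rightarrow> real \<Rightarrow> (real \<Rightarrow> real) \<Rightarrow> (real \<Rightarrow> real) \<Rightarrow> (real \<Rightarrow> real) \<Rightarrow> bool" where
  "c2_on c d u v A \<longleftrightarrow> (\<forall>t\<in>{c..d}. (u has_real_derivative v t) (at t within {c..d}) \<and>
     (v has_real_derivative A t) (at t within {c..d}))"

lemma c2_onD:
  assumes "c2_on c d u v A" "t \<in> {c..d}"
  shows "(u has_real_derivative v t) (at t within {c..d})"
    "(v has_real_derivative A t) (at t within {c..d})"
  using assms by (auto simp: c2_on_def)

lemma c2_on_subset:
  assumes "c2_on c d u v A" "c \<le> c'" "d' \<le> d"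
  shows "c2_on c' d' u v A"
  unfolding c2_on_def
proof
  fix t assume "t \<in> {c'..d'}"
  with assms have "t \<in> {c..d}" "{c'..d'} \<subseteq> {c..d}" by auto
  with c2_onD[OF assms(1)] show "(u has_real_derivative v t) (at t within {c'..d'}) \<and>
     (v has_real_derivative A t) (at t within {c'..d'})"
    by (meson DERIV_subset)
qed

lemma c2_on_cong:
  assumes "c2_on c d u v A" "\<And>t. t \<in> {c..d} \<Longrightarrow> A t = B t"
  shows "c2_on c d u v B"
  using assms by (simp add: c2_on_def)

lemma c2_on_cong_fun:
  assumes "c2_on c d u v A" "\<And>t. t \<in> {c..d} \<Longrightarrow> u t = u' t"
  shows "c2_on c d u' v A"
  using assms unfolding c2_on_def has_field_derivative_def
  by (metis has_derivative_transform)

lemma c2_on_lincomb: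
  assumes "c2_on c d u v A" "c2_on c d u' v' A'"
  shows "c2_on c d (\<lambda>t. x * u t + y * u' t) (\<lambda>t. x * v t + y * v' t) (\<lambda>t. x * A t + y * A' t)"
  using assms unfolding c2_on_def by (auto intro!: derivative_eq_intros)

lemma c2_on_scale:
  assumes "c2_on c d u v A"
  shows "c2_on c d (\<lambda>t. x * u t) (\<lambda>t. x * v t) (\<lambda>t. x * A t)"
  using assms unfolding c2_on_def by (auto intro!: derivative_eq_intros)

lemma c2_on_minus:
  assumes "c2_on c d u v A"
  shows "c2_on c d (\<lambda>t. - u t) (\<lambda>t. - v t) (\<lambda>t. - A t)"
  using c2_on_scale[OF assms, of "-1"] by simp

lemma c2_on_diff:
  assumes "c2_on c d u v A" "c2_on c d u' v' A'"
  shows "c2_on c d (\<lambda>t. u t - u' t) (\<lambda>t. v t - v' t) (\<lambda>t. A t - A' t)"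
  using c2_on_lincomb[OF assms, of 1 "-1"] by simp

lemma c2_on_linear: "c2_on c d (\<lambda>t. x + y * (t - s)) (\<lambda>t. y) (\<lambda>t. 0)"
  unfolding c2_on_def by (auto intro!: derivative_eq_intros)

lemma c2_on_affine:
  assumes "c2_on c d u v A" "\<And>t. t \<in> {c'..d'} \<Longrightarrow> e * t + s \<in> {c..d}"
  shows "c2_on c' d' (\<lambda>t. u (e * t + s)) (\<lambda>t. e * v (e * t + s)) (\<lambda>t. e * e * A (e * t + s))"
proof -
  have "((\<lambda>t. g (e * t + s)) has_real_derivative e * g') (at t within {c'..d'})"
    if "t \<in> {c'..d'}" "(g has_real_derivative g') (at (e * t + s) within {c..d})" for t g g'
  proof -
    have "((g \<circ> (\<lambda>t. e * t + s)) has_real_derivative g' * e) (at t within {c'..d'})"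
    proof (rule DERIV_image_chain)
      show "(g has_real_derivative g') (at (e * t + s) within (\<lambda>t. e * t + s) ` {c'..d'})"
        by (rule DERIV_subset[OF that(2)]) (use assms(2) in auto)
      show "((\<lambda>t. e * t + s) has_real_derivative e) (at t within {c'..d'})"
        by (auto intro!: derivative_eq_intros)
    qed
    then show ?thesis by (simp add: o_def mult.commute)
  qed
  note * = this
  show ?thesis unfolding c2_on_def
  proof (intro ballI conjI)
    fix t assume t: "t \<in> {c'..d'}"
    show "((\<lambda>t. u (e * t + s)) has_real_derivative e * v (e * t + s)) (at t within {c'..d'})"
      using *[OF t] c2_onD(1)[OF assms(1) assms(2)[OF t]] by blast
    have "((\<lambda>t. v (e * t + s)) has_real_derivative e * A (e * t + s)) (at t within {c'..d'})"
      using *[OF t] c2_onD(2)[OF assms(1) assms(2)[OF t]] by blast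
    from DERIV_cmult[OF this, of e]
    show "((\<lambda>t. e * v (e * t + s)) has_real_derivative e * e * A (e * t + s)) (at t within {c'..d'})"
      by (simp add: mult.assoc)
  qed
qed

lemma c2_on_reflect:
  assumes "c2_on c d u v A"
  shows "c2_on (-d) (-c) (\<lambda>t. u (-t)) (\<lambda>t. - v (-t)) (\<lambda>t. A (-t))"
  using c2_on_affine[OF assms, of "-d" "-c" "-1" 0] by simp

lemma c2_on_shift:
  assumes "c2_on c d u v A"
  shows "c2_on (c - s) (d - s) (\<lambda>t. u (t + s)) (\<lambda>t. v (t + s)) (\<lambda>t. A (t + s))"
  using c2_on_affine[OF assms, of "c - s" "d - s" 1 s] by simp

lemma c2_on_cont:
  assumes "c2_on c d u v A"
  shows "continuous_on {c..d} u" "continuous_on {c..d} v"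
  using assms unfolding c2_on_def by (auto intro!: DERIV_continuous_on)

section \<open>Mean value, Taylor and Gronwall estimates\<close>

lemma mvt_within:
  fixes f f' :: "real \<Rightarrow> real"
  assumes "\<And>t. t \<in> {c..d} \<Longrightarrow> (f has_real_derivative f' t) (at t within {c..d})"
    and "c \<le> x" "x < y" "y \<le> d"
  shows "\<exists>t. x < t \<and> t < y \<and> f y - f x = f' t * (y - x)"
proof -
  have "\<exists>t\<in>{x<..<y}. f y - f x = (\<lambda>h. f' t * h) (y - x)"
  proof (rule mvt_simple[OF assms(3)])
    fix t assume "x \<le> t" "t \<le> y"
    then have "(f has_real_derivative f' t) (at t within {x..y})"
      using assms by (intro DERIV_subset[OF assms(1)]) auto
    then show "(f has_derivative (*) (f' t)) (at t within {x..y})"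
      by (simp add: has_field_derivative_def)
  qed
  then show ?thesis by auto
qed

lemma deriv_ge:
  fixes f f' :: "real \<Rightarrow> real"
  assumes "\<And>t. t \<in> {c..d} \<Longrightarrow> (f has_real_derivative f' t) (at t within {c..d})"
    and "c \<le> x" "x \<le> y" "y \<le> d" and "\<And>t. x < t \<Longrightarrow> t < y \<Longrightarrow> m \<le> f' t"
  shows "m * (y - x) \<le> f y - f x"
proof (cases "x = y")
  case False
  with mvt_within[OF assms(1,2)] assms obtain t where "x < t" "t < y" "f y - f x = f' t * (y - x)"
    by (metis less_eq_real_def)
  then show ?thesis using assms(5)[of t] by (simp add: mult_right_mono)
qed auto

lemma deriv_gt:
  fixes f f' :: "real \<Rightarrow> real"
  assumes "\<And>t. t \<in> {c..d} \<Longrightarrow> (f has_real_derivative f' t) (at t within {c..d})"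
    and "c \<le> x" "x < y" "y \<le> d" and "\<And>t. x < t \<Longrightarrow> t < y \<Longrightarrow> m < f' t"
  shows "m * (y - x) < f y - f x"
proof -
  from mvt_within[OF assms(1-4)] obtain t where "x < t" "t < y" "f y - f x = f' t * (y - x)"
    by auto
  then show ?thesis using assms(5)[of t] by (simp)
qed

lemma deriv_le:
  fixes f f' :: "real \<Rightarrow> real"
  assumes "\<And>t. t \<in> {c..d} \<Longrightarrow> (f has_real_derivative f' t) (at t within {c..d})"
    and "c \<le> x" "x \<le> y" "y \<le> d" and "\<And>t. x < t \<Longrightarrow> t < y \<Longrightarrow> f' t \<le> m"
  shows "f y - f x \<le> m * (y - x)"
  using deriv_ge[of c d "\<lambda>t. - f t" "\<lambda>t. - f' t" x y "-m"] assms
  by (force intro: derivative_intros)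

lemma deriv_lt:
  fixes f f' :: "real \<Rightarrow> real"
  assumes "\<And>t. t \<in> {c..d} \<Longrightarrow> (f has_real_derivative f' t) (at t within {c..d})"
    and "c \<le> x" "x < y" "y \<le> d" and "\<And>t. x < t \<Longrightarrow> t < y \<Longrightarrow> f' t < m"
  shows "f y - f x < m * (y - x)"
  using deriv_gt[of c d "\<lambda>t. - f t" "\<lambda>t. - f' t" x y "-m"] assms
  by (force intro: derivative_intros)

lemma taylor_le:
  assumes "c2_on c d u v A" and "x \<in> {c..d}" "y \<in> {c..d}"
    and "\<And>t. t \<in> {c..d} \<Longrightarrow> A t \<le> g"
  shows "u y \<le> u x + v x * (y - x) + g * (y - x)\<^sup>2 / 2"
proof -
  define \<phi> where "\<phi> = (\<lambda>t. u t - v x * (t - x) - g * (t - x)\<^sup>2 / 2)"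
  have d: "(\<phi> has_real_derivative (v t - v x - g * (t - x))) (at t within {c..d})" if "t \<in> {c..d}" for t
    unfolding \<phi>_def using c2_onD[OF assms(1) that] by (auto intro!: derivative_eq_intros)
  have "\<phi> y \<le> \<phi> x"
  proof (cases "x \<le> y")
    case True
    have "\<phi> y - \<phi> x \<le> 0 * (y - x)"
    proof (rule deriv_le[OF d])
      fix t assume t: "x < t" "t < y"
      have "v t - v x \<le> g * (t - x)"
        by (rule deriv_le[OF c2_onD(2)[OF assms(1)]]) (use assms t in auto)
      then show "v t - v x - g * (t - x) \<le> 0" by simp
    qed (use assms True in auto)
    then show ?thesis by simp
  next
    case False
    have "0 * (x - y) \<le> \<phi> x - \<phi> y"
    proof (rule deriv_ge[OF d])
      fix t assume t: "y < t" "t < x"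
      have "v x - v t \<le> g * (x - t)"
        by (rule deriv_le[OF c2_onD(2)[OF assms(1)]]) (use assms t in auto)
      then show "0 \<le> v t - v x - g * (t - x)" by (simp add: algebra_simps)
    qed (use assms False in auto)
    then show ?thesis by simp
  qed
  then show ?thesis by (simp add: \<phi>_def)
qed

lemma taylor_ge:
  assumes "c2_on c d u v A" and "x \<in> {c..d}" "y \<in> {c..d}"
    and "\<And>t. t \<in> {c..d} \<Longrightarrow> g \<le> A t"
  shows "u x + v x * (y - x) + g * (y - x)\<^sup>2 / 2 \<le> u y"
  using taylor_le[OF c2_on_minus[OF assms(1)] assms(2,3), of "-g"] assms(4) by simp

text \<open>The energy u^2 + v^2 + \<eta>^2, damped by \<open>exp (-(K + 2) * (t - c))\<close>, does
  not increase. Counting \<eta> in the energy absorbs the inhomogeneous term through 2|v|\<eta>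
  \<le> v^2 + \<eta>^2.\<close>

lemma gronwall:
  assumes "c2_on c d u v A" and "K \<ge> 0"
    and "\<And>t. t \<in> {c..d} \<Longrightarrow> \<bar>A t\<bar> \<le> K * \<bar>u t\<bar> + \<eta>" and "t \<in> {c..d}"
  shows "(u t)\<^sup>2 + (v t)\<^sup>2 + \<eta>\<^sup>2 \<le> exp ((K + 2) * (t - c)) * ((u c)\<^sup>2 + (v c)\<^sup>2 + \<eta>\<^sup>2)"
proof -
  define \<phi> where "\<phi> = (\<lambda>t. exp (-(K + 2) * (t - c)) * ((u t)\<^sup>2 + (v t)\<^sup>2 + \<eta>\<^sup>2))"
  define \<phi>' where "\<phi>' = (\<lambda>t. exp (-(K + 2) * (t - c)) *
      (2 * u t * v t + 2 * v t * A t - (K + 2) * ((u t)\<^sup>2 + (v t)\<^sup>2 + \<eta>\<^sup>2)))"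
  have d: "(\<phi> has_real_derivative \<phi>' t) (at t within {c..d})" if "t \<in> {c..d}" for t
    unfolding \<phi>_def \<phi>'_def using c2_onD[OF assms(1) that]
    by (auto intro!: derivative_eq_intros simp: algebra_simps)
  have "\<phi>' s \<le> 0" if "s \<in> {c..d}" for s
  proof -
    have "2 * u s * v s \<le> (u s)\<^sup>2 + (v s)\<^sup>2" by (rule sum_squares_bound)
    moreover have "2 * v s * A s \<le> K * ((u s)\<^sup>2 + (v s)\<^sup>2) + (v s)\<^sup>2 + \<eta>\<^sup>2"
    proof -
      have "v s * A s \<le> \<bar>v s\<bar> * \<bar>A s\<bar>" by (metis abs_ge_self abs_mult)
      also have "\<dots> \<le> \<bar>v s\<bar> * (K * \<bar>u s\<bar> + \<eta>)"
        using assms(3)[OF that] by (intro mult_left_mono) auto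
      finally have 1: "2 * v s * A s \<le> K * (2 * \<bar>u s\<bar> * \<bar>v s\<bar>) + 2 * \<bar>v s\<bar> * \<eta>"
        by (simp add: algebra_simps)
      have 2: "2 * \<bar>v s\<bar> * \<eta> \<le> (v s)\<^sup>2 + \<eta>\<^sup>2"
        using sum_squares_bound[of "\<bar>v s\<bar>" \<eta>] by simp
      have "K * (2 * \<bar>u s\<bar> * \<bar>v s\<bar>) \<le> K * ((u s)\<^sup>2 + (v s)\<^sup>2)"
        using sum_squares_bound[of "\<bar>u s\<bar>" "\<bar>v s\<bar>"] assms(2) by (intro mult_left_mono) auto
      with 1 2 show ?thesis by linarith
    qed
    moreover have "0 \<le> (K + 1) * \<eta>\<^sup>2 + (u s)\<^sup>2" using assms(2) by simp
    ultimately have "2 * u s * v s + 2 * v s * A s - (K + 2) * ((u s)\<^sup>2 + (v s)\<^sup>2 + \<eta>\<^sup>2) \<le> 0"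
      by (simp add: algebra_simps)
    then show ?thesis unfolding \<phi>'_def by (simp add: mult_nonneg_nonpos)
  qed
  then have "\<phi> t - \<phi> c \<le> 0 * (t - c)"
    using assms(4) by (intro deriv_le[OF d]) auto
  then have "\<phi> t \<le> (u c)\<^sup>2 + (v c)\<^sup>2 + \<eta>\<^sup>2" by (simp add: \<phi>_def)
  then have "exp ((K + 2) * (t - c)) * \<phi> t \<le> exp ((K + 2) * (t - c)) * ((u c)\<^sup>2 + (v c)\<^sup>2 + \<eta>\<^sup>2)"
    by (intro mult_left_mono) auto
  moreover have "exp ((K + 2) * (t - c)) * \<phi> t = (u t)\<^sup>2 + (v t)\<^sup>2 + \<eta>\<^sup>2"
    unfolding \<phi>_def mult.assoc[symmetric] mult_minus_left exp_minus_inverse by simp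
  ultimately show ?thesis by simp
qed

lemma gronwall_abs:
  assumes "c2_on c d u v A" and "K \<ge> 0" "\<eta> \<ge> 0"
    and "\<And>t. t \<in> {c..d} \<Longrightarrow> \<bar>A t\<bar> \<le> K * \<bar>u t\<bar> + \<eta>" and "t \<in> {c..d}"
    and "\<bar>u c\<bar> \<le> \<eta>" "\<bar>v c\<bar> \<le> \<eta>"
  shows "\<bar>u t\<bar> \<le> 2 * exp ((K + 2) * (d - c)) * \<eta>" "\<bar>v t\<bar> \<le> 2 * exp ((K + 2) * (d - c)) * \<eta>"
proof -
  have sq: "(u c)\<^sup>2 \<le> \<eta>\<^sup>2" "(v c)\<^sup>2 \<le> \<eta>\<^sup>2" using assms(6,7)
    by (metis abs_ge_zero power2_abs power_mono)+
  have e: "1 \<le> exp ((K + 2) * (d - c))" using assms(2,5) by auto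
  have "(u t)\<^sup>2 + (v t)\<^sup>2 + \<eta>\<^sup>2 \<le> exp ((K + 2) * (t - c)) * ((u c)\<^sup>2 + (v c)\<^sup>2 + \<eta>\<^sup>2)"
    by (rule gronwall[OF assms(1,2,4,5)])
  \<comment> \<open>Only three squares are present; the factor 4 and the squaring of the exponential
    turn the bound into a perfect square.\<close>
  also have "\<dots> \<le> exp ((K + 2) * (d - c)) * (4 * \<eta>\<^sup>2)"
  proof (rule mult_mono)
    show "(u c)\<^sup>2 + (v c)\<^sup>2 + \<eta>\<^sup>2 \<le> 4 * \<eta>\<^sup>2" using sq zero_le_power2[of \<eta>] by linarith
  qed (use assms in \<open>auto intro!: mult_left_mono\<close>)
  also have "\<dots> \<le> (exp ((K + 2) * (d - c)))\<^sup>2 * (4 * \<eta>\<^sup>2)"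
    using e by (intro mult_right_mono) (auto simp: power2_eq_square mult_le_cancel_left1)
  finally have *: "(u t)\<^sup>2 + (v t)\<^sup>2 + \<eta>\<^sup>2 \<le> (2 * exp ((K + 2) * (d - c)) * \<eta>)\<^sup>2"
    by (simp add: power_mult_distrib)
  have "(u t)\<^sup>2 \<le> (2 * exp ((K + 2) * (d - c)) * \<eta>)\<^sup>2" "(v t)\<^sup>2 \<le> (2 * exp ((K + 2) * (d - c)) * \<eta>)\<^sup>2"
    using * by (smt (verit) zero_le_power2)+
  then have "\<bar>u t\<bar> \<le> \<bar>2 * exp ((K + 2) * (d - c)) * \<eta>\<bar>" "\<bar>v t\<bar> \<le> \<bar>2 * exp ((K + 2) * (d - c)) * \<eta>\<bar>"
    by (simp_all only: abs_le_square_iff)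
  then show "\<bar>u t\<bar> \<le> 2 * exp ((K + 2) * (d - c)) * \<eta>" "\<bar>v t\<bar> \<le> 2 * exp ((K + 2) * (d - c)) * \<eta>"
    using assms(3) by (simp_all add: abs_mult)
qed

text \<open>To the right of \<open>s\<close> this is the Gronwall bound with \<eta> = 0; the left
  side is reduced to it by t -> -t.\<close>

lemma zero_unique:
  assumes "c2_on c d u v A" and "K \<ge> 0" "\<And>t. t \<in> {c..d} \<Longrightarrow> \<bar>A t\<bar> \<le> K * \<bar>u t\<bar>"
    and "s \<in> {c..d}" "u s = 0" "v s = 0" and "t \<in> {c..d}"
  shows "u t = 0" "v t = 0"
proof -
  have fwd: "u t = 0 \<and> v t = 0" if "c2_on c d u v A" "\<And>t. t \<in> {c..d} \<Longrightarrow> \<bar>A t\<bar> \<le> K * \<bar>u t\<bar>"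
    "s \<in> {c..d}" "u s = 0" "v s = 0" "t \<in> {c..d}" "s \<le> t" for c d u v A s t
  proof -
    have "c2_on s d u v A" using c2_on_subset that by (meson atLeastAtMost_iff order_refl)
    from gronwall_abs[OF this assms(2), of 0 t] that show ?thesis by auto
  qed
  have "u t = 0 \<and> v t = 0"
  proof (cases "s \<le> t")
    case True
    then show ?thesis using fwd assms by blast
  next
    case False
    have "u (- (-t)) = 0 \<and> - v (- (-t)) = 0"
      by (rule fwd[OF c2_on_reflect[OF assms(1)], of "-s"]) (use assms False in auto)
    then show ?thesis by auto
  qed
  then show "u t = 0" "v t = 0" by auto
qed

section \<open>Initial value problems\<close>

text \<open>The Picard map is a contraction for the sup norm weighted by \<open>exp (- l * (t - c))\<close> with \<open>l > 2 * K\<close>.\<close>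

lemma picard:
  fixes G :: "real \<Rightarrow> 'a :: banach \<Rightarrow> 'a"
  assumes "c \<le> d" and cont: "continuous_on ({c..d} \<times> UNIV) (\<lambda>(t, z). G t z)" and "K \<ge> 0"
    and lip: "\<And>t z z'. t \<in> {c..d} \<Longrightarrow> norm (G t z - G t z') \<le> K * norm (z - z')"
  obtains z where "z c = z0" "\<And>t. t \<in> {c..d} \<Longrightarrow> (z has_vector_derivative G t (z t)) (at t within {c..d})"
proof -
  \<comment> \<open>Elements of the function space live on the whole line; clamping the argument to
    [c, d] turns the image of the Picard map into a bounded continuous function there.\<close>
  define cl where "cl = (\<lambda>t. max c (min d t))"
  have cl: "cl t \<in> {c..d}" for t using assms(1) by (auto simp: cl_def)
  have clid: "cl t = t" if "t \<in> {c..d}" for t using that by (auto simp: cl_def)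
  have clc: "continuous_on UNIV cl" unfolding cl_def by (intro continuous_intros)
  define l where "l = 2 * K + 1"
  have l: "l > 0" "K / l \<le> 1/2" using assms(3) by (auto simp: l_def field_simps)
  define E where "E = (\<lambda>t. exp (l * (t - c)))"
  have E: "E t > 0" for t by (simp add: E_def)
  \<comment> \<open>The fixed point is stored divided by the weight \<open>E\<close>, so that the
    plain sup distance is the weighted one.\<close>
  define g where "g = (\<lambda>z r. G r (E r *\<^sub>R apply_bcontfun z r))"
  define I where "I = (\<lambda>z s. integral {c..s} (g z))"
  define \<phi> where "\<phi> = (\<lambda>z s. (1 / E s) *\<^sub>R (z0 + I z s))"
  have gc: "continuous_on {c..d} (g z)" for z
  proof -
    have "continuous_on {c..d} (\<lambda>r. (\<lambda>(t, z). G t z) (r, E r *\<^sub>R apply_bcontfun z r))"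
      by (rule continuous_on_compose2[OF cont])
        (auto simp: E_def intro!: continuous_intros)
    then show ?thesis by (simp add: g_def)
  qed
  have gi: "g z integrable_on {c..s}" if "s \<in> {c..d}" for z s
    using that by (intro integrable_continuous_interval continuous_on_subset[OF gc]) auto
  have Ic: "continuous_on {c..d} (I z)" for z
    unfolding I_def by (rule indefinite_integral_continuous_1) (use gi assms(1) in auto)
  have \<phi>c: "continuous_on {c..d} (\<phi> z)" for z
    unfolding \<phi>_def by (intro continuous_intros Ic) (auto simp: E_def intro!: continuous_intros)
  have mem: "(\<lambda>t. \<phi> z (cl t)) \<in> bcontfun" for z
  proof -
    have "continuous_on UNIV (\<lambda>t. \<phi> z (cl t))"
      by (rule continuous_on_compose2[OF \<phi>c clc]) (use cl in auto)
    moreover have "bounded (\<phi> z ` {c..d})"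
      by (intro compact_imp_bounded compact_continuous_image \<phi>c) auto
    then have "bounded (range (\<lambda>t. \<phi> z (cl t)))"
      by (rule bounded_subset) (use cl in auto)
    ultimately show ?thesis by (simp add: bcontfun_def)
  qed
  define T where "T = (\<lambda>z. Bcontfun (\<lambda>t. \<phi> z (cl t)))"
  have T: "apply_bcontfun (T z) t = \<phi> z (cl t)" for z t
    unfolding T_def by (simp add: Bcontfun_inverse[OF mem])
  have con: "dist (T z) (T y) \<le> 1/2 * dist z y" for z y
  proof (rule dist_bound)
    fix t
    define s where "s = cl t"
    have s: "s \<in> {c..d}" using cl s_def by simp
    have hi: "((\<lambda>r. K * dist z y * E r) has_integral (K * dist z y * E s / l - K * dist z y * E c / l)) {c..s}"
      by (rule fundamental_theorem_of_calculus)
        (use s l in \<open>auto simp: E_def has_real_derivative_iff_has_vector_derivative[symmetric] intro!: derivative_eq_intros\<close>)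
    have "norm (I z s - I y s) = norm (integral {c..s} (\<lambda>r. g z r - g y r))"
      unfolding I_def by (subst Henstock_Kurzweil_Integration.integral_diff) (use gi s in auto)
    also have "\<dots> \<le> integral {c..s} (\<lambda>r. K * dist z y * E r)"
    proof (rule integral_norm_bound_integral)
      show "(\<lambda>r. g z r - g y r) integrable_on {c..s}" by (intro integrable_diff gi s)
      show "(\<lambda>r. K * dist z y * E r) integrable_on {c..s}" using hi by blast
      fix r assume r: "r \<in> {c..s}"
      have "norm (g z r - g y r) \<le> K * norm (E r *\<^sub>R apply_bcontfun z r - E r *\<^sub>R apply_bcontfun y r)"
        unfolding g_def using r s by (intro lip) auto
      also have "norm (E r *\<^sub>R apply_bcontfun z r - E r *\<^sub>R apply_bcontfun y r) = E r * dist (apply_bcontfun z r) (apply_bcontfun y r)"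
        using E[of r] by (simp add: dist_norm scaleR_diff_right[symmetric])
      also have "K * \<dots> \<le> K * (E r * dist z y)"
        using assms(3) E[of r] by (intro mult_left_mono dist_bounded) auto
      finally show "norm (g z r - g y r) \<le> K * dist z y * E r" by (simp add: algebra_simps)
    qed
    also have "\<dots> = K * dist z y * E s / l - K * dist z y * E c / l" using hi by (rule integral_unique)
    also have "\<dots> \<le> K / l * dist z y * E s" using assms(3) l E[of c] by simp
    also have "\<dots> \<le> 1/2 * dist z y * E s" using l E[of s]
      by (intro mult_right_mono) auto
    finally have *: "norm (I z s - I y s) \<le> 1/2 * dist z y * E s" .
    have "dist (apply_bcontfun (T z) t) (apply_bcontfun (T y) t) = norm ((1 / E s) *\<^sub>R (I z s - I y s))"
      unfolding T s_def[symmetric] \<phi>_def dist_norm by (simp add: algebra_simps)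
    also have "\<dots> = norm (I z s - I y s) / E s" using E[of s] by (simp add: divide_inverse mult.commute)
    also have "\<dots> \<le> 1/2 * dist z y" using * E[of s] by (simp add: field_simps)
    finally show "dist (apply_bcontfun (T z) t) (apply_bcontfun (T y) t) \<le> 1/2 * dist z y" .
  qed
  have "\<exists>!z. T z = z" by (rule banach_fix_type[of "1/2"]) (use con in auto)
  then obtain z where z: "T z = z" by blast
  define y where "y = (\<lambda>t. E t *\<^sub>R apply_bcontfun z t)"
  have y: "y t = z0 + integral {c..t} (\<lambda>r. G r (y r))" if "t \<in> {c..d}" for t
  proof -
    have "apply_bcontfun z t = \<phi> z t" using T[of z t] z clid[OF that] by simp
    then have "y t = z0 + I z t" unfolding y_def \<phi>_def using E[of t] by simp
    then show ?thesis by (simp add: I_def g_def y_def)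
  qed
  have yc: "continuous_on {c..d} (\<lambda>r. G r (y r))" using gc[of z] by (simp add: g_def y_def)
  show thesis
  proof (rule that)
    show "y c = z0" using y[of c] assms(1) by simp
    fix t assume t: "t \<in> {c..d}"
    have "((\<lambda>t. z0 + integral {c..t} (\<lambda>r. G r (y r))) has_vector_derivative G t (y t)) (at t within {c..d})"
      using integral_has_vector_derivative[OF yc t] by (auto intro!: derivative_eq_intros)
    then show "(y has_vector_derivative G t (y t)) (at t within {c..d})"
      using y t by (metis (no_types, lifting) has_vector_derivative_transform)
  qed
qed

lemma ivp_exists:
  fixes F :: "real \<Rightarrow> real \<Rightarrow> real"
  assumes "c \<le> d" and cont: "continuous_on ({c..d} \<times> UNIV) (\<lambda>(t, x). F t x)" and "K \<ge> 0"
    and lip: "\<And>t x y. t \<in> {c..d} \<Longrightarrow> \<bar>F t x - F t y\<bar> \<le> K * \<bar>x - y\<bar>"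
  obtains u v where "c2_on c d u v (\<lambda>t. F t (u t))" "u c = x0" "v c = y0"
proof -
  define G where "G = (\<lambda>t (z::real \<times> real). (snd z, F t (fst z)))"
  obtain z where z: "z c = (x0, y0)"
    "\<And>t. t \<in> {c..d} \<Longrightarrow> (z has_vector_derivative G t (z t)) (at t within {c..d})"
  proof (rule picard[OF assms(1), of G "K + 1" "(x0, y0)"])
    have "continuous_on ({c..d} \<times> UNIV) (\<lambda>x. (\<lambda>(t, x). F t x) (fst x, fst (snd x)))"
      by (rule continuous_on_compose2[OF cont]) (auto intro!: continuous_intros)
    then show "continuous_on ({c..d} \<times> UNIV) (\<lambda>(t, z). G t z)"
      unfolding G_def case_prod_beta by (auto intro!: continuous_intros)
    fix t z z' assume t: "t \<in> {c..d}"
    have "norm (G t z - G t z') \<le> \<bar>snd (z - z')\<bar> + \<bar>F t (fst z) - F t (fst z')\<bar>"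
      unfolding G_def using norm_Pair_le[of "snd z - snd z'" "F t (fst z) - F t (fst z')"] by simp
    also have "\<dots> \<le> \<bar>snd (z - z')\<bar> + K * \<bar>fst (z - z')\<bar>" using lip[OF t] by simp
    also have "\<dots> \<le> norm (z - z') + K * norm (z - z')"
      using norm_fst_le[of "fst (z - z')" "snd (z - z')"] norm_snd_le[of "snd (z - z')" "fst (z - z')"] assms(3)
      unfolding prod.collapse real_norm_def by (intro add_mono mult_left_mono)
    finally show "norm (G t z - G t z') \<le> (K + 1) * norm (z - z')" by (simp add: algebra_simps)
  qed (use assms(3) in auto)
  show thesis
  proof (rule that[of "\<lambda>t. fst (z t)" "\<lambda>t. snd (z t)"])
    show "c2_on c d (\<lambda>t. fst (z t)) (\<lambda>t. snd (z t)) (\<lambda>t. F t (fst (z t)))"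
      unfolding c2_on_def has_real_derivative_iff_has_vector_derivative
    proof (intro ballI conjI)
      fix t assume t: "t \<in> {c..d}"
      show "((\<lambda>t. fst (z t)) has_vector_derivative snd (z t)) (at t within {c..d})"
        using bounded_linear.has_vector_derivative[OF bounded_linear_fst z(2)[OF t]] by (simp add: G_def)
      show "((\<lambda>t. snd (z t)) has_vector_derivative F t (fst (z t))) (at t within {c..d})"
        using bounded_linear.has_vector_derivative[OF bounded_linear_snd z(2)[OF t]] by (simp add: G_def)
    qed
  qed (use z in auto)
qed

lemma linear_ivp:
  fixes r :: "real \<Rightarrow> real"
  assumes "c \<le> d" "continuous_on {c..d} r" "\<And>t. t \<in> {c..d} \<Longrightarrow> \<bar>r t\<bar> \<le> K"
  obtains w w' where "c2_on c d w w' (\<lambda>t. - (r t * w t))" "w c = x0" "w' c = y0"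
proof -
  have "continuous_on ({c..d} \<times> UNIV) (\<lambda>(t, x). - (r t * x))"
    unfolding case_prod_beta by (intro continuous_intros continuous_on_compose2[OF assms(2)]) auto
  then show thesis
  proof (rule ivp_exists[OF assms(1), of _ K x0 y0])
    show "0 \<le> K" using assms(1) assms(3)[of c] by auto
    show "\<bar>- (r t * x) - - (r t * y)\<bar> \<le> K * \<bar>x - y\<bar>" if "t \<in> {c..d}" for t x y
      using mult_right_mono[OF assms(3)[OF that], of "\<bar>x - y\<bar>"]
      by (simp add: abs_mult[symmetric] right_diff_distrib abs_minus_commute)
  qed (rule that)
qed

section \<open>The truncated power nonlinearity\<close>

text \<open>Only the point 0 needs an argument: there the difference quotient is at most |h|^(q-1),
  which tends to 0 because q > 1.\<close>

lemma has_real_derivative_pos_part_powr: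
  fixes q x :: real
  assumes "q > 1"
  shows "((\<lambda>x. max x 0 powr q) has_real_derivative q * max x 0 powr (q - 1)) (at x)"
proof -
  consider "x > 0" | "x < 0" | "x = 0" by linarith
  then show ?thesis
  proof cases
    case 1
    have "((\<lambda>x. x powr q) has_real_derivative q * x powr (q - 1)) (at x)"
      by (rule has_real_derivative_powr[OF 1])
    then have "((\<lambda>x. max x 0 powr q) has_real_derivative q * x powr (q - 1)) (at x)"
      by (rule has_field_derivative_transform_within_open[of _ _ _ "{0<..}"]) (use 1 in auto)
    then show ?thesis using 1 by simp
  next
    case 2
    have "((\<lambda>x. 0) has_real_derivative 0) (at x)" by simp
    then have "((\<lambda>x. max x 0 powr q) has_real_derivative 0) (at x)"
      by (rule has_field_derivative_transform_within_open[of _ _ _ "{..<0}"]) (use 2 in auto)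
    then show ?thesis using 2 by simp
  next
    case 3
    have "((\<lambda>h. \<bar>h\<bar> powr (q - 1)) \<longlongrightarrow> \<bar>0::real\<bar> powr (q - 1)) (at 0)"
      by (rule tendsto_powr') (use assms in \<open>auto intro!: tendsto_rabs_zero tendsto_ident_at\<close>)
    then have lim: "((\<lambda>h::real. \<bar>h\<bar> powr (q - 1)) \<longlongrightarrow> 0) (at 0)" by simp
    have "((\<lambda>h. (max h 0 powr q) / h) \<longlongrightarrow> 0) (at 0)"
    proof (rule Lim_null_comparison[OF _ lim])
      have "norm (max h 0 powr q / h) \<le> \<bar>h\<bar> powr (q - 1)" if "h \<noteq> 0" for h :: real
        using that by (cases "h > 0") (simp add: powr_diff, simp add: max_def)
      then show "\<forall>\<^sub>F h in at 0. norm (max h 0 powr q / h) \<le> \<bar>h\<bar> powr (q - 1)"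
        by (auto simp: eventually_at_filter)
    qed
    then show ?thesis using 3 assms by (simp add: DERIV_def)
  qed
qed

locale truncated_power =
  fixes p R :: real
  assumes p: "p > 1" and R: "R > 0"
begin

text \<open>The continuation of \<open>x\<^sup>p\<close> beyond \<open>R\<close> is linear, so that initial value problems have global solutions, and
  it keeps \<open>f x / x\<close> monotone, so that the a priori bound for positive solutions still holds.\<close>

definition f :: "real \<Rightarrow> real" where
  "f x = max (min x R) 0 powr p + R powr (p - 1) * max (x - R) 0"

text \<open>This is the derivative of \<open>f\<close> below \<open>R\<close> only, since
  \<open>f\<close> has a corner at \<open>R\<close>; hence the later care to keep arguments below
  \<open>R\<close>.\<close>

definition g :: "real \<Rightarrow> real" where
  "g x = p * max x 0 powr (p - 1)"

definition K :: real where "K = p * R powr (p - 1)"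

text \<open>The value on the diagonal makes the linearised equation the special case of two equal
  solutions.\<close>

definition dq :: "real \<Rightarrow> real \<Rightarrow> real" where
  "dq x y = (if x = y then g x else (f x - f y) / (x - y))"

lemma f_nonpos: "x \<le> 0 \<Longrightarrow> f x = 0"
  using R by (auto simp: f_def max_def min_def)

lemma f_powr: "0 \<le> x \<Longrightarrow> x \<le> R \<Longrightarrow> f x = x powr p"
  by (auto simp: f_def)

lemma f_eq: "0 \<le> x \<Longrightarrow> f x = x * min x R powr (p - 1)"
proof -
  assume x: "0 \<le> x"
  have *: "y powr p = y * y powr (p - 1)" if "y \<ge> 0" for y :: real
    using that by (cases "y = 0") (auto simp: powr_diff)
  show ?thesis
    using x R *[of x] *[of R] by (cases "x \<le> R") (auto simp: f_def min_def algebra_simps)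
qed

lemma f_nonneg: "0 \<le> f x"
  using R by (simp add: f_def)

lemma f_pos: "0 < x \<Longrightarrow> 0 < f x"
  using R by (simp add: f_eq)

lemma f_mono: "x \<le> y \<Longrightarrow> f x \<le> f y"
  unfolding f_def using R p
  by (intro add_mono powr_mono2 mult_left_mono) auto

lemma g_nonneg: "0 \<le> g x"
  using p by (simp add: g_def)

lemma g_le_K: "x \<le> R \<Longrightarrow> g x \<le> K"
  unfolding g_def K_def using p R by (intro mult_left_mono powr_mono2) auto

lemma g_mono: "x \<le> y \<Longrightarrow> g x \<le> g y"
  unfolding g_def using p by (intro mult_left_mono powr_mono2) auto

lemma K_pos: "K > 0"
  using p R by (simp add: K_def)

lemma f_deriv: "x < R \<Longrightarrow> (f has_real_derivative g x) (at x)"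
proof -
  assume x: "x < R"
  have "((\<lambda>x. max x 0 powr p) has_real_derivative g x) (at x)"
    unfolding g_def by (rule has_real_derivative_pos_part_powr[OF p])
  then show ?thesis
    by (rule has_field_derivative_transform_within_open[of _ _ _ "{..<R}"]) (use x in \<open>auto simp: f_def\<close>)
qed

lemma f_diff_powr:
  assumes "x \<le> y" "y \<le> R"
  shows "f y - f x \<le> K * (y - x)"
proof -
  have "(\<lambda>x. max x 0 powr p) y - (\<lambda>x. max x 0 powr p) x \<le> K * (y - x)"
  proof (rule deriv_le[of x y])
    fix t assume "t \<in> {x..y}"
    show "((\<lambda>x. max x 0 powr p) has_real_derivative g t) (at t within {x..y})"
      unfolding g_def by (rule has_field_derivative_at_within[OF has_real_derivative_pos_part_powr[OF p]])
  qed (use assms g_le_K in auto)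
  then show ?thesis using assms by (simp add: f_def)
qed

lemma f_diff:
  assumes "x \<le> y"
  shows "f y - f x \<le> K * (y - x)"
proof -
  have big: "f z - f y \<le> K * (z - y)" if "R \<le> y" "y \<le> z" for y z
  proof -
    have "f z - f y = R powr (p - 1) * (z - y)" using that by (simp add: f_def algebra_simps)
    also have "\<dots> \<le> K * (z - y)" using that p R unfolding K_def by (intro mult_right_mono) auto
    finally show ?thesis .
  qed
  consider "y \<le> R" | "x \<le> R" "R \<le> y" | "R \<le> x" by linarith
  then show ?thesis
  proof cases
    case 2
    then show ?thesis using f_diff_powr[of x R] big[of R y] by (simp add: algebra_simps)
  qed (use f_diff_powr big assms in auto)
qed

lemma f_lipschitz: "\<bar>f x - f y\<bar> \<le> K * \<bar>x - y\<bar>"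
  using f_diff[of x y] f_diff[of y x] f_mono[of x y] f_mono[of y x] by (cases "x \<le> y") auto

lemma f_bound: "\<bar>f x\<bar> \<le> K * \<bar>x\<bar>"
  using f_lipschitz[of x 0] f_nonpos[of 0] by simp

lemma f_cont: "continuous_on S f"
  unfolding f_def using p by (auto intro!: continuous_intros continuous_on_powr')

lemma g_cont: "continuous_on S g"
  unfolding g_def using p by (auto intro!: continuous_intros continuous_on_powr')

lemma dq_mult: "dq x y * (x - y) = f x - f y"
  by (simp add: dq_def)

lemma dq_sym: "dq x y = dq y x"
  by (simp add: dq_def) (metis minus_diff_eq minus_divide_divide)

lemma dq_self: "dq x x = g x"
  by (simp add: dq_def)

lemma dq_nonneg: "0 \<le> dq x y"
  using f_mono[of x y] f_mono[of y x] g_nonneg[of x]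
  by (cases "x \<le> y") (auto simp: dq_def zero_le_divide_iff)

lemma dq_le_K: "x \<le> R \<Longrightarrow> dq x y \<le> K"
proof (cases "x = y")
  case False
  have "\<bar>f x - f y\<bar> / \<bar>x - y\<bar> \<le> K" using False f_lipschitz[of x y] by (simp add: field_simps)
  then show ?thesis using False by (simp add: dq_def abs_divide[symmetric] del: abs_divide)
qed (simp add: dq_def g_le_K)

lemma dq_mvt:
  assumes "x < R" "y < R"
  shows "\<exists>z. min x y \<le> z \<and> z \<le> max x y \<and> dq x y = g z"
proof -
  have *: "\<exists>z. x \<le> z \<and> z \<le> y \<and> dq x y = g z" if "x < y" "y < R" for x y
  proof -
    have "\<exists>t. x < t \<and> t < y \<and> f y - f x = g t * (y - x)"
      by (rule mvt_within[of x y]) (use that f_deriv in \<open>auto intro: has_field_derivative_at_within\<close>)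
    then obtain t where t: "x < t" "t < y" "f y - f x = g t * (y - x)" by blast
    then have "dq x y = g t" using that by (simp add: dq_def field_simps)
    then show ?thesis using t by (meson less_imp_le)
  qed
  consider "x < y" | "y < x" | "x = y" by linarith
  then show ?thesis
  proof cases
    case 1 then show ?thesis using *[of x y] assms by auto
  next
    case 2 then show ?thesis using *[of y x] assms dq_sym[of x y] by auto
  next
    case 3 then show ?thesis by (auto simp: dq_self)
  qed
qed

text \<open>By convexity, a chord with one end over \<open>x\<close> is at least as steep as the
  chord from 0 to \<open>x\<close>. This lets a solution serve as comparison function for the linear
  equation in \<open>boundary_layer\<close>.\<close>

lemma dq_ge:
  assumes "0 \<le> x" "x \<le> R" "0 \<le> y" "y \<le> R"
  shows "x powr (p - 1) \<le> dq x y"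
proof -
  have *: "z powr p = z * z powr (p - 1)" if "z \<ge> 0" for z :: real
    using that by (cases "z = 0") (auto simp: powr_diff)
  consider "x < y" | "y < x" | "x = y" by linarith
  then show ?thesis
  proof cases
    case 1
    have "x powr (p - 1) * y \<le> y powr (p - 1) * y"
      using 1 assms p by (intro mult_right_mono powr_mono2) auto
    then have "x powr (p - 1) * (y - x) \<le> f y - f x"
      using assms by (simp add: f_powr * algebra_simps)
    then show ?thesis using 1 dq_mult[of y x] dq_sym[of x y]
      by (metis diff_gt_0_iff_gt mult_le_cancel_right_pos)
  next
    case 2
    have "y powr (p - 1) * y \<le> x powr (p - 1) * y"
      using 2 assms p by (intro mult_right_mono powr_mono2) auto
    then have "x powr (p - 1) * (x - y) \<le> f x - f y"
      using assms by (simp add: f_powr * algebra_simps)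
    then show ?thesis using 2 dq_mult[of x y]
      by (metis diff_gt_0_iff_gt mult_le_cancel_right_pos)
  next
    case 3
    then show ?thesis using assms p by (simp add: dq_self g_def mult_le_cancel_right1)
  qed
qed

text \<open>The difference quotient is a value of \<open>g\<close> between the two arguments, and
  \<open>g\<close> is uniformly continuous on compact sets.\<close>

lemma dq_uniform:
  assumes "e > 0"
  shows "\<exists>d>0. \<forall>x y z. 0 \<le> z \<and> z < R \<and> x < R \<and> y < R \<and> \<bar>x - z\<bar> \<le> d \<and> \<bar>y - z\<bar> \<le> d \<longrightarrow> \<bar>dq x y - g z\<bar> \<le> e"
proof -
  \<comment> \<open>The margin below 0 admits arguments close to \<open>z\<close> that are slightly
    negative.\<close>
  have "uniformly_continuous_on {-1..R} g"
    by (intro compact_uniformly_continuous g_cont) auto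
  then obtain d where d: "d > 0" "\<And>x x'. x \<in> {-1..R} \<Longrightarrow> x' \<in> {-1..R} \<Longrightarrow> dist x' x < d \<Longrightarrow> dist (g x') (g x) < e"
    unfolding uniformly_continuous_on_def using assms by metis
  show ?thesis
  proof (intro exI[of _ "min (d / 2) 1"] conjI allI impI)
    fix x y z assume *: "0 \<le> z \<and> z < R \<and> x < R \<and> y < R \<and> \<bar>x - z\<bar> \<le> min (d / 2) 1 \<and> \<bar>y - z\<bar> \<le> min (d / 2) 1"
    then obtain w where w: "min x y \<le> w" "w \<le> max x y" "dq x y = g w" using dq_mvt by blast
    have "w - z \<le> d / 2 \<and> z - w \<le> d / 2 \<and> z - w \<le> 1"
      using w(1,2) * by (auto simp: min_def max_def abs_le_iff split: if_splits)
    then have "dist (g w) (g z) < e"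
      by (intro d(2)) (use w * d(1) in \<open>auto simp: dist_real_def\<close>)
    then show "\<bar>dq x y - g z\<bar> \<le> e" by (simp add: w dist_real_def)
  qed (use d in auto)
qed

lemma force_bound:
  assumes "\<bar>q\<bar> \<le> B"
  shows "\<bar>- (q * f x) - - (q * f y)\<bar> \<le> B * K * \<bar>x - y\<bar>"
proof -
  have "\<bar>- (q * f x) - - (q * f y)\<bar> = \<bar>q\<bar> * \<bar>f x - f y\<bar>"
    by (simp add: abs_mult[symmetric] right_diff_distrib abs_minus_commute)
  also have "\<dots> \<le> B * (K * \<bar>x - y\<bar>)"
    using assms f_lipschitz by (intro mult_mono) auto
  finally show ?thesis by (simp add: mult.assoc)
qed

text \<open>Truncation makes \<open>f\<close> globally Lipschitz, so the constant does not depend on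
  the solutions. Continuity of all shooting maps rests on this.\<close>

lemma force_stable:
  assumes u: "c2_on c d u v (\<lambda>t. - (q t * f (u t)))" and u': "c2_on c d u' v' (\<lambda>t. - (q t * f (u' t)))"
    and q: "\<And>t. \<bar>q t\<bar> \<le> B" and \<eta>: "\<bar>u c - u' c\<bar> \<le> \<eta>" "\<bar>v c - v' c\<bar> \<le> \<eta>" and t: "t \<in> {c..d}"
  shows "\<bar>u t - u' t\<bar> \<le> 2 * exp ((B * K + 2) * (d - c)) * \<eta>"
proof (rule gronwall_abs(1)[OF c2_on_diff[OF u u']])
  fix s
  show "\<bar>- (q s * f (u s)) - - (q s * f (u' s))\<bar> \<le> B * K * \<bar>u s - u' s\<bar> + \<eta>"
    using force_bound[OF q, of s "u s" "u' s"] \<eta>(1) by simp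
  show "0 \<le> B * K" using q[of c] K_pos by simp
qed (use \<eta> t in auto)

lemma force_unique:
  assumes u: "c2_on c d u v (\<lambda>t. - (q t * f (u t)))" and u': "c2_on c d u' v' (\<lambda>t. - (q t * f (u' t)))"
    and q: "\<And>t. \<bar>q t\<bar> \<le> B" and s: "s \<in> {c..d}" "u s = u' s" "v s = v' s" and t: "t \<in> {c..d}"
  shows "u t = u' t" "v t = v' t"
proof -
  have "0 \<le> B * K" using q[of c] K_pos by simp
  then have "u t - u' t = 0" "v t - v' t = 0"
    using zero_unique[OF c2_on_diff[OF u u'], of "B * K" s t] force_bound[OF q] s t by simp_all
  then show "u t = u' t" "v t = v' t" by auto
qed

lemma force_ivp:
  assumes "c \<le> d" "continuous_on UNIV q" "\<And>t. \<bar>q t\<bar> \<le> B"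
  obtains u v where "c2_on c d u v (\<lambda>t. - (q t * f (u t)))" "u c = x" "v c = y"
proof -
  have "continuous_on ({c..d} \<times> UNIV) (\<lambda>(t, x). - (q t * f x))"
    unfolding case_prod_beta
    by (intro continuous_intros continuous_on_compose2[OF f_cont[of UNIV]] continuous_on_compose2[OF assms(2)]) auto
  then show thesis
    using ivp_exists[of c d "\<lambda>t x. - (q t * f x)" "B * K" x y] assms(1) force_bound[OF assms(3)]
      assms(3)[of c] K_pos that by (metis abs_ge_zero less_imp_le mult_nonneg_nonneg order_trans)
qed

end

section \<open>The Dirichlet problem on one positive hump\<close>

lemma first_zero:
  fixes d :: "real \<Rightarrow> real"
  assumes "continuous_on {x..y} d" "x \<le> y" "d x > 0" "d y \<le> 0"
  obtains z where "x < z" "z \<le> y" "d z = 0" "\<And>t. x \<le> t \<Longrightarrow> t < z \<Longrightarrow> d t > 0"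
proof -
  define S where "S = {t \<in> {x..y}. d t \<le> 0}"
  have "closed S" unfolding S_def
    by (rule continuous_on_closed_Collect_le) (use assms in \<open>auto intro!: continuous_intros\<close>)
  then have "compact S" by (rule compact_eq_bounded_closed[THEN iffD2, OF conjI, rotated])
    (auto intro: bounded_subset[OF bounded_closed_interval[of x y]] simp: S_def)
  moreover have "y \<in> S" using assms by (simp add: S_def)
  ultimately obtain z where z: "z \<in> S" "\<And>t. t \<in> S \<Longrightarrow> z \<le> t"
    using compact_attains_inf[of S] by blast
  have pos: "d t > 0" if "x \<le> t" "t < z" for t
    using z that by (force simp: S_def)
  have zS: "x \<le> z" "z \<le> y" "d z \<le> 0" using z(1) by (auto simp: S_def)
  then have xz: "x < z" using assms(3) by (cases "x = z") auto
  have "d z = 0"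
  proof (rule ccontr)
    assume "d z \<noteq> 0"
    then have "d z < 0" using zS by simp
    have "\<exists>t\<ge>x. t \<le> z \<and> d t = 0"
      by (rule IVT2') (use zS assms(3) \<open>d z < 0\<close> in \<open>auto intro: continuous_on_subset[OF assms(1)]\<close>)
    then obtain t where "x \<le> t" "t \<le> z" "d t = 0" by blast
    with pos[of t] \<open>d z < 0\<close> show False by (cases "t = z") auto
  qed
  then show thesis using that[of z] xz zS(2) pos by blast
qed

lemma first_zero_deriv:
  fixes d :: "real \<Rightarrow> real"
  assumes "continuous_on {x..y} d" "x < y" "d x = 0" "d y \<le> 0"
    and "(d has_real_derivative D) (at x within {x..y})" "D > 0"
  obtains z where "x < z" "z \<le> y" "d z = 0" "\<And>t. x < t \<Longrightarrow> t < z \<Longrightarrow> d t > 0"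
proof -
  from has_real_derivative_pos_inc_right[OF assms(5,6)] obtain e where
    e: "e > 0" "\<And>h. 0 < h \<Longrightarrow> x + h \<in> {x..y} \<Longrightarrow> h < e \<Longrightarrow> d x < d (x + h)" by blast
  define x' where "x' = x + min (e / 2) (y - x)"
  have x': "x < x'" "x' \<le> y" "x' < x + e" using e assms by (auto simp: x'_def)
  have e': "d t > 0" if "x < t" "t \<le> x'" for t
    using e(2)[of "t - x"] that x' assms(3) by auto
  obtain z where z: "x' < z" "z \<le> y" "d z = 0" "\<And>t. x' \<le> t \<Longrightarrow> t < z \<Longrightarrow> d t > 0"
    by (rule first_zero[of x' y d]) (use x' assms e' in \<open>auto intro: continuous_on_subset\<close>)
  show thesis using that[of z] z x' e' by (metis less_trans linear)
qed

lemma deriv_at_first_zero: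
  fixes d :: "real \<Rightarrow> real"
  assumes "(d has_real_derivative D) (at z within {a..b})" "a \<le> x" "x < z" "z \<le> b" "d z = 0"
    and "\<And>t. x < t \<Longrightarrow> t < z \<Longrightarrow> d t > 0"
  shows "D \<le> 0"
proof (rule ccontr)
  assume "\<not> D \<le> 0"
  then have "D > 0" by simp
  from has_real_derivative_pos_inc_left[OF assms(1) this] obtain e where
    e: "e > 0" "\<And>h. 0 < h \<Longrightarrow> z - h \<in> {a..b} \<Longrightarrow> h < e \<Longrightarrow> d (z - h) < d z" by blast
  define h where "h = min (e / 2) ((z - x) / 2)"
  have "0 < h" "z - h \<in> {a..b}" "h < e" "x < z - h" "z - h < z"
    using e assms by (auto simp: h_def min_def field_simps)
  then show False using e(2)[of h] assms(5) assms(6)[of "z - h"] by linarith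
qed

text \<open>After the downward crossing at \<open>x\<close> the function is negative, so its next
  zero is reached from below, where a downward crossing is impossible. A sign condition on quotients
  takes the place of a negative derivative, so that the shooting map need not be
  differentiated.\<close>

lemma no_two_decreasing_zeros:
  fixes F :: "real \<Rightarrow> real"
  assumes "continuous_on {x..y} F" "x < y" "F x = 0" "F y = 0"
    and "\<And>z. z \<in> {x..y} \<Longrightarrow> F z = 0 \<Longrightarrow> \<exists>d>0. \<forall>t\<in>{x..y}. t \<noteq> z \<and> \<bar>t - z\<bar> < d \<longrightarrow> F t / (t - z) < 0"
  shows False
proof -
  obtain d where d: "d > 0" "\<And>t. t \<in> {x..y} \<Longrightarrow> t \<noteq> x \<Longrightarrow> \<bar>t - x\<bar> < d \<Longrightarrow> F t / (t - x) < 0"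
    using assms(5)[of x] assms by auto
  define x' where "x' = x + min (d / 2) (y - x)"
  have x': "x < x'" "x' \<le> y" "x' < x + d" using d assms by (auto simp: x'_def)
  have "F x' < 0" using d(2)[of x'] x' by (auto simp: divide_less_0_iff)
  obtain z where z: "x' < z" "z \<le> y" "- F z = 0" "\<And>t. x' \<le> t \<Longrightarrow> t < z \<Longrightarrow> - F t > 0"
    by (rule first_zero[of x' y "\<lambda>t. - F t"])
      (use x' assms \<open>F x' < 0\<close> in \<open>auto intro: continuous_on_subset continuous_on_minus\<close>)
  obtain e where e: "e > 0" "\<And>t. t \<in> {x..y} \<Longrightarrow> t \<noteq> z \<Longrightarrow> \<bar>t - z\<bar> < e \<Longrightarrow> F t / (t - z) < 0"
    using assms(5)[of z] z x' by auto
  define t where "t = max x' (z - e / 2)"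
  have t: "x' \<le> t" "t < z" "z - e < t" using z e by (auto simp: t_def)
  then have "F t / (t - z) < 0" using e(2)[of t] z x' by auto
  with t(2) have "F t > 0" by (auto simp: divide_less_0_iff)
  with z(4)[OF t(1,2)] show False by simp
qed

text \<open>The hump is centred at 0: reflection becomes t -> -t, and an even solution is determined
  by its height at the centre.\<close>

locale cos_problem = truncated_power +
  fixes \<omega> :: real
  assumes \<omega>: "\<omega> > 0"
begin

definition H :: real where "H = pi / (2 * \<omega>)"

lemma H: "H > 0" using \<omega> by (simp add: H_def)

lemma cos_pos: "-H < t \<Longrightarrow> t < H \<Longrightarrow> cos (\<omega> * t) > 0"
  using \<omega> by (intro cos_gt_zero_pi) (auto simp: H_def field_simps)

lemma cos_nonneg: "-H \<le> t \<Longrightarrow> t \<le> H \<Longrightarrow> cos (\<omega> * t) \<ge> 0"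
  using \<omega> by (intro cos_ge_zero) (auto simp: H_def field_simps)

lemma sin_pos: "0 < t \<Longrightarrow> t \<le> H \<Longrightarrow> sin (\<omega> * t) > 0"
proof -
  assume t: "0 < t" "t \<le> H"
  then have "\<omega> * t \<le> pi / 2" using \<omega> by (simp add: H_def field_simps)
  then have "\<omega> * t < pi" using pi_gt_zero by linarith
  then show ?thesis using \<omega> t by (intro sin_gt_zero) auto
qed

abbreviation cos_eq :: "real \<Rightarrow> real \<Rightarrow> (real \<Rightarrow> real) \<Rightarrow> (real \<Rightarrow> real) \<Rightarrow> bool" where
  "cos_eq c d u v \<equiv> c2_on c d u v (\<lambda>t. - (cos (\<omega> * t) * f (u t)))"

abbreviation cos_lin :: "(real \<Rightarrow> real) \<Rightarrow> real \<Rightarrow> real \<Rightarrow> (real \<Rightarrow> real) \<Rightarrow> (real \<Rightarrow> real) \<Rightarrow> bool" where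
  "cos_lin u c d w w' \<equiv> c2_on c d w w' (\<lambda>t. - (cos (\<omega> * t) * g (u t) * w t))"

text \<open>The right half of an even positive Dirichlet solution; the bound by \<open>R\<close>
  keeps it where \<open>f\<close> is the power.\<close>

definition half_sol :: "(real \<Rightarrow> real) \<Rightarrow> (real \<Rightarrow> real) \<Rightarrow> bool" where
  "half_sol u v \<longleftrightarrow> cos_eq 0 H u v \<and> v 0 = 0 \<and> u H = 0 \<and>
     (\<forall>t. 0 \<le> t \<and> t < H \<longrightarrow> 0 < u t \<and> u t < R)"

section \<open>The linearised equation on half of the hump\<close>

lemma half_sol_range:
  assumes "half_sol u v" "t \<in> {0..H}"
  shows "0 \<le> u t" "u t < R"
  using assms R unfolding half_sol_def by (cases "t = H"; force)+

lemma deriv_strict_mono: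
  assumes u: "cos_eq c d u v" and cd: "-H \<le> c" "c \<le> s" "s < t" "t \<le> d" "d \<le> H"
    and pos: "\<And>r. s < r \<Longrightarrow> r < t \<Longrightarrow> 0 < u r"
  shows "v t < v s"
proof -
  have "v t - v s < 0 * (t - s)"
  proof (rule deriv_lt[OF c2_onD(2)[OF u]])
    fix r assume r: "s < r" "r < t"
    then have "cos (\<omega> * r) > 0" using cd by (intro cos_pos) auto
    then show "- (cos (\<omega> * r) * f (u r)) < 0" using f_pos[OF pos[OF r]] by simp
  qed (use cd in auto)
  then show ?thesis by simp
qed

lemma half_sol_deriv_mono:
  assumes "half_sol u v" "0 \<le> s" "s < t" "t \<le> H"
  shows "v t < v s"
  by (rule deriv_strict_mono[of 0 H u v]) (use assms H in \<open>auto simp: half_sol_def\<close>)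

lemma half_sol_deriv_neg:
  assumes "half_sol u v" "0 < t" "t \<le> H"
  shows "v t < 0"
  using half_sol_deriv_mono[OF assms(1), of 0 t] assms by (auto simp: half_sol_def)

lemma g_times: "0 \<le> x \<Longrightarrow> x \<le> R \<Longrightarrow> g x * x = p * f x"
  using R by (auto simp: g_def f_eq)

lemma accel_deriv:
  assumes "cos_eq c d u v" "t \<in> {c..d}" "u t < R"
  shows "((\<lambda>t. - (cos (\<omega> * t) * f (u t))) has_real_derivative
    \<omega> * sin (\<omega> * t) * f (u t) - cos (\<omega> * t) * g (u t) * v t) (at t within {c..d})"
proof -
  have "((\<lambda>t. f (u t)) has_real_derivative g (u t) * v t) (at t within {c..d})"
    using DERIV_chain2[OF f_deriv[OF assms(3)] c2_onD(1)[OF assms(1,2)]] .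
  then show ?thesis by (auto intro!: derivative_eq_intros)
qed

lemma linearised_bound:
  assumes "\<bar>y\<bar> \<le> 1" "u \<le> R"
  shows "\<bar>- (y * g u * w)\<bar> \<le> K * \<bar>w\<bar>"
  unfolding abs_minus_cancel abs_mult
proof (rule mult_right_mono)
  have "\<bar>y\<bar> * \<bar>g u\<bar> \<le> 1 * K" using assms g_le_K g_nonneg by (intro mult_mono) auto
  then show "\<bar>y\<bar> * \<bar>g u\<bar> \<le> K" by simp
qed auto

text \<open>\<open>w\<close> has a zero \<open>z1 < H\<close> by comparison with \<open>u\<close>. For a second zero \<open>z2\<close>, compare with \<open>V t = t * u' t + c * u t\<close>,
  where \<open>c\<close> makes \<open>V z1 = 0\<close>. The linearised operator maps \<open>V\<close> to \<open>G t * f (u t)\<close>, and \<open>G\<close> changes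
  sign at most once, from negative to positive.\<close>

lemma half_sol_nondegenerate_even:
  assumes u: "half_sol u v" and w: "cos_lin u 0 H w w'"
    and w0: "w 0 = 1" "w' 0 = 0"
  shows "w H < 0"
proof (rule ccontr)
  assume "\<not> w H < 0"
  then have wH: "w H \<ge> 0" by simp
  have uc: "cos_eq 0 H u v" and v0: "v 0 = 0" and uH: "u H = 0"
    using u by (auto simp: half_sol_def)
  have up: "u t > 0" if "0 \<le> t" "t < H" for t using u that by (auto simp: half_sol_def)
  have ex: "\<exists>t. 0 < t \<and> t < H \<and> w t \<le> 0"
  proof (rule ccontr)
    assume "\<not> ?thesis"
    then have wp: "w t > 0" if "0 < t" "t < H" for t using that by force
    \<comment> \<open>If \<open>w\<close> were positive, this Wronskian would increase strictly,
      because g(u) u = p f(u) > f(u). But it is 0 at the centre and at most 0 at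
      \<open>H\<close>.\<close>
    define W where "W = (\<lambda>t. w t * v t - w' t * u t)"
    have d: "(W has_real_derivative (w t * - (cos (\<omega> * t) * f (u t)) + cos (\<omega> * t) * g (u t) * w t * u t)) (at t within {0..H})"
      if "t \<in> {0..H}" for t
      unfolding W_def using c2_onD[OF uc that] c2_onD[OF w that]
      by (auto intro!: derivative_eq_intros simp: algebra_simps)
    have "0 * (H - 0) < W H - W 0"
    proof (rule deriv_gt[OF d])
      fix t assume t: "0 < t" "t < H"
      have "w t * - (cos (\<omega> * t) * f (u t)) + cos (\<omega> * t) * g (u t) * w t * u t
         = w t * cos (\<omega> * t) * (g (u t) * u t - f (u t))" by (simp add: algebra_simps)
      also have "\<dots> = w t * cos (\<omega> * t) * ((p - 1) * f (u t))"
        using half_sol_range[OF u, of t] t by (subst g_times) (auto simp: algebra_simps)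
      also have "\<dots> > 0" using wp[OF t] cos_pos[of t] f_pos[OF up[of t]] t p
        by (intro mult_pos_pos) auto
      finally show "0 < w t * - (cos (\<omega> * t) * f (u t)) + cos (\<omega> * t) * g (u t) * w t * u t" .
    qed (use H in auto)
    moreover have "W 0 = 0" by (simp add: W_def v0 w0)
    moreover have "W H \<le> 0" using wH half_sol_deriv_neg[OF u, of H] H uH
      by (auto simp: W_def mult_nonneg_nonpos)
    ultimately show False by simp
  qed
  then obtain t0 where t0: "0 < t0" "t0 < H" "w t0 \<le> 0" by blast
  obtain z1 where z1: "0 < z1" "z1 \<le> t0" "w z1 = 0" "\<And>t. 0 \<le> t \<Longrightarrow> t < z1 \<Longrightarrow> w t > 0"
    by (rule first_zero[of 0 t0 w]) (use t0 w0 c2_on_cont(1)[OF w] in \<open>auto intro: continuous_on_subset\<close>)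
  have z1H: "z1 < H" using z1 t0 by simp
  have "w' z1 \<le> 0"
    by (rule deriv_at_first_zero[OF c2_onD(1)[OF w], of z1 0]) (use z1 z1H in auto)
  moreover have "w' z1 \<noteq> 0"
  proof
    assume "w' z1 = 0"
    have "w 0 = 0"
    proof (rule zero_unique(1)[OF w, of K z1 0])
      fix t assume "t \<in> {0..H}"
      then show "\<bar>- (cos (\<omega> * t) * g (u t) * w t)\<bar> \<le> K * \<bar>w t\<bar>"
        using half_sol_range[OF u, of t] by (intro linearised_bound) auto
    qed (use z1 z1H K_pos \<open>w' z1 = 0\<close> in auto)
    with w0 show False by simp
  qed
  ultimately have w'z1: "w' z1 < 0" by simp
  obtain z2 where z2: "z1 < z2" "z2 \<le> H" "- w z2 = 0" "\<And>t. z1 < t \<Longrightarrow> t < z2 \<Longrightarrow> - w t > 0"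
  proof (rule first_zero_deriv[of z1 H "\<lambda>t. - w t" "- w' z1"])
    show "((\<lambda>t. - w t) has_real_derivative - w' z1) (at z1 within {z1..H})"
      using c2_onD(1)[OF c2_on_minus[OF c2_on_subset[OF w, of z1 H]], of z1] z1 z1H by auto
  qed (use z1 z1H wH w'z1 c2_on_cont(1)[OF w] in \<open>auto intro!: continuous_on_minus intro: continuous_on_subset\<close>)
  have w'z2: "- w' z2 \<le> 0"
    by (rule deriv_at_first_zero[OF c2_onD(1)[OF c2_on_minus[OF w]], of z2 z1]) (use z1 z2 in auto)
  define c where "c = - z1 * v z1 / u z1"
  have c: "c > 0" unfolding c_def
    using half_sol_deriv_neg[OF u z1(1)] z1H z1 up[of z1] by (auto intro!: divide_neg_pos mult_pos_neg)
  \<comment> \<open>\<open>V\<close> is the derivative at \<lambda> = 1 of the rescalings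
    \<lambda>^c u(\<lambda> t).\<close>
  define V where "V = (\<lambda>t. t * v t + c * u t)"
  define A where "A = (\<lambda>t. - (cos (\<omega> * t) * f (u t)))"
  define V' where "V' = (\<lambda>t. (1 + c) * v t + t * A t)"
  define W where "W = (\<lambda>t. w t * V' t - w' t * V t)"
  define G where "G = (\<lambda>t. (c * (p - 1) - 2) * cos (\<omega> * t) + \<omega> * t * sin (\<omega> * t))"
  have Wd: "(W has_real_derivative w t * f (u t) * G t) (at t within {0..H})" if t: "t \<in> {0..H}" for t
  proof -
    define A' where "A' = \<omega> * sin (\<omega> * t) * f (u t) - cos (\<omega> * t) * g (u t) * v t"
    have Ad: "(A has_real_derivative A') (at t within {0..H})"
      unfolding A_def A'_def by (rule accel_deriv[OF uc t]) (use half_sol_range[OF u t] in auto)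
    have vd: "(v has_real_derivative A t) (at t within {0..H})" "(u has_real_derivative v t) (at t within {0..H})"
      using c2_onD[OF uc t] by (auto simp: A_def)
    have 1: "(V has_real_derivative V' t) (at t within {0..H})"
      unfolding V_def V'_def using vd by (auto intro!: derivative_eq_intros simp: algebra_simps)
    have 2: "(V' has_real_derivative (2 + c) * A t + t * A') (at t within {0..H})"
      unfolding V'_def using vd Ad by (auto intro!: derivative_eq_intros simp: algebra_simps)
    have "(W has_real_derivative w t * ((2 + c) * A t + t * A') + cos (\<omega> * t) * g (u t) * w t * V t) (at t within {0..H})"
      unfolding W_def using 1 2 c2_onD[OF w t] by (auto intro!: derivative_eq_intros simp: algebra_simps)
    moreover have "w t * ((2 + c) * A t + t * A') + cos (\<omega> * t) * g (u t) * w t * V t = w t * f (u t) * G t"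
    proof -
      have gu: "g (u t) * u t = p * f (u t)" using half_sol_range[OF u t] by (intro g_times) auto
      have "w t * ((2 + c) * A t + t * A') + cos (\<omega> * t) * g (u t) * w t * V t
        = w t * ((\<omega> * t * sin (\<omega> * t) - (2 + c) * cos (\<omega> * t)) * f (u t) + c * cos (\<omega> * t) * (g (u t) * u t))"
        unfolding A_def A'_def V_def by (simp add: algebra_simps)
      also have "\<dots> = w t * f (u t) * G t" unfolding gu G_def by (simp add: algebra_simps)
      finally show ?thesis .
    qed
    ultimately show ?thesis by simp
  qed
  have W0: "W 0 = 0" by (simp add: W_def V'_def v0 w0)
  have Vz1: "V z1 = 0" using up[of z1] z1 z1H by (simp add: V_def c_def)
  have Wz1: "W z1 = 0" by (simp add: W_def Vz1 z1)
  \<comment> \<open>If \<open>G\<close> were nonpositive somewhere beyond \<open>z1\<close>, it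
    would be negative on all of (0, z1), since there cos is larger and t sin is smaller. Then
    \<open>W\<close> would decrease strictly on (0, z1), although it vanishes at both ends.\<close>
  have Gpos: "G t > 0" if t: "z1 < t" "t < z2" for t
  proof (rule ccontr)
    assume n: "\<not> G t > 0"
    define \<kappa> where "\<kappa> = c * (p - 1) - 2"
    have tH: "0 < t" "t < H" using t z1 z2 by auto
    have "\<kappa> < 0"
    proof (rule ccontr)
      assume "\<not> \<kappa> < 0"
      then have "\<kappa> * cos (\<omega> * t) \<ge> 0" using cos_pos[of t] tH by auto
      moreover have "\<omega> * t * sin (\<omega> * t) > 0" using \<omega> sin_pos[of t] tH by auto
      ultimately show False using n by (simp add: G_def \<kappa>_def)
    qed
    have Gneg: "G s < 0" if s: "0 < s" "s < z1" for s
    proof -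
      have st: "0 \<le> \<omega> * s" "\<omega> * s < \<omega> * t" "\<omega> * t \<le> pi / 2"
        using s t tH \<omega> by (auto simp: H_def field_simps)
      have "cos (\<omega> * t) < cos (\<omega> * s)" using st pi_gt_zero by (intro cos_monotone_0_pi) auto
      then have "\<kappa> * cos (\<omega> * s) < \<kappa> * cos (\<omega> * t)" using \<open>\<kappa> < 0\<close> by simp
      moreover have "sin (\<omega> * s) \<le> sin (\<omega> * t)"
        using st by (intro sin_monotone_2pi_le) auto
      then have "\<omega> * s * sin (\<omega> * s) \<le> \<omega> * t * sin (\<omega> * t)"
        using st sin_pos[of s] s z1H t \<omega> by (intro mult_mono) auto
      ultimately show ?thesis using n by (simp add: G_def \<kappa>_def)
    qed
    have "W z1 - W 0 < 0 * (z1 - 0)"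
    proof (rule deriv_lt[OF Wd])
      fix s assume s: "0 < s" "s < z1"
      show "w s * f (u s) * G s < 0"
        using z1(4)[of s] f_pos[OF up[of s]] Gneg[OF s] s z1H by (intro mult_pos_neg) auto
    qed (use z1 z1H in auto)
    then show False by (simp add: W0 Wz1)
  qed
  have "W z2 - W z1 < 0 * (z2 - z1)"
  proof (rule deriv_lt[OF Wd])
    fix s assume s: "z1 < s" "s < z2"
    show "w s * f (u s) * G s < 0"
      using z2(4)[OF s] f_pos[OF up[of s]] Gpos[OF s] s z1 z2 by (intro mult_neg_pos) (auto intro!: mult_neg_pos)
  qed (use z1 z2 in auto)
  then have "W z2 < 0" by (simp add: Wz1)
  \<comment> \<open>At \<open>z2\<close> only -w' V is left of the Wronskian. Both t v and u
    decrease, so V z2 \<le> V z1 = 0, while w' z2 \<ge> 0.\<close>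
  moreover have "W z2 \<ge> 0"
  proof -
    have 1: "v z2 \<le> v z1" using half_sol_deriv_mono[OF u, of z1 z2] z1 z2 by simp
    have 2: "v z2 \<le> 0" using half_sol_deriv_neg[OF u, of z2] z1 z2 by simp
    have "u z2 - u z1 \<le> 0 * (z2 - z1)"
      by (rule deriv_le[OF c2_onD(1)[OF uc]])
        (use z1 z2 half_sol_deriv_neg[OF u] in \<open>auto intro: less_imp_le\<close>)
    then have "c * u z2 \<le> c * u z1" using c by simp
    moreover have "z2 * v z2 \<le> z1 * v z1"
    proof -
      have "z2 * v z2 \<le> z1 * v z2" using z2 2 by (intro mult_right_mono_neg) auto
      also have "\<dots> \<le> z1 * v z1" using 1 z1 by simp
      finally show ?thesis .
    qed
    ultimately have "V z2 \<le> V z1" by (simp add: V_def)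
    then have "w' z2 * V z2 \<le> 0" using w'z2 Vz1 by (simp add: mult_nonneg_nonpos)
    then show ?thesis using z2(3) by (simp add: W_def)
  qed
  ultimately show False by simp
qed

text \<open>The derivative \<open>v\<close> satisfies the linearised equation up to a forcing term
  \<omega> sin(\<omega>t) f(u) of one sign. Hence the Wronskian of \<open>y\<close> and
  \<open>v\<close> increases strictly from 0 up to the first zero of \<open>y\<close>, where the
  signs of y' and v make it nonpositive.\<close>

lemma half_sol_nondegenerate_odd:
  assumes u: "half_sol u v" and w: "cos_lin u 0 H w w'"
    and w0: "w 0 = 0" "w H = 0"
  shows "w' 0 = 0"
proof (rule ccontr)
  assume n: "w' 0 \<noteq> 0"
  have uc: "cos_eq 0 H u v" and v0: "v 0 = 0"
    using u by (auto simp: half_sol_def)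
  define y where "y = (\<lambda>t. (1 / w' 0) * w t)"
  define y' where "y' = (\<lambda>t. (1 / w' 0) * w' t)"
  have y: "cos_lin u 0 H y y'"
    unfolding y_def y'_def by (rule c2_on_cong[OF c2_on_scale[OF w]]) (simp add: algebra_simps)
  have y0: "y 0 = 0" "y H = 0" "y' 0 = 1" using n w0 by (auto simp: y_def y'_def)
  obtain z where z: "0 < z" "z \<le> H" "y z = 0" "\<And>t. 0 < t \<Longrightarrow> t < z \<Longrightarrow> y t > 0"
    by (rule first_zero_deriv[of 0 H y 1])
      (use y0 H c2_on_cont(1)[OF y] c2_onD(1)[OF y, of 0] in auto)
  have y'z: "y' z \<le> 0"
    by (rule deriv_at_first_zero[OF c2_onD(1)[OF y], of z 0]) (use z in auto)
  define A where "A = (\<lambda>t. - (cos (\<omega> * t) * f (u t)))"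
  define X where "X = (\<lambda>t. y t * A t - y' t * v t)"
  have Xd: "(X has_real_derivative y t * (\<omega> * sin (\<omega> * t) * f (u t))) (at t within {0..H})" if t: "t \<in> {0..H}" for t
  proof -
    have Ad: "(A has_real_derivative \<omega> * sin (\<omega> * t) * f (u t) - cos (\<omega> * t) * g (u t) * v t) (at t within {0..H})"
      unfolding A_def by (rule accel_deriv[OF uc t]) (use half_sol_range[OF u t] in auto)
    have vd: "(v has_real_derivative A t) (at t within {0..H})"
      using c2_onD(2)[OF uc t] by (simp add: A_def)
    show ?thesis unfolding X_def using Ad vd c2_onD[OF y t]
      by (auto intro!: derivative_eq_intros simp: algebra_simps)
  qed
  have "0 * (z - 0) < X z - X 0"
  proof (rule deriv_gt[OF Xd])
    fix t assume t: "0 < t" "t < z"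
    show "0 < y t * (\<omega> * sin (\<omega> * t) * f (u t))"
      using z(4)[OF t] sin_pos[of t] f_pos[of "u t"] t z \<omega> u by (auto simp: half_sol_def)
  qed (use z in auto)
  moreover have "X 0 = 0" by (simp add: X_def y0 v0)
  moreover have "X z \<le> 0" using y'z half_sol_deriv_neg[OF u z(1,2)] z(3)
    by (simp add: X_def mult_nonpos_nonpos)
  ultimately show False by simp
qed

section \<open>Symmetry, uniqueness and non-degeneracy of Dirichlet solutions\<close>

definition dirichlet_sol :: "(real \<Rightarrow> real) \<Rightarrow> (real \<Rightarrow> real) \<Rightarrow> bool" where
  "dirichlet_sol u v \<longleftrightarrow> cos_eq (-H) H u v \<and> u (-H) = 0 \<and> u H = 0 \<and>
     (\<forall>t\<in>{-H..H}. 0 \<le> u t \<and> u t < R) \<and> (\<exists>t\<in>{-H..H}. u t > 0)"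

lemma accel_nonpos: "t \<in> {-H..H} \<Longrightarrow> - (cos (\<omega> * t) * f x) \<le> 0"
  using cos_nonneg f_nonneg by auto

lemma dirichlet_sol_reflect:
  assumes "dirichlet_sol u v"
  shows "dirichlet_sol (\<lambda>t. u (-t)) (\<lambda>t. - v (-t))"
proof -
  have "cos_eq (-H) H (\<lambda>t. u (-t)) (\<lambda>t. - v (-t))"
    using c2_on_reflect[of "-H" H u v "\<lambda>t. - (cos (\<omega> * t) * f (u t))"] assms by (simp add: dirichlet_sol_def)
  moreover obtain t where "t \<in> {-H..H}" "u t > 0" using assms by (auto simp: dirichlet_sol_def)
  then have "-t \<in> {-H..H}" "u (- (-t)) > 0" by auto
  ultimately show ?thesis using assms unfolding dirichlet_sol_def by (auto intro: bexI[of _ "-t"])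
qed

text \<open>By concavity the tangent at an interior zero lies above \<open>u\<close>. It is
  nonnegative at both ends and so must be horizontal, which forces u \<le> 0 throughout.\<close>

lemma dirichlet_sol_pos:
  assumes "dirichlet_sol u v" "-H < t" "t < H"
  shows "u t > 0"
proof (rule ccontr)
  assume "\<not> u t > 0"
  have uc: "cos_eq (-H) H u v" using assms by (simp add: dirichlet_sol_def)
  have nn: "0 \<le> u s" if "s \<in> {-H..H}" for s using assms that by (simp add: dirichlet_sol_def)
  have t0: "u t = 0" using nn[of t] \<open>\<not> u t > 0\<close> assms by simp
  have tay: "u s \<le> v t * (s - t)" if "s \<in> {-H..H}" for s
    using taylor_le[OF uc, of t s 0] that assms accel_nonpos t0 by simp
  have "0 \<le> v t * (H - t)" "0 \<le> v t * (-H - t)" using tay[of H] tay[of "-H"] nn[of H] nn[of "-H"] H by auto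
  moreover have "H - t > 0" "-H - t < 0" using assms by auto
  ultimately have "v t = 0" by (simp only: zero_le_mult_iff) linarith
  moreover obtain s where "s \<in> {-H..H}" "u s > 0" using assms by (auto simp: dirichlet_sol_def)
  ultimately show False using tay[of s] by simp
qed

lemma dirichlet_sol_deriv_mono:
  assumes "dirichlet_sol u v" "-H \<le> s" "s < t" "t \<le> H"
  shows "v t < v s"
  by (rule deriv_strict_mono[of "-H" H u v])
    (use assms dirichlet_sol_pos[OF assms(1)] in \<open>auto simp: dirichlet_sol_def\<close>)

text \<open>If the maximum were attained to the right of the centre, \<open>u\<close> would at first exceed its reflection
  there. Where the two meet again both are decreasing, \<open>u\<close> at least as steeply, which contradicts the
  decay of the difference of their energies.\<close>

lemma dirichlet_sol_deriv_zero_le: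
  assumes u: "dirichlet_sol u v"
  shows "v 0 \<le> 0"
proof (rule ccontr)
  assume "\<not> v 0 \<le> 0"
  then have v0: "v 0 > 0" by simp
  have uc: "cos_eq (-H) H u v" using assms by (simp add: dirichlet_sol_def)
  define y where "y = (\<lambda>t. u (-t))"
  define y' where "y' = (\<lambda>t. - v (-t))"
  have y: "dirichlet_sol y y'" unfolding y_def y'_def by (rule dirichlet_sol_reflect[OF u])
  then have yc: "cos_eq (-H) H y y'" by (simp add: dirichlet_sol_def)
  define d where "d = (\<lambda>t. u t - y t)"
  have dc: "c2_on (-H) H d (\<lambda>t. v t - y' t) (\<lambda>t. - (cos (\<omega> * t) * f (u t)) - - (cos (\<omega> * t) * f (y t)))"
    unfolding d_def by (rule c2_on_diff[OF uc yc])
  note dc0 = c2_on_subset[OF dc, of 0 H]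
  obtain r where r: "0 < r" "r \<le> H" "d r = 0" "\<And>t. 0 < t \<Longrightarrow> t < r \<Longrightarrow> d t > 0"
    by (rule first_zero_deriv[of 0 H d "v 0 - y' 0"])
      (use H c2_on_cont(1)[OF dc0] c2_onD(1)[OF dc0, of 0] v0 u y in \<open>auto simp: d_def y'_def y_def dirichlet_sol_def\<close>)
  have "v r - y' r \<le> 0"
    by (rule deriv_at_first_zero[OF c2_onD(1)[OF dc0], of r 0]) (use r H in auto)
  moreover have "y' r < 0" using dirichlet_sol_deriv_mono[OF u, of "-r" 0] r v0 by (simp add: y'_def)
  ultimately have "\<bar>y' r\<bar> \<le> \<bar>v r\<bar>" by linarith
  then have sq: "(v r)\<^sup>2 \<ge> (y' r)\<^sup>2" by (simp only: abs_le_square_iff)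
  define \<Phi> where "\<Phi> = (\<lambda>x::real. max x 0 powr (p + 1) / (p + 1))"
  have \<Phi>: "(\<Phi> has_real_derivative f x) (at x)" if "x < R" for x
  proof -
    have "(\<Phi> has_real_derivative (p + 1) * max x 0 powr (p + 1 - 1) / (p + 1)) (at x)"
      unfolding \<Phi>_def using p by (intro DERIV_cdivide has_real_derivative_pos_part_powr) auto
    then show ?thesis using p that by (simp add: f_def)
  qed
  have range: "0 \<le> u t" "u t < R" "0 \<le> y t" "y t < R" if "t \<in> {-H..H}" for t
    using u y that by (auto simp: dirichlet_sol_def)
  \<comment> \<open>In the derivative of the energy difference everything cancels except the term
    from the derivative of the cosine, which is negative where u exceeds its reflection.\<close>
  define E where "E = (\<lambda>t. ((v t)\<^sup>2 - (y' t)\<^sup>2) / 2 + cos (\<omega> * t) * (\<Phi> (u t) - \<Phi> (y t)))"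
  have Ed: "(E has_real_derivative - (\<omega> * sin (\<omega> * t)) * (\<Phi> (u t) - \<Phi> (y t))) (at t within {-H..H})"
    if t: "t \<in> {-H..H}" for t
  proof -
    have "((\<lambda>t. \<Phi> (u t)) has_real_derivative f (u t) * v t) (at t within {-H..H})"
      "((\<lambda>t. \<Phi> (y t)) has_real_derivative f (y t) * y' t) (at t within {-H..H})"
      using DERIV_chain2[OF \<Phi>[OF range(2)[OF t]] c2_onD(1)[OF uc t]]
        DERIV_chain2[OF \<Phi>[OF range(4)[OF t]] c2_onD(1)[OF yc t]] by auto
    then show ?thesis unfolding E_def using c2_onD[OF uc t] c2_onD[OF yc t]
      by (auto intro!: derivative_eq_intros simp: field_simps)
  qed
  have "E r - E 0 < 0 * (r - 0)"
  proof (rule deriv_lt[OF Ed])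
    fix t assume t: "0 < t" "t < r"
    then have tH: "t \<in> {-H..H}" using r by auto
    have "y t < u t" using r(4)[OF t] by (simp add: d_def)
    then have "max (y t) 0 powr (p + 1) < max (u t) 0 powr (p + 1)"
      using range[OF tH] p by (intro powr_less_mono2) auto
    then have "\<Phi> (u t) - \<Phi> (y t) > 0" using p by (simp add: \<Phi>_def divide_strict_right_mono)
    then show "- (\<omega> * sin (\<omega> * t)) * (\<Phi> (u t) - \<Phi> (y t)) < 0"
      using sin_pos[of t] \<omega> t r by (intro mult_neg_pos) auto
  qed (use r H in auto)
  moreover have "E 0 = 0" by (simp add: E_def y_def y'_def)
  moreover have "E r \<ge> 0" using sq r(3) by (simp add: E_def d_def)
  ultimately show False by simp
qed

lemma dirichlet_sol_half:
  assumes "dirichlet_sol u v"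
  shows "half_sol u v"
proof -
  have "v 0 \<le> 0" "- v 0 \<le> 0"
    using dirichlet_sol_deriv_zero_le[OF assms] dirichlet_sol_deriv_zero_le[OF dirichlet_sol_reflect[OF assms]] by auto
  moreover have "cos_eq 0 H u v"
    by (rule c2_on_subset[of "-H" H]) (use assms H in \<open>auto simp: dirichlet_sol_def\<close>)
  ultimately show ?thesis using assms dirichlet_sol_pos[OF assms] H
    by (auto simp: half_sol_def dirichlet_sol_def)
qed

lemma force_diff: "s * (- (c * f x) - - (c * f y)) = - (c * dq x y * (s * (x - y)))"
proof -
  have "s * (- (c * f x) - - (c * f y)) = - (c * s * (f x - f y))" by (simp add: algebra_simps)
  then show ?thesis unfolding dq_mult[symmetric] by (simp add: mult_ac)
qed

text \<open>The error (m - n) w of the coefficient plays the role of the inhomogeneous term in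
  Gronwall.\<close>

lemma linear_stable:
  assumes z: "c2_on c d z z' (\<lambda>t. - (q t * m t * z t))" and w: "c2_on c d w w' (\<lambda>t. - (q t * n t * w t))"
    and q: "\<And>t. t \<in> {c..d} \<Longrightarrow> \<bar>q t\<bar> \<le> 1" and m: "\<And>t. t \<in> {c..d} \<Longrightarrow> 0 \<le> m t" "\<And>t. t \<in> {c..d} \<Longrightarrow> m t \<le> K"
    and e: "\<And>t. t \<in> {c..d} \<Longrightarrow> \<bar>m t - n t\<bar> \<le> e" and B: "\<And>t. t \<in> {c..d} \<Longrightarrow> \<bar>w t\<bar> \<le> B"
    and \<eta>: "e * B \<le> \<eta>" "\<bar>z c - w c\<bar> \<le> \<eta>" "\<bar>z' c - w' c\<bar> \<le> \<eta>" and t: "t \<in> {c..d}"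
  shows "\<bar>z t - w t\<bar> \<le> 2 * exp ((K + 2) * (d - c)) * \<eta>"
proof (rule gronwall_abs(1)[OF c2_on_diff[OF z w]])
  fix s assume s: "s \<in> {c..d}"
  have "\<bar>- (q s * m s * z s) - - (q s * n s * w s)\<bar> = \<bar>q s\<bar> * \<bar>m s * (z s - w s) + (m s - n s) * w s\<bar>"
    by (simp add: abs_mult[symmetric] algebra_simps abs_minus_commute)
  also have "\<dots> \<le> 1 * \<bar>m s * (z s - w s) + (m s - n s) * w s\<bar>"
    using q[OF s] by (intro mult_right_mono) auto
  also have "\<dots> \<le> \<bar>m s\<bar> * \<bar>z s - w s\<bar> + \<bar>m s - n s\<bar> * \<bar>w s\<bar>"
    by (simp add: abs_mult[symmetric] abs_triangle_ineq)
  also have "\<dots> \<le> K * \<bar>z s - w s\<bar> + e * B"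
    using m[OF s] e[OF s] B[OF s] by (intro add_mono mult_right_mono mult_mono) auto
  finally show "\<bar>- (q s * m s * z s) - - (q s * n s * w s)\<bar> \<le> K * \<bar>z s - w s\<bar> + \<eta>" using \<eta>(1) by simp
qed (use K_pos \<eta> t in auto)

text \<open>Shoot from the centre with height A and let \<open>F A\<close> be the value at
  \<open>H\<close>. Every zero of \<open>F\<close> between the two heights belongs to a half
  solution, and non-degeneracy makes \<open>F\<close> cross 0 downwards there, which cannot happen
  at two zeros.\<close>

lemma half_sol_ordered:
  assumes u1: "half_sol u1 v1" and u2: "half_sol u2 v2"
  shows "\<not> u1 0 < u2 0"
proof
  assume less: "u1 0 < u2 0"
  define a1 where "a1 = u1 0"
  define a2 where "a2 = u2 0"
  have a: "0 < a1" "a1 < a2" "a2 < R" using less u1 u2 H by (auto simp: a1_def a2_def half_sol_def)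
  have "\<exists>u v. cos_eq 0 H u v \<and> u 0 = A \<and> v 0 = 0" for A
    by (rule force_ivp[of 0 H "\<lambda>t. cos (\<omega> * t)" 1 A 0]) (use H in \<open>auto intro!: continuous_intros\<close>)
  then obtain U V where U: "\<And>A. cos_eq 0 H (U A) (V A)"
      "\<And>A. U A 0 = A" "\<And>A. V A 0 = 0"
    by metis
  define C where "C = 2 * exp ((1 * K + 2) * (H - 0))"
  have lip: "\<bar>U A t - U B t\<bar> \<le> C * \<bar>A - B\<bar>" if "t \<in> {0..H}" for A B t
    unfolding C_def by (rule force_stable[OF U(1)[of A] U(1)[of B]]) (use that U in auto)
  define F where "F = (\<lambda>A. U A H)"
  have Fc: "continuous_on {a1..a2} F"
  proof (rule lipschitz_on_continuous_on)
    show "C-lipschitz_on {a1..a2} F"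
      using lip[of H] H by (intro lipschitz_onI) (auto simp: F_def dist_real_def C_def)
  qed
  have F0: "F a1 = 0" "F a2 = 0"
  proof -
    have *: "F (u 0) = 0" if "half_sol u v" for u v
      using force_unique(1)[OF U(1)[of "u 0"], of u v 1 0 H] that U(2,3) H by (auto simp: half_sol_def F_def)
    show "F a1 = 0" "F a2 = 0" using *[OF u1] *[OF u2] by (auto simp: a1_def a2_def)
  qed
  have le: "U A t \<le> A" if "t \<in> {0..H}" for A t
    using taylor_le[OF U(1)[of A], of 0 t 0] that H accel_nonpos U(2,3)[of A] by auto
  have half: "half_sol (U A) (V A)" if A: "A \<in> {a1..a2}" "F A = 0" for A
  proof -
    \<comment> \<open>A concave function that starts at A > 0 and is nonpositive at some t < H is
      descending there, and would be negative at \<open>H\<close>.\<close>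
    have "U A t > 0" if t: "0 \<le> t" "t < H" for t
    proof (rule ccontr)
      assume "\<not> U A t > 0"
      then have n: "U A t \<le> 0" by simp
      have tay: "U A s \<le> U A t + V A t * (s - t)" if "s \<in> {0..H}" for s
        using taylor_le[OF U(1)[of A], of t s 0] that t accel_nonpos by auto
      have "V A t < 0"
      proof -
        have "A \<le> U A t - V A t * t" using tay[of 0] U(2)[of A] H by simp
        then have "0 < - V A t * t" using n A a by simp
        then show ?thesis using t by (simp add: mult_less_0_iff)
      qed
      then have "V A t * (H - t) < 0" using t by (simp add: mult_neg_pos)
      then show False using tay[of H] n A H by (simp add: F_def)
    qed
    moreover have "U A t < R" if "0 \<le> t" "t < H" for t using le[of t A] that A a by auto
    ultimately show ?thesis using U A by (auto simp: half_sol_def F_def)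
  qed
  show False
  proof (rule no_two_decreasing_zeros[OF Fc a(2) F0])
    fix A assume A: "A \<in> {a1..a2}" "F A = 0"
    note hA = half[OF A]
    obtain w w' where w: "cos_lin (U A) 0 H w w'" "w 0 = 1" "w' 0 = 0"
    proof (rule linear_ivp[of 0 H "\<lambda>t. cos (\<omega> * t) * g (U A t)" K 1 0])
      show "continuous_on {0..H} (\<lambda>t. cos (\<omega> * t) * g (U A t))"
        by (intro continuous_intros continuous_on_compose2[OF g_cont[of UNIV] c2_on_cont(1)[OF U(1)]]) auto
      show "\<bar>cos (\<omega> * t) * g (U A t)\<bar> \<le> K" if "t \<in> {0..H}" for t
        using linearised_bound[of "cos (\<omega> * t)" "U A t" 1] half_sol_range(2)[OF hA that] by simp
    qed (use H in auto)
    have wH: "w H < 0" by (rule half_sol_nondegenerate_even[OF hA w])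
    obtain B where B: "B > 0" "\<And>t. t \<in> {0..H} \<Longrightarrow> \<bar>w t\<bar> \<le> B"
    proof -
      have "bounded (w ` {0..H})"
        by (intro compact_imp_bounded compact_continuous_image c2_on_cont(1)[OF w(1)]) auto
      then show thesis using that by (auto simp: bounded_pos)
    qed
    \<comment> \<open>Chosen so that C * e * B = |w H| / 2: the difference quotient \<open>z\<close>
      below then still ends at a negative value.\<close>
    define e where "e = - w H / (2 * C * B)"
    have C: "C > 0" by (simp add: C_def)
    have e: "e > 0" unfolding e_def using wH B(1) C by (intro divide_pos_pos mult_pos_pos) auto
    obtain \<delta> where \<delta>: "\<delta> > 0" "\<And>x y z. 0 \<le> z \<Longrightarrow> z < R \<Longrightarrow> x < R \<Longrightarrow> y < R \<Longrightarrow> \<bar>x - z\<bar> \<le> \<delta> \<Longrightarrow> \<bar>y - z\<bar> \<le> \<delta> \<Longrightarrow> \<bar>dq x y - g z\<bar> \<le> e"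
      using dq_uniform[OF e] by metis
    show "\<exists>d>0. \<forall>t\<in>{a1..a2}. t \<noteq> A \<and> \<bar>t - A\<bar> < d \<longrightarrow> F t / (t - A) < 0"
    proof (intro exI[of _ "\<delta> / C"] conjI ballI impI)
      fix D assume D: "D \<in> {a1..a2}" "D \<noteq> A \<and> \<bar>D - A\<bar> < \<delta> / C"
      have near: "\<bar>U D t - U A t\<bar> \<le> \<delta>" if "t \<in> {0..H}" for t
        using lip[OF that, of D A] D C by (auto simp: field_simps)
      \<comment> \<open>The difference quotient in the height solves the linear equation with
        coefficient \<open>dq\<close> and starts from the data 1, 0 of \<open>w\<close>.\<close>
      define z where "z = (\<lambda>t. (1 / (D - A)) * (U D t - U A t))"
      define z' where "z' = (\<lambda>t. (1 / (D - A)) * (V D t - V A t))"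
      have z: "c2_on 0 H z z' (\<lambda>t. - (cos (\<omega> * t) * dq (U D t) (U A t) * z t))"
        unfolding z_def z'_def
        by (rule c2_on_cong[OF c2_on_scale[OF c2_on_diff[OF U(1)[of D] U(1)[of A]]]])
          (rule force_diff)
      have "\<bar>z H - w H\<bar> \<le> 2 * exp ((K + 2) * (H - 0)) * (e * B)"
      proof (rule linear_stable[OF z w(1)])
        fix t assume t: "t \<in> {0..H}"
        have r: "U D t < R" "U A t < R" "0 \<le> U A t"
          using le[OF t, of D] half_sol_range[OF hA t] D a by auto
        show "\<bar>dq (U D t) (U A t) - g (U A t)\<bar> \<le> e"
          using \<delta>(2)[of "U A t" "U D t" "U A t"] near[OF t] r \<delta>(1) by auto
        show "0 \<le> dq (U D t) (U A t)" "dq (U D t) (U A t) \<le> K"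
          using r dq_le_K dq_nonneg by auto
      next
        show "\<bar>z 0 - w 0\<bar> \<le> e * B" using D U w e B by (simp add: z_def)
        show "\<bar>z' 0 - w' 0\<bar> \<le> e * B" using D U w e B by (simp add: z'_def)
      qed (use B H e in auto)
      also have "\<dots> = C * (e * B)" by (simp add: C_def)
      also have "\<dots> = - w H / 2" using C B by (simp add: e_def field_simps)
      finally have "z H < 0" using wH by (simp add: abs_le_iff) 
      then show "F D / (D - A) < 0" using A by (simp add: z_def F_def)
    qed (use \<delta> C in auto)
  qed
qed

lemma dirichlet_sol_unique:
  assumes "dirichlet_sol u1 v1" "dirichlet_sol u2 v2" "t \<in> {-H..H}"
  shows "u1 t = u2 t"
proof -
  note h = dirichlet_sol_half[OF assms(1)] dirichlet_sol_half[OF assms(2)]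
  have "u1 0 = u2 0" using half_sol_ordered[OF h] half_sol_ordered[OF h(2,1)] by simp
  then show ?thesis
    using force_unique(1)[of "-H" H u1 v1 "\<lambda>t. cos (\<omega> * t)" u2 v2 1 0 t] assms h H
    by (auto simp: dirichlet_sol_def half_sol_def)
qed

text \<open>Since \<open>u\<close> is even, w(t) + w(-t) and w(t) - w(-t) solve the linearised
  equation too; the even and the odd case dispose of one each.\<close>

lemma dirichlet_sol_nondegenerate:
  assumes u: "dirichlet_sol u v" and w: "cos_lin u (-H) H w w'"
    and w0: "w (-H) = 0" "w H = 0" and t: "t \<in> {-H..H}"
  shows "w t = 0"
proof -
  note hu = dirichlet_sol_half[OF u]
  have even: "u (-t) = u t" if "t \<in> {-H..H}" for t
    using dirichlet_sol_unique[OF dirichlet_sol_reflect[OF u] u that] by simp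
  have wr: "c2_on (-H) H (\<lambda>t. w (-t)) (\<lambda>t. - w' (-t)) (\<lambda>t. - (cos (\<omega> * t) * g (u t) * w (-t)))"
    using c2_on_reflect[OF w] even unfolding minus_minus by (elim c2_on_cong) auto
  have bnd: "\<bar>- (cos (\<omega> * s) * g (u s) * x)\<bar> \<le> K * \<bar>x\<bar>" if "s \<in> {-H..H}" for s x
  proof (rule linearised_bound)
    show "u s \<le> R" using that u by (simp add: dirichlet_sol_def less_imp_le)
  qed simp
  define y where "y = (\<lambda>t. 1 * w t + 1 * w (-t))"
  have y: "cos_lin u (-H) H y (\<lambda>t. 1 * w' t + 1 * - w' (-t))"
    unfolding y_def by (rule c2_on_cong[OF c2_on_lincomb[OF w wr]]) (simp add: algebra_simps)
  define x where "x = (\<lambda>t. 1 * w t + (-1) * w (-t))"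
  have x: "cos_lin u (-H) H x (\<lambda>t. 1 * w' t + (-1) * - w' (-t))"
    unfolding x_def by (rule c2_on_cong[OF c2_on_lincomb[OF w wr]]) (simp add: algebra_simps)
  have "y 0 = 0"
  proof (rule ccontr)
    assume n: "y 0 \<noteq> 0"
    have "(1 / y 0) * y H < 0"
      by (rule half_sol_nondegenerate_even[OF hu, of _ "\<lambda>t. (1 / y 0) * (1 * w' t + 1 * - w' (-t))"],
          rule c2_on_cong[OF c2_on_scale[OF c2_on_subset[OF y]]])
        (use n H in \<open>auto simp: algebra_simps\<close>)
    then show False using w0 by (simp add: y_def)
  qed
  then have "y t = 0"
    by - (rule zero_unique(1)[OF y, of K 0], use K_pos H bnd t in \<open>auto intro: less_imp_le\<close>)
  moreover have "w' 0 + w' 0 = 0"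
    using half_sol_nondegenerate_odd[OF hu c2_on_subset[OF x]] H w0 by (simp add: x_def)
  then have "x t = 0"
    by - (rule zero_unique(1)[OF x, of K 0], use K_pos H bnd t in \<open>auto intro: less_imp_le simp: x_def\<close>)
  ultimately show ?thesis by (simp add: x_def y_def)
qed

end

section \<open>Compactness for approximate Dirichlet solutions\<close>

text \<open>The mean value theorem gives one point with slope at most 2M/(d-c); the bound on the
  second derivative carries this to all others.\<close>

lemma slope_bound:
  assumes u: "c2_on c d u v A" and "c < d" and M: "\<And>t. t \<in> {c..d} \<Longrightarrow> \<bar>u t\<bar> \<le> M"
    and B: "\<And>t. t \<in> {c..d} \<Longrightarrow> \<bar>A t\<bar> \<le> B" and x: "x \<in> {c..d}"
  shows "\<bar>v x\<bar> \<le> 2 * M / (d - c) + B * (d - c)"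
proof -
  obtain s where s: "c < s" "s < d" "u d - u c = v s * (d - c)"
    using mvt_within[OF c2_onD(1)[OF u], of c d] assms(2) by auto
  have "\<bar>v s\<bar> * (d - c) = \<bar>u d - u c\<bar>" using s assms(2) by (simp add: abs_mult)
  also have "\<dots> \<le> 2 * M" using M[of d] M[of c] assms(2) by auto
  finally have 1: "\<bar>v s\<bar> \<le> 2 * M / (d - c)" using assms(2) by (simp add: field_simps)
  have *: "\<bar>v y - v x\<bar> \<le> B * (d - c)" if "x \<le> y" "x \<in> {c..d}" "y \<in> {c..d}" for x y
  proof -
    have "- B \<le> A t" "A t \<le> B" if "t \<in> {c..d}" for t using B[OF that] by auto
    then have "(- B) * (y - x) \<le> v y - v x" "v y - v x \<le> B * (y - x)"
      by - (rule deriv_ge[OF c2_onD(2)[OF u]] deriv_le[OF c2_onD(2)[OF u]], use that in auto)+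
    moreover have "B * (y - x) \<le> B * (d - c)"
      using that B[of c] assms(2) by (intro mult_left_mono) auto
    ultimately show ?thesis by auto
  qed
  have "\<bar>v x - v s\<bar> \<le> B * (d - c)"
    using *[of s x] *[of x s] s x by (cases "s \<le> x") (auto simp: abs_minus_commute)
  with 1 show ?thesis by linarith
qed

context cos_problem
begin

text \<open>An approximate Dirichlet solution: boundary values are tolerated up to \<delta>, and the
  height \<epsilon> prevents a trivial limit as \<delta> tends to 0.\<close>

definition bump :: "real \<Rightarrow> real \<Rightarrow> real \<Rightarrow> (real \<Rightarrow> real) \<Rightarrow> (real \<Rightarrow> real) \<Rightarrow> bool" where
  "bump M \<epsilon> \<delta> u v \<longleftrightarrow> cos_eq (-H) H u v \<and> (\<forall>t\<in>{-H..H}. 0 \<le> u t \<and> u t \<le> M) \<and>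
     u (-H) \<le> \<delta> \<and> u H \<le> \<delta> \<and> (\<exists>t\<in>{-H..H}. \<epsilon> \<le> u t)"

lemma bump_deriv_bound:
  assumes "bump M \<epsilon> \<delta> u v"
  shows "\<bar>v (-H)\<bar> \<le> 2 * M / (2 * H) + K * M * (2 * H)"
proof -
  have "\<bar>v (-H)\<bar> \<le> 2 * M / (H - - H) + K * M * (H - - H)"
  proof (rule slope_bound[where v = v and x = "-H"])
    show "cos_eq (-H) H u v" using assms by (simp add: bump_def)
    fix t assume t: "t \<in> {-H..H}"
    then have u: "0 \<le> u t" "u t \<le> M" using assms by (auto simp: bump_def)
    then show "\<bar>u t\<bar> \<le> M" by simp
    have "\<bar>cos (\<omega> * t) * f (u t)\<bar> \<le> 1 * (K * \<bar>u t\<bar>)"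
      unfolding abs_mult using f_bound[of "u t"] by (intro mult_mono) auto
    also have "\<dots> \<le> K * M" using u K_pos by simp
    finally show "\<bar>- (cos (\<omega> * t) * f (u t))\<bar> \<le> K * M" by simp
  qed (use H in auto)
  then show ?thesis by simp
qed

text \<open>By \<open>force_stable\<close>, convergence of value and slope at the left end already
  gives uniform convergence to the solution with the limiting data. The height \<epsilon> survives
  in the limit.\<close>

lemma bump_limit:
  assumes b: "\<And>n. bump M \<epsilon> (1 / real (Suc n)) (U n) (V n)" and "M < R" "\<epsilon> > 0"
    and lim: "(\<lambda>n. U n (-H)) \<longlonglongrightarrow> x" "(\<lambda>n. V n (-H)) \<longlonglongrightarrow> y"
  obtains u v where "dirichlet_sol u v" "\<And>e. e > 0 \<Longrightarrow> \<forall>\<^sub>F n in sequentially. \<forall>t\<in>{-H..H}. \<bar>U n t - u t\<bar> \<le> e"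
proof -
  obtain u v where u: "cos_eq (-H) H u v" "u (-H) = x" "v (-H) = y"
    by (rule force_ivp[of "-H" H "\<lambda>t. cos (\<omega> * t)" 1 x y]) (use H in \<open>auto intro!: continuous_intros\<close>)
  have Uc: "cos_eq (-H) H (U n) (V n)" for n
    using b[of n] by (simp add: bump_def)
  have conv: "\<forall>\<^sub>F n in sequentially. \<forall>t\<in>{-H..H}. \<bar>U n t - u t\<bar> \<le> e" if e: "e > 0" for e
  proof -
    define \<eta> where "\<eta> = e / (2 * exp ((1 * K + 2) * (H - - H)))"
    have \<eta>: "\<eta> > 0" using e by (simp add: \<eta>_def)
    have "\<forall>\<^sub>F n in sequentially. \<bar>U n (-H) - x\<bar> < \<eta>" "\<forall>\<^sub>F n in sequentially. \<bar>V n (-H) - y\<bar> < \<eta>"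
      using lim[THEN tendstoD, OF \<eta>] by (auto simp: dist_real_def)
    then show ?thesis
    proof eventually_elim
      case (elim n)
      show ?case
      proof
        fix t assume t: "t \<in> {-H..H}"
        have "\<bar>U n t - u t\<bar> \<le> 2 * exp ((1 * K + 2) * (H - - H)) * \<eta>"
          by (rule force_stable[OF Uc u(1)]) (use t elim u in auto)
        then show "\<bar>U n t - u t\<bar> \<le> e" by (simp add: \<eta>_def)
      qed
    qed
  qed
  have pt: "(\<lambda>n. U n t) \<longlonglongrightarrow> u t" if t: "t \<in> {-H..H}" for t
  proof (rule tendstoI)
    fix e :: real assume "e > 0"
    then have "\<forall>\<^sub>F n in sequentially. \<forall>t\<in>{-H..H}. \<bar>U n t - u t\<bar> \<le> e / 2" by (intro conv) auto
    then show "\<forall>\<^sub>F n in sequentially. dist (U n t) (u t) < e"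
      by eventually_elim (use t \<open>e > 0\<close> in \<open>force simp: dist_real_def\<close>)
  qed
  have lo: "0 \<le> u t" if "t \<in> {-H..H}" for t
    by (rule LIMSEQ_le_const[OF pt[OF that]]) (use b that in \<open>auto simp: bump_def\<close>)
  have hi: "u t \<le> M" if "t \<in> {-H..H}" for t
    by (rule LIMSEQ_le_const2[OF pt[OF that]]) (use b that in \<open>auto simp: bump_def\<close>)
  have z: "u t \<le> 0" if "t = -H \<or> t = H" for t
  proof (rule LIMSEQ_le[OF pt LIMSEQ_Suc[OF lim_1_over_n]])
    show "\<exists>N. \<forall>n\<ge>N. U n t \<le> 1 / real (Suc n)" using b that by (auto simp: bump_def)
  qed (use that H in auto)
  have "\<exists>t\<in>{-H..H}. u t > 0"
  proof (rule ccontr)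
    assume n: "\<not> ?thesis"
    have "\<forall>\<^sub>F n in sequentially. \<forall>t\<in>{-H..H}. \<bar>U n t - u t\<bar> \<le> \<epsilon> / 2" using assms by (intro conv) auto
    then obtain N where N: "\<forall>t\<in>{-H..H}. \<bar>U N t - u t\<bar> \<le> \<epsilon> / 2"
      by (auto simp: eventually_sequentially)
    obtain t where t: "t \<in> {-H..H}" "\<epsilon> \<le> U N t" using b[of N] by (auto simp: bump_def)
    have "\<bar>U N t - u t\<bar> \<le> \<epsilon> / 2" "u t \<le> 0" using N n t(1) by (blast, force)
    then show False using t \<open>\<epsilon> > 0\<close> by linarith
  qed
  moreover have "u (-H) = 0" "u H = 0" using z[of H] z[of "-H"] lo[of H] lo[of "-H"] H by auto
  moreover have "u t < R" if "t \<in> {-H..H}" for t using hi[OF that] \<open>M < R\<close> by simp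
  ultimately have "dirichlet_sol u v" unfolding dirichlet_sol_def using u(1) lo by blast
  then show thesis using that conv by blast
qed

text \<open>By contradiction with tolerances 1/(n+1): along a subsequence both bumps tend to the
  unique Dirichlet solution, so \<open>dq\<close> tends to \<open>g\<close> of it and the functions
  \<open>w\<close> tend to a solution of the linearised Dirichlet problem. This limit is 0, although
  each \<open>w\<close> reaches modulus 1.\<close>

lemma bump_estimate:
  assumes "M < R" "\<epsilon> > 0"
  shows "\<exists>\<delta>>0. \<forall>u1 v1 u2 v2 w w'. bump M \<epsilon> \<delta> u1 v1 \<longrightarrow> bump M \<epsilon> \<delta> u2 v2 \<longrightarrow>
    c2_on (-H) H w w' (\<lambda>t. - (cos (\<omega> * t) * dq (u1 t) (u2 t) * w t)) \<longrightarrow> (\<forall>t\<in>{-H..H}. \<bar>w t\<bar> \<le> 1) \<longrightarrow>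
    \<bar>w (-H)\<bar> \<le> \<delta> \<longrightarrow> \<bar>w H\<bar> \<le> \<delta> \<longrightarrow> (\<forall>t\<in>{-H..H}. \<bar>w t\<bar> < 1)"
proof (rule ccontr)
  define Q where "Q = (\<lambda>\<delta> u1 v1 u2 v2 w w'. bump M \<epsilon> \<delta> u1 v1 \<and> bump M \<epsilon> \<delta> u2 v2 \<and>
    c2_on (-H) H w w' (\<lambda>t. - (cos (\<omega> * t) * dq (u1 t) (u2 t) * w t)) \<and> (\<forall>t\<in>{-H..H}. \<bar>w t\<bar> \<le> 1) \<and>
    \<bar>w (-H)\<bar> \<le> \<delta> \<and> \<bar>w H\<bar> \<le> \<delta> \<and> (\<exists>t\<in>{-H..H}. \<bar>w t\<bar> \<ge> 1))"
  assume n: "\<not> ?thesis"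
  have "\<exists>u1 v1 u2 v2 w w'. Q \<delta> u1 v1 u2 v2 w w'" if "\<delta> > 0" for \<delta>
    using n that unfolding Q_def by (simp add: not_less[symmetric])
  then have "\<forall>n. \<exists>u1 v1 u2 v2 w w'. Q (1 / real (Suc n)) u1 v1 u2 v2 w w'" by simp
  then obtain U1 V1 U2 V2 W W' where X: "\<And>n. Q (1 / real (Suc n)) (U1 n) (V1 n) (U2 n) (V2 n) (W n) (W' n)"
    by metis
  have b1: "bump M \<epsilon> (1 / real (Suc n)) (U1 n) (V1 n)" and b2: "bump M \<epsilon> (1 / real (Suc n)) (U2 n) (V2 n)"
    and W: "c2_on (-H) H (W n) (W' n) (\<lambda>t. - (cos (\<omega> * t) * dq (U1 n t) (U2 n t) * W n t))"
    and W1: "\<And>t. t \<in> {-H..H} \<Longrightarrow> \<bar>W n t\<bar> \<le> 1" and W0: "\<bar>W n (-H)\<bar> \<le> 1 / real (Suc n)" "\<bar>W n H\<bar> \<le> 1 / real (Suc n)"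
    and W2: "\<exists>t\<in>{-H..H}. \<bar>W n t\<bar> \<ge> 1" for n
    using X[of n] unfolding Q_def by auto
  have rng: "0 \<le> U1 n t" "U1 n t < R" "0 \<le> U2 n t" "U2 n t < R" if "t \<in> {-H..H}" for n t
    using b1[of n] b2[of n] that assms(1) unfolding bump_def by force+
  have W'b: "\<bar>W' n (-H)\<bar> \<le> 2 * 1 / (H - - H) + K * (H - - H)" for n
  proof (rule slope_bound[OF W, where x = "-H"])
    fix t assume t: "t \<in> {-H..H}"
    have "\<bar>cos (\<omega> * t) * dq (U1 n t) (U2 n t) * W n t\<bar> \<le> 1 * K * 1"
      unfolding abs_mult using W1[OF t, of n] dq_nonneg[of "U1 n t" "U2 n t"] dq_le_K[of "U1 n t" "U2 n t"] rng[OF t, of n] K_pos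
      by (intro mult_mono) auto
    then show "\<bar>- (cos (\<omega> * t) * dq (U1 n t) (U2 n t) * W n t)\<bar> \<le> K" by simp
  qed (use W1 H in auto)
  \<comment> \<open>These five numbers determine the limits of all three functions; the sixth,
    \<open>W n (-H)\<close>, tends to 0 anyway.\<close>
  define Z where "Z = (\<lambda>n. (U1 n (-H), V1 n (-H), U2 n (-H), V2 n (-H), W' n (-H)))"
  define B where "B = max M (max (2 * M / (2 * H) + K * M * (2 * H)) (2 * 1 / (H - - H) + K * (H - - H)))"
  have "bounded (range Z)"
  proof -
    have bp: "\<bar>U1 n (-H)\<bar> \<le> B" "\<bar>U2 n (-H)\<bar> \<le> B" "\<bar>V1 n (-H)\<bar> \<le> B" "\<bar>V2 n (-H)\<bar> \<le> B" "\<bar>W' n (-H)\<bar> \<le> B" for n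
    proof -
      have "-H \<in> {-H..H}" using H by simp
      then have "0 \<le> U1 n (-H)" "U1 n (-H) \<le> M" "0 \<le> U2 n (-H)" "U2 n (-H) \<le> M"
        using b1[of n] b2[of n] unfolding bump_def by blast+
      then show "\<bar>U1 n (-H)\<bar> \<le> B" "\<bar>U2 n (-H)\<bar> \<le> B" "\<bar>V1 n (-H)\<bar> \<le> B" "\<bar>V2 n (-H)\<bar> \<le> B" "\<bar>W' n (-H)\<bar> \<le> B"
        using bump_deriv_bound[OF b1[of n]] bump_deriv_bound[OF b2[of n]] W'b[of n] unfolding B_def by auto
    qed
    have "range Z \<subseteq> {-B..B} \<times> {-B..B} \<times> {-B..B} \<times> {-B..B} \<times> {-B..B}"
      using bp by (auto simp: Z_def abs_le_iff minus_le_iff)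
    then show ?thesis
      by (rule bounded_subset[rotated]) (intro bounded_Times bounded_closed_interval)
  qed
  then obtain l r where r: "strict_mono r" "(Z \<circ> r) \<longlonglongrightarrow> l"
    using bounded_imp_convergent_subsequence by blast
  obtain x1 y1 x2 y2 yw where l: "l = (x1, y1, x2, y2, yw)" by (cases l)
  have lims: "(\<lambda>n. U1 (r n) (-H)) \<longlonglongrightarrow> x1" "(\<lambda>n. V1 (r n) (-H)) \<longlonglongrightarrow> y1" "(\<lambda>n. U2 (r n) (-H)) \<longlonglongrightarrow> x2"
    "(\<lambda>n. V2 (r n) (-H)) \<longlonglongrightarrow> y2" "(\<lambda>n. W' (r n) (-H)) \<longlonglongrightarrow> yw"
    using r(2)[THEN tendsto_fst] r(2)[THEN tendsto_snd, THEN tendsto_fst]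
      r(2)[THEN tendsto_snd, THEN tendsto_snd, THEN tendsto_fst]
      r(2)[THEN tendsto_snd, THEN tendsto_snd, THEN tendsto_snd, THEN tendsto_fst]
      r(2)[THEN tendsto_snd, THEN tendsto_snd, THEN tendsto_snd, THEN tendsto_snd]
    by (simp_all add: Z_def l o_def)
  have rn: "1 / real (Suc (r n)) \<le> 1 / real (Suc n)" for n
    using seq_suble[OF r(1), of n] by (simp add: field_simps)
  have br: "bump M \<epsilon> (1 / real (Suc n)) u v" if "bump M \<epsilon> (1 / real (Suc (r n))) u v" for n u v
    using that rn[of n] unfolding bump_def by (meson order_trans)
  obtain u1 v1 where u1: "dirichlet_sol u1 v1"
    "\<And>e. e > 0 \<Longrightarrow> \<forall>\<^sub>F n in sequentially. \<forall>t\<in>{-H..H}. \<bar>U1 (r n) t - u1 t\<bar> \<le> e"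
    using bump_limit[OF br[OF b1[of "r _"]] assms lims(1,2)] by blast
  obtain u2 v2 where u2: "dirichlet_sol u2 v2"
    "\<And>e. e > 0 \<Longrightarrow> \<forall>\<^sub>F n in sequentially. \<forall>t\<in>{-H..H}. \<bar>U2 (r n) t - u2 t\<bar> \<le> e"
    using bump_limit[OF br[OF b2[of "r _"]] assms lims(3,4)] by blast
  have uR: "0 \<le> u1 t" "u1 t < R" if "t \<in> {-H..H}" for t
    using u1(1) that by (auto simp: dirichlet_sol_def)
  have uc: "continuous_on {-H..H} u1"
    by (rule c2_on_cont(1)) (use u1(1) in \<open>auto simp: dirichlet_sol_def\<close>)
  obtain w w' where w: "cos_lin u1 (-H) H w w'" "w (-H) = 0" "w' (-H) = yw"
  proof (rule linear_ivp[of "-H" H "\<lambda>t. cos (\<omega> * t) * g (u1 t)" K 0 yw])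
    show "continuous_on {-H..H} (\<lambda>t. cos (\<omega> * t) * g (u1 t))"
      by (intro continuous_intros continuous_on_compose2[OF g_cont[of UNIV] uc]) auto
    show "\<bar>cos (\<omega> * t) * g (u1 t)\<bar> \<le> K" if "t \<in> {-H..H}" for t
      using linearised_bound[of "cos (\<omega> * t)" "u1 t" 1] uR(2)[OF that] by simp
  qed (use H in auto)
  obtain D where D: "D > 0" "\<And>t. t \<in> {-H..H} \<Longrightarrow> \<bar>w t\<bar> \<le> D"
  proof -
    have "bounded (w ` {-H..H})"
      by (intro compact_imp_bounded compact_continuous_image c2_on_cont(1)[OF w(1)]) auto
    then show thesis using that by (auto simp: bounded_pos)
  qed
  have conv: "\<forall>\<^sub>F n in sequentially. \<forall>t\<in>{-H..H}. \<bar>W (r n) t - w t\<bar> \<le> e" if e: "e > 0" for e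
  proof -
    define \<eta> where "\<eta> = e / (2 * exp ((K + 2) * (H - - H)))"
    have \<eta>: "\<eta> > 0" using e by (simp add: \<eta>_def)
    obtain d where d: "d > 0" "\<And>x y z. 0 \<le> z \<Longrightarrow> z < R \<Longrightarrow> x < R \<Longrightarrow> y < R \<Longrightarrow> \<bar>x - z\<bar> \<le> d \<Longrightarrow> \<bar>y - z\<bar> \<le> d \<Longrightarrow> \<bar>dq x y - g z\<bar> \<le> \<eta> / D"
      using dq_uniform[of "\<eta> / D"] \<eta> D(1) by (metis divide_pos_pos)
    have "\<forall>\<^sub>F n in sequentially. \<bar>W' (r n) (-H) - yw\<bar> < \<eta>"
      using lims(5)[THEN tendstoD, OF \<eta>] by (auto simp: dist_real_def)
    moreover have "\<forall>\<^sub>F n in sequentially. 1 / real (Suc n) < \<eta>"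
      by (rule order_tendstoD(2)[OF LIMSEQ_Suc[OF lim_1_over_n] \<eta>])
    ultimately show ?thesis using u1(2)[OF d(1)] u2(2)[OF d(1)]
    proof eventually_elim
      case (elim n)
      show ?case
      proof
        fix t assume t: "t \<in> {-H..H}"
        have "\<bar>W (r n) t - w t\<bar> \<le> 2 * exp ((K + 2) * (H - - H)) * \<eta>"
        proof (rule linear_stable[OF W w(1)])
          fix s assume s: "s \<in> {-H..H}"
          show "\<bar>dq (U1 (r n) s) (U2 (r n) s) - g (u1 s)\<bar> \<le> \<eta> / D"
            using bspec[OF elim(3) s] bspec[OF elim(4) s] dirichlet_sol_unique[OF u1(1) u2(1) s]
            by (intro d(2) uR[OF s] rng[OF s]) auto
          show "0 \<le> dq (U1 (r n) s) (U2 (r n) s)" "dq (U1 (r n) s) (U2 (r n) s) \<le> K"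
            using rng[OF s, of "r n"] dq_le_K dq_nonneg by auto
        next
          show "\<bar>W (r n) (-H) - w (-H)\<bar> \<le> \<eta>" using W0(1)[of "r n"] rn[of n] elim(2) w(2) by simp
          show "\<bar>W' (r n) (-H) - w' (-H)\<bar> \<le> \<eta>" using elim(1) w(3) by simp
        qed (use D t in auto)
        then show "\<bar>W (r n) t - w t\<bar> \<le> e" by (simp add: \<eta>_def)
      qed
    qed
  qed
  have "w H = 0"
  proof (rule ccontr)
    assume "w H \<noteq> 0"
    then have e: "\<bar>w H\<bar> / 4 > 0" by simp
    have "\<forall>\<^sub>F n in sequentially. 1 / real (Suc n) < \<bar>w H\<bar> / 4"
      by (rule order_tendstoD(2)[OF LIMSEQ_Suc[OF lim_1_over_n] e])
    with conv[OF e] have "\<forall>\<^sub>F n in sequentially. False"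
    proof eventually_elim
      case (elim n)
      then have "\<bar>W (r n) H - w H\<bar> \<le> \<bar>w H\<bar> / 4" using H by auto
      then show False using W0(2)[of "r n"] rn[of n] elim(2) e by linarith
    qed
    then show False by simp
  qed
  then have wz: "w t = 0" if "t \<in> {-H..H}" for t
    using dirichlet_sol_nondegenerate[OF u1(1) w(1,2) _ that] by simp
  have "\<forall>\<^sub>F n in sequentially. False" using conv[of "1/2", simplified]
  proof eventually_elim
    case (elim n)
    obtain t where t: "t \<in> {-H..H}" "\<bar>W (r n) t\<bar> \<ge> 1" using W2 by blast
    have "\<bar>W (r n) t - w t\<bar> \<le> 1/2" using elim t(1) by auto
    then show False using t wz[OF t(1)] by simp
  qed
  then show False by simp
qed

end

section \<open>Estimates on a single hump\<close>

lemma sin_ge_sin: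
  assumes "0 \<le> \<delta>" "\<delta> \<le> pi / 2" "\<delta> \<le> x" "x \<le> pi - \<delta>"
  shows "sin \<delta> \<le> sin x"
proof (cases "x \<le> pi / 2")
  case True
  then show ?thesis using assms by (intro sin_monotone_2pi_le) auto
next
  case False
  then have "sin \<delta> \<le> sin (pi - x)" using assms by (intro sin_monotone_2pi_le) auto
  then show ?thesis by simp
qed

section \<open>Convexity and Sturm comparison\<close>

text \<open>The tangent inequalities from \<open>s\<close> to both ends, weighted so that the slope
  at \<open>s\<close> cancels.\<close>

lemma convex_chord:
  assumes u: "c2_on c d u v A" and "\<And>t. t \<in> {c..d} \<Longrightarrow> 0 \<le> A t" and s: "s \<in> {c..d}"
  shows "(d - c) * u s \<le> (d - s) * u c + (s - c) * u d"
proof -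
  have "u s + v s * (c - s) \<le> u c" "u s + v s * (d - s) \<le> u d"
    using taylor_ge[OF u, of s c 0] taylor_ge[OF u, of s d 0] assms by auto
  then have "(d - s) * (u s + v s * (c - s)) \<le> (d - s) * u c" "(s - c) * (u s + v s * (d - s)) \<le> (s - c) * u d"
    using s by (auto intro!: mult_left_mono)
  then show ?thesis by (simp add: algebra_simps)
qed

text \<open>A Sturm comparison: \<open>w / u\<close> has derivative at least \<open>\<theta> / u\<^sup>2\<close>, and \<open>u\<close> lies below its chord,
  for which this lower bound integrates explicitly.\<close>

lemma ratio_growth:
  assumes u: "c2_on c d u v A" and w: "c2_on c d w w' B" and "c < d"
    and upos: "\<And>t. t \<in> {c..d} \<Longrightarrow> u t > 0" and A: "\<And>t. t \<in> {c..d} \<Longrightarrow> 0 \<le> A t"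
    and AB: "\<And>t. t \<in> {c..d} \<Longrightarrow> w t > 0 \<Longrightarrow> w t * A t \<le> B t * u t"
    and \<theta>: "0 < \<theta>" "\<theta> \<le> w' c * u c - w c * v c" and "w c > 0"
  shows "\<theta> * (d - c) / u c \<le> w d"
proof -
  define W where "W = (\<lambda>t. w' t * u t - w t * v t)"
  have Wd: "(W has_real_derivative B t * u t - w t * A t) (at t within {c..d})" if t: "t \<in> {c..d}" for t
    unfolding W_def using c2_onD[OF u t] c2_onD[OF w t]
    by (auto intro!: derivative_eq_intros simp: algebra_simps)
  have Wge: "\<theta> \<le> W z" if z: "c \<le> z" "z \<le> d" "\<And>t. c \<le> t \<Longrightarrow> t < z \<Longrightarrow> w t > 0" for z
  proof -
    have "0 * (z - c) \<le> W z - W c"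
      by (rule deriv_ge[OF Wd]) (use z AB in auto)
    then show ?thesis using \<theta> by (simp add: W_def)
  qed
  \<comment> \<open>At a first zero of \<open>w\<close> the Wronskian would be w' u \<le> 0, but up
    to there it has not fallen below \<theta>.\<close>
  have wpos: "w t > 0" if t: "t \<in> {c..d}" for t
  proof (rule ccontr)
    assume "\<not> w t > 0"
    then obtain z where z: "c < z" "z \<le> t" "w z = 0" "\<And>t. c \<le> t \<Longrightarrow> t < z \<Longrightarrow> w t > 0"
      by - (rule first_zero[of c t w], use t \<open>w c > 0\<close> in \<open>auto intro: continuous_on_subset[OF c2_on_cont(1)[OF w]]\<close>)
    have "w' z \<le> 0"
      by (rule deriv_at_first_zero[OF c2_onD(1)[OF w], of z c]) (use z t in auto)
    moreover have "\<theta> \<le> W z" using z t by (intro Wge) auto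
    ultimately show False using z(3) \<theta>(1) upos[of z] z(1,2) t
      by (simp add: W_def) (smt (verit) mult_nonpos_nonneg)
  qed
  define L where "L = (\<lambda>s. u c + (u d - u c) * ((s - c) / (d - c)))"
  have Lge: "u s \<le> L s" if s: "s \<in> {c..d}" for s
  proof -
    have "(d - c) * u s \<le> (d - s) * u c + (s - c) * u d" by (rule convex_chord[OF u A s])
    also have "\<dots> = (d - c) * L s" using \<open>c < d\<close> by (simp add: L_def field_simps)
    finally show ?thesis using \<open>c < d\<close> by simp
  qed
  \<comment> \<open>The subtracted quotient is the antiderivative of \<theta> / L^2 that vanishes at
    \<open>c\<close>.\<close>
  define \<phi> where "\<phi> = (\<lambda>s. w s / u s - \<theta> * (s - c) / (u c * L s))"
  have uc: "u c > 0" using upos[of c] \<open>c < d\<close> by simp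
  have \<phi>d: "(\<phi> has_real_derivative (W s / (u s)\<^sup>2 - \<theta> / (L s)\<^sup>2)) (at s within {c..d})" if s: "s \<in> {c..d}" for s
  proof -
    have Lp: "L s > 0" using Lge[OF s] upos[OF s] by simp
    have 1: "((\<lambda>s. w s / u s) has_real_derivative W s / (u s)\<^sup>2) (at s within {c..d})"
      using c2_onD(1)[OF u s] c2_onD(1)[OF w s] upos[OF s]
      by (auto intro!: derivative_eq_intros simp: W_def power2_eq_square)
    have Ld: "(L has_real_derivative (u d - u c) / (d - c)) (at s within {c..d})"
      unfolding L_def using \<open>c < d\<close> by (auto intro!: derivative_eq_intros)
    have "((\<lambda>s. \<theta> * (s - c) / (u c * L s)) has_real_derivative
       (\<theta> * (u c * L s) - \<theta> * (s - c) * (u c * ((u d - u c) / (d - c)))) / (u c * L s * (u c * L s))) (at s within {c..d})"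
      using Ld Lp uc by (auto intro!: derivative_eq_intros)
    moreover have "\<theta> * (u c * L s) - \<theta> * (s - c) * (u c * ((u d - u c) / (d - c))) = \<theta> * (u c * u c)"
      by (simp add: L_def algebra_simps)
    then have "(\<theta> * (u c * L s) - \<theta> * (s - c) * (u c * ((u d - u c) / (d - c)))) / (u c * L s * (u c * L s)) = \<theta> / (L s)\<^sup>2"
      using uc Lp by (simp add: power2_eq_square)
    ultimately have 2: "((\<lambda>s. \<theta> * (s - c) / (u c * L s)) has_real_derivative \<theta> / (L s)\<^sup>2) (at s within {c..d})"
      by simp
    show ?thesis unfolding \<phi>_def by (rule DERIV_diff[OF 1 2])
  qed
  have "0 * (d - c) \<le> \<phi> d - \<phi> c"
  proof (rule deriv_ge[OF \<phi>d])
    fix s assume "c < s" "s < d"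
    then have s: "s \<in> {c..d}" by simp
    have "\<theta> / (L s)\<^sup>2 \<le> \<theta> / (u s)\<^sup>2"
      using Lge[OF s] upos[OF s] \<theta>(1) by (intro divide_left_mono power_mono) auto
    also have "\<dots> \<le> W s / (u s)\<^sup>2" using s wpos by (intro divide_right_mono Wge) auto
    finally show "0 \<le> W s / (u s)\<^sup>2 - \<theta> / (L s)\<^sup>2" by simp
  qed (use \<open>c < d\<close> in auto)
  moreover have "\<phi> c > 0" using \<open>w c > 0\<close> uc by (simp add: \<phi>_def)
  ultimately have "\<phi> d > 0" by simp
  moreover have "L d = u d" using \<open>c < d\<close> by (simp add: L_def)
  moreover have ud: "u d > 0" using upos[of d] \<open>c < d\<close> by simp
  ultimately have "\<theta> * (d - c) / (u c * u d) < w d / u d" by (simp add: \<phi>_def)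
  then have "\<theta> * (d - c) / (u c * u d) * u d < w d" using ud by (simp add: pos_less_divide_eq)
  then show ?thesis using ud by simp
qed

context cos_problem
begin

definition l :: real where "l = pi / \<omega>"

text \<open>On the middle half of the hump a solution with maximum M is at least M/4 and the sine is
  at least 1/2. The resulting concavity is compatible with nonnegative values only if (M/4)^(p-1)
  l^2 \<le> 256.\<close>

definition M0 :: real where "M0 = 4 * (256 / l\<^sup>2) powr (1 / (p - 1))"

lemma l: "l > 0" "l = 2 * H" "\<omega> * l = pi"
  using \<omega> by (auto simp: l_def H_def)

lemma M0_pos: "M0 > 0"
  using l by (simp add: M0_def)

lemma sin_nonneg: "c \<le> t \<Longrightarrow> t \<le> c + l \<Longrightarrow> 0 \<le> sin (\<omega> * (t - c))"
proof -
  assume t: "c \<le> t" "t \<le> c + l"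
  then have "\<omega> * (t - c) \<le> \<omega> * l" using \<omega> by (intro mult_left_mono) auto
  then have "\<omega> * (t - c) \<le> pi" by (simp only: l(3))
  then show ?thesis using t \<omega> by (intro sin_ge_zero) auto
qed

lemma sin_lower:
  assumes "0 \<le> d" "d \<le> l / 2" "c + d \<le> t" "t \<le> c + l - d"
  shows "sin (\<omega> * d) \<le> sin (\<omega> * (t - c))"
proof (rule sin_ge_sin)
  show "0 \<le> \<omega> * d" using assms \<omega> by simp
  have "\<omega> * d \<le> \<omega> * (l / 2)" using assms \<omega> by (intro mult_left_mono) auto
  then show "\<omega> * d \<le> pi / 2" using l by simp
  show "\<omega> * d \<le> \<omega> * (t - c)" using assms \<omega> by (intro mult_left_mono) auto
  have "\<omega> * (t - c) \<le> \<omega> * (l - d)" using assms \<omega> by (intro mult_left_mono) auto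
  then show "\<omega> * (t - c) \<le> pi - \<omega> * d" using l by (simp add: right_diff_distrib)
qed

lemma sin_reflect: "sin (\<omega> * (c + l - t)) = sin (\<omega> * (t - c))"
proof -
  have "\<omega> * (c + l - t) = pi - \<omega> * (t - c)" using l(3) by (simp add: algebra_simps)
  then show ?thesis by simp
qed

text \<open>Stated for every \<open>F\<close> above the truncated nonlinearity, so that it serves
  the truncated problem and the original power alike.\<close>

lemma apriori_bound:
  assumes u: "c2_on c (c + l) u v (\<lambda>t. - (sin (\<omega> * (t - c)) * F (u t)))"
    and nn: "\<And>t. t \<in> {c..c+l} \<Longrightarrow> 0 \<le> u t" and F: "\<And>x. 0 \<le> x \<Longrightarrow> x * min x R powr (p - 1) \<le> F x"
    and MR: "M0 < R" and t: "t \<in> {c..c+l}"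
  shows "u t \<le> M0"
proof -
  note c2_on_cont(1)[OF u]
  then obtain s where s: "s \<in> {c..c+l}" "\<And>t. t \<in> {c..c+l} \<Longrightarrow> u t \<le> u s"
    using continuous_attains_sup[of "{c..c+l}" u] l by auto
  define M where "M = u s"
  have M: "u t \<le> M" if "t \<in> {c..c+l}" for t using s that by (simp add: M_def)
  have Fnn: "0 \<le> F x" if "0 \<le> x" for x
    using F[OF that] that by (meson mult_nonneg_nonneg order_trans powr_ge_zero)
  have neg: "- (sin (\<omega> * (t - c)) * F (u t)) \<le> 0" if "t \<in> {c..c+l}" for t
    using Fnn[OF nn[OF that]] sin_nonneg that by simp
  \<comment> \<open>From a point of the middle half, the maximum is at most three times as far away
    as the opposite end, where \<open>u\<close> is nonnegative. The tangent lies above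
    \<open>u\<close> at both.\<close>
  have quarter: "M / 4 \<le> u t" if t: "c + l / 4 \<le> t" "t \<le> c + 3 * l / 4" for t
  proof -
    have tm: "t \<in> {c..c+l}" using t l by auto
    have tay: "u y \<le> u t + v t * (y - t)" if "y \<in> {c..c+l}" for y
      using taylor_le[OF u tm that neg] by simp
    have 1: "M \<le> u t + v t * (s - t)" using tay[OF s(1)] by (simp add: M_def)
    have 2: "v t * (t - c) \<le> u t" using tay[of c] nn[of c] l by (simp add: algebra_simps)
    have 3: "- v t * (c + l - t) \<le> u t" using tay[of "c + l"] nn[of "c + l"] l by (simp add: algebra_simps)
    consider "v t * (s - t) \<le> 0" | "v t > 0" "s > t" | "v t < 0" "s < t"
      by (metis linorder_neqE_linordered_idom mult_le_0_iff diff_gt_0_iff_gt diff_le_0_iff_le diff_less_0_iff_less less_eq_real_def)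
    then show ?thesis
    proof cases
      case 1
      then show ?thesis using \<open>M \<le> u t + v t * (s - t)\<close> nn[OF tm] by simp
    next
      case 2
      have "v t * (s - t) \<le> v t * (3 * (t - c))" using 2 t s by (intro mult_left_mono) auto
      then show ?thesis using 1 \<open>v t * (t - c) \<le> u t\<close> by linarith
    next
      case c: 3
      have "- v t * (t - s) \<le> - v t * (3 * (c + l - t))" using c t s by (intro mult_left_mono) auto
      then have "v t * (s - t) \<le> 3 * (- v t * (c + l - t))" by (simp add: algebra_simps)
      then show ?thesis using 1 3 by linarith
    qed
  qed
  have "M \<le> M0"
  proof (rule ccontr)
    assume "\<not> M \<le> M0"
    then have M4: "M > M0" "M > 0" using M0_pos by auto
    \<comment> \<open>Since R > M0, the cap at \<open>R\<close> still leaves \<rho> above M0/4,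
      which is what the contradiction uses.\<close>
    define \<rho> where "\<rho> = min (M / 4) R"
    have \<rho>: "\<rho> > M0 / 4" using M4 MR M0_pos by (auto simp: \<rho>_def)
    define G where "G = M / 4 * \<rho> powr (p - 1)"
    have G: "G \<le> F (u t)" if "c + l / 4 \<le> t" "t \<le> c + 3 * l / 4" for t
    proof -
      have "G \<le> u t * min (u t) R powr (p - 1)" unfolding G_def \<rho>_def
        using quarter[OF that] M4 p R by (intro mult_mono powr_mono2) auto
      also have "\<dots> \<le> F (u t)" using quarter[OF that] M4 by (intro F) auto
      finally show ?thesis .
    qed
    have Gnn: "0 \<le> G" using M4 by (simp add: G_def)
    note u' = c2_on_subset[OF u, of "c + l / 4" "c + 3 * l / 4"]
    have acc: "- (sin (\<omega> * (t - c)) * F (u t)) \<le> - G / 2" if t: "t \<in> {c + l / 4..c + 3 * l / 4}" for t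
    proof -
      have "1 / 2 \<le> sin (\<omega> * (t - c))"
      proof -
        have "sin (pi / 6) \<le> sin (\<omega> * (l / 4))" using l(3) pi_gt_zero by (intro sin_monotone_2pi_le) auto
        also have "\<dots> \<le> sin (\<omega> * (t - c))" using t l by (intro sin_lower) auto
        finally show ?thesis by (simp add: sin_30)
      qed
      then have "1 / 2 * G \<le> sin (\<omega> * (t - c)) * F (u t)"
        using G[of t] t Gnn by (intro mult_mono) auto
      then show ?thesis by simp
    qed
    have tay: "u y \<le> u (c + l / 2) + v (c + l / 2) * (y - (c + l / 2)) + (- G / 2) * (y - (c + l / 2))\<^sup>2 / 2"
      if "y \<in> {c + l / 4..c + 3 * l / 4}" for y
      by (rule taylor_le[OF u' _ that acc]) (use l in auto)
    have "u (c + l / 4) \<le> u (c + l / 2) + v (c + l / 2) * (- l / 4) + (- G / 2) * (- l / 4)\<^sup>2 / 2"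
      using tay[of "c + l / 4"] l by (simp add: field_simps)
    moreover have "u (c + 3 * l / 4) \<le> u (c + l / 2) + v (c + l / 2) * (l / 4) + (- G / 2) * (l / 4)\<^sup>2 / 2"
      using tay[of "c + 3 * l / 4"] l by (simp add: field_simps)
    moreover have "0 \<le> u (c + l / 4)" "0 \<le> u (c + 3 * l / 4)" "u (c + l / 2) \<le> M" using nn M l by auto
    ultimately have "G * l\<^sup>2 \<le> 64 * M" by (simp add: power2_eq_square field_simps)
    then have "M / 4 * (\<rho> powr (p - 1) * l\<^sup>2) \<le> M / 4 * 256" by (simp add: G_def algebra_simps)
    then have "\<rho> powr (p - 1) * l\<^sup>2 \<le> 256" using M4 by (simp only: mult_le_cancel_left_pos)
    then have "\<rho> powr (p - 1) \<le> 256 / l\<^sup>2" using l by (simp add: field_simps)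
    then have "(\<rho> powr (p - 1)) powr (1 / (p - 1)) \<le> (256 / l\<^sup>2) powr (1 / (p - 1))"
      using p by (intro powr_mono2) auto
    then have "\<rho> \<le> M0 / 4" using p \<rho> M0_pos by (simp add: powr_powr M0_def)
    with \<rho> show False by simp
  qed
  then show ?thesis using M[OF t] by simp
qed

text \<open>Within the distance \<open>d\<close> the initial slope can lower \<open>u\<close> by at
  most \<delta>/2. On the second half of that stretch the sine is bounded away from 0, so a large
  \<mu> raises the slope to 2|Y|/l, and convexity preserves it over the rest, at least half of the
  hump. The bound on \<mu> is uniform in the hump and the solution.\<close>

lemma blow_up:
  assumes "\<delta> > 0"
  shows "\<exists>\<mu>0>0. \<forall>\<mu>\<ge>\<mu>0. \<forall>c u v. c2_on c (c + l) u v (\<lambda>t. \<mu> * sin (\<omega> * (t - c)) * f (u t)) \<longrightarrow>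
    \<delta> \<le> u c \<longrightarrow> - D \<le> v c \<longrightarrow> (\<forall>t\<in>{c..c+l}. 0 < u t) \<and> Y \<le> u (c + l)"
proof -
  define E where "E = \<bar>D\<bar> + 1"
  define d where "d = min (\<delta> / (2 * E)) (l / 2)"
  define \<kappa> where "\<kappa> = sin (\<omega> * (d / 2)) * f (\<delta> / 2)"
  have E: "E > 0" "D \<le> E" by (auto simp: E_def)
  have d: "d > 0" "d \<le> l / 2" "E * d \<le> \<delta> / 2"
  proof -
    show "d > 0" "d \<le> l / 2" using E assms l by (auto simp: d_def)
    have "E * d \<le> E * (\<delta> / (2 * E))" using E by (intro mult_left_mono) (auto simp: d_def)
    then show "E * d \<le> \<delta> / 2" using E by simp
  qed
  have "\<omega> * (d / 2) < pi"
  proof -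
    have "\<omega> * (d / 2) < \<omega> * l" using d l \<omega> by (intro mult_strict_left_mono) auto
    then show ?thesis using l by simp
  qed
  then have \<kappa>: "\<kappa> > 0" using \<omega> d assms by (auto simp: \<kappa>_def intro!: mult_pos_pos f_pos sin_gt_zero)
  \<comment> \<open>Over a length d/2 the slope gains at least \<mu> \<kappa> d/2; this has to
    offset the initial -E and leave 2|Y|/l.\<close>
  define \<mu>0 where "\<mu>0 = (E + 2 * \<bar>Y\<bar> / l) * 2 / (\<kappa> * d)"
  have \<mu>0: "\<mu>0 > 0" using E \<kappa> d l by (auto simp: \<mu>0_def intro!: divide_pos_pos mult_pos_pos add_pos_nonneg)
  show ?thesis
  proof (intro exI[of _ \<mu>0] conjI allI impI)
    show "\<mu>0 > 0" by (rule \<mu>0)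
  next
    fix \<mu> c u v
    assume \<mu>: "\<mu>0 \<le> \<mu>" and u: "c2_on c (c + l) u v (\<lambda>t. \<mu> * sin (\<omega> * (t - c)) * f (u t))"
      and uc: "\<delta> \<le> u c" and vc: "- D \<le> v c"
    have \<mu>p: "\<mu> > 0" using \<mu> \<mu>0 by simp
    have acc: "0 \<le> \<mu> * sin (\<omega> * (t - c)) * f (u t)" if "t \<in> {c..c+l}" for t
      using \<mu>p sin_nonneg[of c t] that f_nonneg by simp
    have tay: "u x + v x * (y - x) \<le> u y" if "x \<in> {c..c+l}" "y \<in> {c..c+l}" for x y
      using taylor_ge[OF u that acc] by simp
    have early: "\<delta> / 2 \<le> u t" if t: "t \<in> {c..c+d}" for t
    proof -
      have "- E * (t - c) \<le> v c * (t - c)" using t vc E by (intro mult_right_mono) auto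
      moreover have "E * (t - c) \<le> E * d" using t E by (intro mult_left_mono) auto
      moreover have "u c + v c * (t - c) \<le> u t" using tay[of c t] t d l by auto
      ultimately show ?thesis using d(3) uc by linarith
    qed
    have "0 * (c + d / 2 - c) \<le> v (c + d / 2) - v c"
      by (rule deriv_ge[OF c2_onD(2)[OF u]]) (use acc d in auto)
    then have v1: "- E \<le> v (c + d / 2)" using vc E by simp
    have "\<mu> * \<kappa> * ((c + d) - (c + d / 2)) \<le> v (c + d) - v (c + d / 2)"
    proof (rule deriv_ge[OF c2_onD(2)[OF u]])
      fix t assume t: "c + d / 2 < t" "t < c + d"
      have "\<kappa> \<le> sin (\<omega> * (t - c)) * f (u t)" unfolding \<kappa>_def
      proof (intro mult_mono)
        show "sin (\<omega> * (d / 2)) \<le> sin (\<omega> * (t - c))" using t d by (intro sin_lower) auto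
        show "f (\<delta> / 2) \<le> f (u t)" using t d by (intro f_mono early) auto
        show "0 \<le> sin (\<omega> * (t - c))" using t d l by (intro sin_nonneg) auto
      qed (simp add: f_nonneg)
      then have "\<mu> * \<kappa> \<le> \<mu> * (sin (\<omega> * (t - c)) * f (u t))" using \<mu>p by (intro mult_left_mono) auto
      then show "\<mu> * \<kappa> \<le> \<mu> * sin (\<omega> * (t - c)) * f (u t)" by (simp add: mult.assoc)
    qed (use d l in auto)
    moreover have "E + 2 * \<bar>Y\<bar> / l \<le> \<mu> * \<kappa> * (d / 2)"
    proof -
      have "\<mu>0 * (\<kappa> * d / 2) \<le> \<mu> * (\<kappa> * d / 2)" using \<mu> \<kappa> d by (intro mult_right_mono) auto
      moreover have "\<mu>0 * (\<kappa> * d / 2) = E + 2 * \<bar>Y\<bar> / l" using \<kappa> d by (simp add: \<mu>0_def)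
      ultimately show ?thesis by simp
    qed
    ultimately have v2: "2 * \<bar>Y\<bar> / l \<le> v (c + d)" using v1 by simp
    have ud: "\<delta> / 2 \<le> u (c + d)" using d by (intro early) auto
    have late: "\<delta> / 2 + 2 * \<bar>Y\<bar> / l * (t - (c + d)) \<le> u t" if t: "c + d \<le> t" "t \<le> c + l" for t
    proof -
      have "2 * \<bar>Y\<bar> / l * (t - (c + d)) \<le> v (c + d) * (t - (c + d))" using t v2 by (intro mult_right_mono) auto
      moreover have "u (c + d) + v (c + d) * (t - (c + d)) \<le> u t" using t d by (intro tay) auto
      ultimately show ?thesis using ud by linarith
    qed
    show "\<forall>t\<in>{c..c+l}. 0 < u t"
    proof
      fix t assume t: "t \<in> {c..c+l}"
      show "0 < u t"
      proof (cases "t \<le> c + d")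
        case True
        then show ?thesis using early[of t] t assms by auto
      next
        case False
        have "0 \<le> 2 * \<bar>Y\<bar> / l * (t - (c + d))" using False l by (intro mult_nonneg_nonneg) auto
        moreover have "\<delta> / 2 + 2 * \<bar>Y\<bar> / l * (t - (c + d)) \<le> u t" using False t by (intro late) auto
        ultimately show ?thesis using assms by linarith
      qed
    qed
    have "2 * \<bar>Y\<bar> / l * (l / 2) \<le> 2 * \<bar>Y\<bar> / l * (c + l - (c + d))" using d l by (intro mult_left_mono) auto
    then show "Y \<le> u (c + l)" using late[of "c + l"] l d assms by auto
  qed
qed

lemma blow_up_reflect:
  assumes "c2_on c (c + l) u v (\<lambda>t. \<mu> * sin (\<omega> * (t - c)) * f (u t))"
  shows "c2_on c (c + l) (\<lambda>t. u (2 * c + l - t)) (\<lambda>t. - v (2 * c + l - t)) (\<lambda>t. \<mu> * sin (\<omega> * (t - c)) * f (u (2 * c + l - t)))"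
proof -
  have "c2_on c (c + l) (\<lambda>t. u (- 1 * t + (2 * c + l))) (\<lambda>t. - 1 * v (- 1 * t + (2 * c + l)))
     (\<lambda>t. - 1 * - 1 * (\<mu> * sin (\<omega> * (- 1 * t + (2 * c + l) - c)) * f (u (- 1 * t + (2 * c + l)))))"
    by (rule c2_on_affine[OF assms]) auto
  moreover have "- 1 * t + (2 * c + l) = 2 * c + l - t" "2 * c + l - t - c = c + l - t" for t by auto
  ultimately show ?thesis by (simp only: sin_reflect) simp
qed

text \<open>Where the maximum \<epsilon> is attained the slope is nonnegative; at the left end this
  is the assumption on \<open>v c\<close>. From there on the second derivative is at least
  -\<epsilon>^p, and the last condition on \<epsilon> limits the loss of height to
  \<epsilon>/4.\<close>

lemma threshold_end:
  assumes u: "c2_on c (c + l) u v (\<lambda>t. - (sin (\<omega> * (t - c)) * f (u t)))" and vc: "0 \<le> v c"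
    and le: "\<And>t. t \<in> {c..c+l} \<Longrightarrow> u t \<le> \<epsilon>" and s: "s \<in> {c..c+l}" "u s = \<epsilon>"
    and \<epsilon>: "0 < \<epsilon>" "\<epsilon> \<le> R" "\<epsilon> powr (p - 1) * l\<^sup>2 \<le> 1 / 2"
  shows "\<epsilon> / 2 \<le> u (c + l)" "- (\<epsilon> / l) \<le> v (c + l)"
proof -
  define G where "G = \<epsilon> * \<epsilon> powr (p - 1)"
  have f\<epsilon>: "f \<epsilon> = G" using \<epsilon> by (simp add: f_eq G_def)
  have acc: "- G \<le> - (sin (\<omega> * (t - c)) * f (u t))" if t: "t \<in> {c..c+l}" for t
  proof -
    have "sin (\<omega> * (t - c)) * f (u t) \<le> 1 * f (u t)" by (intro mult_right_mono f_nonneg) auto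
    also have "\<dots> \<le> G" using f_mono[OF le[OF t]] f\<epsilon> by simp
    finally show ?thesis by simp
  qed
  have "0 \<le> v s"
  proof (rule ccontr)
    assume "\<not> 0 \<le> v s"
    then have n: "v s < 0" by simp
    then have "s \<noteq> c" using vc by auto
    from has_real_derivative_neg_dec_left[OF c2_onD(1)[OF u s(1)] n] obtain e where
      e: "e > 0" "\<And>h. 0 < h \<Longrightarrow> s - h \<in> {c..c+l} \<Longrightarrow> h < e \<Longrightarrow> u s < u (s - h)" by blast
    define h where "h = min (e / 2) (s - c)"
    have "0 < h" "s - h \<in> {c..c+l}" "h < e" using e(1) s \<open>s \<noteq> c\<close> by (auto simp: h_def)
    then show False using e(2)[of h] le[of "s - h"] s(2) by simp
  qed
  have Gl: "G * l\<^sup>2 \<le> \<epsilon> / 2"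
  proof -
    have "\<epsilon> * (\<epsilon> powr (p - 1) * l\<^sup>2) \<le> \<epsilon> * (1 / 2)" using \<epsilon> by (intro mult_left_mono) auto
    then show ?thesis by (simp add: G_def mult.assoc)
  qed
  have G: "0 \<le> G" using \<epsilon> by (simp add: G_def)
  have "u s + v s * (c + l - s) + (- G) * (c + l - s)\<^sup>2 / 2 \<le> u (c + l)"
    by (rule taylor_ge[OF u s(1) _ acc]) (use l in auto)
  moreover have "0 \<le> v s * (c + l - s)" using \<open>0 \<le> v s\<close> s by simp
  moreover have "G * (c + l - s)\<^sup>2 \<le> G * l\<^sup>2" using s G by (intro mult_left_mono power_mono) auto
  ultimately show "\<epsilon> / 2 \<le> u (c + l)" using Gl s(2) \<epsilon>(1) by simp
  have "(- G) * (c + l - s) \<le> v (c + l) - v s"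
    by (rule deriv_ge[OF c2_onD(2)[OF u]]) (use s acc in auto)
  moreover have "G * (c + l - s) \<le> G * l" using s G by (intro mult_left_mono) auto
  moreover have "G * l \<le> \<epsilon> / l"
  proof -
    have "G * l\<^sup>2 / l \<le> (\<epsilon> / 2) / l" using Gl l by (intro divide_right_mono) auto
    also have "\<dots> \<le> \<epsilon> / l" using l \<epsilon> by (intro divide_right_mono) auto
    finally show ?thesis using l by (simp add: power2_eq_square)
  qed
  ultimately show "- (\<epsilon> / l) \<le> v (c + l)" using \<open>0 \<le> v s\<close> by simp
qed

text \<open>The tangent at an end lies above the concave \<open>u\<close>, which differs there from
  its value at \<open>s\<close> by at least \<epsilon>/2, over a distance of at most
  \<open>l\<close>.\<close>

lemma end_slope:
  assumes u: "c2_on c (c + l) u v (\<lambda>t. - (sin (\<omega> * (t - c)) * f (u t)))"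
    and s: "s \<in> {c..c+l}" "\<epsilon> \<le> u s" and \<epsilon>: "\<epsilon> > 0"
  shows "u (c + l) \<le> \<epsilon> / 2 \<Longrightarrow> v (c + l) \<le> - (\<epsilon> / (2 * l))" "u c \<le> \<epsilon> / 2 \<Longrightarrow> \<epsilon> / (2 * l) \<le> v c"
proof -
  have neg: "- (sin (\<omega> * (t - c)) * f (u t)) \<le> 0" if "t \<in> {c..c+l}" for t
    using f_nonneg sin_nonneg that by simp
  have tay: "u s \<le> u x + v x * (s - x)" if "x \<in> {c..c+l}" for x
    using taylor_le[OF u that s(1) neg] by simp
  { assume "u (c + l) \<le> \<epsilon> / 2"
    then have *: "\<epsilon> / 2 \<le> - v (c + l) * (c + l - s)" using tay[of "c + l"] s l by (simp add: algebra_simps)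
    then have "0 < - v (c + l) * (c + l - s)" using \<epsilon> by linarith
    then have "0 < - v (c + l)" using s by (auto simp: zero_less_mult_iff mult_less_0_iff)
    then have "- v (c + l) * (c + l - s) \<le> - v (c + l) * l" using s by (intro mult_left_mono) auto
    with * have "\<epsilon> / 2 \<le> - v (c + l) * l" by linarith
    then show "v (c + l) \<le> - (\<epsilon> / (2 * l))" using l by (simp add: field_simps) }
  { assume "u c \<le> \<epsilon> / 2"
    then have *: "\<epsilon> / 2 \<le> v c * (s - c)" using tay[of c] s l by (simp add: algebra_simps)
    then have "0 < v c * (s - c)" using \<epsilon> by linarith
    then have "0 < v c" using s by (auto simp: zero_less_mult_iff mult_less_0_iff)
    then have "v c * (s - c) \<le> v c * l" using s by (intro mult_left_mono) auto
    with * have "\<epsilon> / 2 \<le> v c * l" by linarith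
    then show "\<epsilon> / (2 * l) \<le> v c" using l by (simp add: field_simps) }
qed

text \<open>\<open>u\<close> itself is the comparison function. If \<open>z c > \<eta>\<close>, the
  Wronskian at \<open>c\<close> is at least \<eta>D - B\<delta> \<ge> \<eta>D/2, and
  \<open>ratio_growth\<close> drives \<open>z e\<close> above 1 because \<open>u c\<close> is at
  most \<delta>. Large \<mu> acts only through the smallness of \<open>u c\<close>.\<close>

lemma boundary_layer:
  assumes u: "c2_on c e u v (\<lambda>t. q t * f (u t))" and z: "c2_on c e z z' (\<lambda>t. q t * m t * z t)" and "c < e"
    and q: "\<And>t. t \<in> {c..e} \<Longrightarrow> 0 \<le> q t" and m: "\<And>t. t \<in> {c..e} \<Longrightarrow> u t powr (p - 1) \<le> m t"
    and ur: "\<And>t. t \<in> {c..e} \<Longrightarrow> 0 < u t" "\<And>t. t \<in> {c..e} \<Longrightarrow> u t \<le> R"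
    and "u c \<le> \<delta>" "v c \<le> - D" "- B \<le> z' c" "z e \<le> 1" "0 < D" "0 \<le> B" "0 < \<eta>"
    and \<delta>: "B * \<delta> \<le> \<eta> * D / 2" "\<delta> < \<eta> * D / 2 * (e - c)"
  shows "z c \<le> \<eta>"
proof (rule ccontr)
  assume "\<not> z c \<le> \<eta>"
  then have zc: "z c > \<eta>" by simp
  have uc: "u c > 0" using ur(1)[of c] \<open>c < e\<close> by simp
  have "\<eta> * D / 2 * (e - c) / u c \<le> z e"
  proof (rule ratio_growth[OF u z \<open>c < e\<close> ur(1)])
    fix t assume t: "t \<in> {c..e}"
    show "0 \<le> q t * f (u t)" using q[OF t] f_nonneg by simp
    assume zt: "0 < z t"
    have "f (u t) = u t powr (p - 1) * u t" using ur[OF t] by (simp add: f_eq min_def)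
    also have "\<dots> \<le> m t * u t" using m[OF t] ur(1)[OF t] by (intro mult_right_mono) auto
    finally have "q t * z t * f (u t) \<le> q t * z t * (m t * u t)" using q[OF t] zt by (intro mult_left_mono) auto
    then show "z t * (q t * f (u t)) \<le> q t * m t * z t * u t" by (simp add: mult_ac)
  next
    have 1: "\<eta> * D \<le> z c * - v c" using zc assms by (intro mult_mono) auto
    have "- B * u c \<le> z' c * u c" by (rule mult_right_mono[OF assms(10) less_imp_le[OF uc]])
    moreover have "B * u c \<le> B * \<delta>" using assms by (intro mult_left_mono) auto
    ultimately show "\<eta> * D / 2 \<le> z' c * u c - z c * v c" using 1 \<delta>(1) by simp
  qed (use assms zc in auto)
  then have "\<eta> * D / 2 * (e - c) / u c \<le> 1" using \<open>z e \<le> 1\<close> by simp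
  then have "\<eta> * D / 2 * (e - c) \<le> u c" using uc by (simp add: field_simps)
  then show False using \<delta>(2) \<open>u c \<le> \<delta>\<close> by simp
qed

end

section \<open>Uniqueness and non-degeneracy for large negative part\<close>

lemma sin_add_npi: "sin (x + real n * pi) = (-1) ^ n * sin x"
proof (induction n)
  case (Suc n)
  have "sin (x + real (Suc n) * pi) = sin (x + real n * pi + pi)" by (simp add: algebra_simps)
  then show ?case by (simp add: Suc)
qed simp

text \<open>The third condition on \<epsilon> is the one of \<open>threshold_end\<close>; the fourth
  is made for \<open>half_decay\<close>, with \<open>real k * l\<close> the length of the whole
  interval.\<close>

locale indefinite = cos_problem +
  fixes a \<epsilon> :: real and k :: nat
  assumes k: "k \<ge> 2" and MR: "M0 < R"
    and \<epsilon>: "0 < \<epsilon>" "\<epsilon> \<le> M0" "\<epsilon> powr (p - 1) * l\<^sup>2 \<le> 1 / 2" "g \<epsilon> * (real k * l)\<^sup>2 < 1"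
begin

definition node :: "nat \<Rightarrow> real" where "node i = a + real i * l"

definition b :: real where "b = node k"

definition wt :: "real \<Rightarrow> real \<Rightarrow> real" where
  "wt \<mu> t = weight (\<lambda>t. sin (\<omega> * (t - a))) \<mu> t"

abbreviation seg :: "nat \<Rightarrow> real set" where "seg i \<equiv> {node i..node i + l}"

definition sol :: "real \<Rightarrow> (real \<Rightarrow> real) \<Rightarrow> (real \<Rightarrow> real) \<Rightarrow> bool" where
  "sol \<mu> u v \<longleftrightarrow> c2_on a b u v (\<lambda>t. - (wt \<mu> t * f (u t)))"

definition good :: "real \<Rightarrow> (real \<Rightarrow> real) \<Rightarrow> (real \<Rightarrow> real) \<Rightarrow> bool" where
  "good \<mu> u v \<longleftrightarrow> sol \<mu> u v \<and> u a = 0 \<and> u b = 0 \<and> (\<forall>t\<in>{a<..<b}. u t > 0)"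

text \<open>\<open>seg i\<close> is a positive hump of the weight for even \<open>i\<close> and a negative one for odd \<open>i\<close>.\<close>

definition big :: "(real \<Rightarrow> real) \<Rightarrow> nat set" where
  "big u = {i. even i \<and> i < k \<and> (\<exists>t\<in>seg i. \<epsilon> < u t)}"

text \<open>The property that \<open>blow_up\<close> supplies; the target height
  \<open>M0 + 1\<close> is out of reach of positive solutions.\<close>

definition blows :: "real \<Rightarrow> real \<Rightarrow> real \<Rightarrow> bool" where
  "blows \<delta> D \<mu> \<longleftrightarrow> (\<forall>c u v. c2_on c (c + l) u v (\<lambda>t. \<mu> * sin (\<omega> * (t - c)) * f (u t)) \<longrightarrow>
    \<delta> \<le> u c \<longrightarrow> - D \<le> v c \<longrightarrow> (\<forall>t\<in>{c..c+l}. 0 < u t) \<and> M0 + 1 \<le> u (c + l))"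

lemma blowsD:
  assumes "blows \<delta> D \<mu>" "c2_on c (c + l) u v (\<lambda>t. \<mu> * sin (\<omega> * (t - c)) * f (u t))" "\<delta> \<le> u c" "- D \<le> v c"
  shows "t \<in> {c..c+l} \<Longrightarrow> 0 < u t" "M0 + 1 \<le> u (c + l)"
  using assms unfolding blows_def by blast+

text \<open>What \<open>slope_bound\<close> gives on a positive hump from u \<le> M0 and |f u| \<le>
  K M0.\<close>

definition Dv :: real where "Dv = 2 * M0 / l + K * M0 * l"

lemma node_simps: "node 0 = a" "node (Suc i) = node i + l"
  by (simp_all add: node_def algebra_simps)

lemma node_mono: "i \<le> j \<Longrightarrow> node i \<le> node j"
  using l by (simp add: node_def mult_right_mono)

lemma node_less: "i < j \<Longrightarrow> node i < node j"
  using l by (simp add: node_def)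

lemma node_ge_a: "a \<le> node i"
  using l by (simp add: node_def)

lemma node_le_b: "i \<le> k \<Longrightarrow> node i \<le> b"
  unfolding b_def by (rule node_mono)

lemma a_less_b: "a < b"
  using node_less[of 0 k] k by (simp add: b_def node_simps)

lemma seg_le_b: "i < k \<Longrightarrow> node i + l \<le> b"
  using node_le_b[of "Suc i"] by (simp add: node_simps)

lemma seg_subset: "i < k \<Longrightarrow> t \<in> seg i \<Longrightarrow> t \<in> {a..b}"
  using seg_le_b[of i] node_ge_a[of i] by auto

lemma b_eq: "b = a + real k * l"
  by (simp add: b_def node_def)

lemma segs_cover:
  assumes "t \<in> {a..b}"
  shows "\<exists>i<k. t \<in> seg i"
proof -
  have "\<exists>i<n. t \<in> seg i" if "0 < n" "t \<le> node n" for n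
    using that
  proof (induction n)
    case (Suc n)
    show ?case
    proof (cases "t \<le> node n \<and> 0 < n")
      case True
      then show ?thesis using Suc.IH by (meson less_SucI)
    next
      case False
      then have "node n \<le> t" using assms by (cases n) (auto simp: node_simps)
      then show ?thesis using Suc.prems by (intro exI[of _ n]) (auto simp: node_simps)
    qed
  qed simp
  then show ?thesis using assms k by (auto simp: b_def)
qed

lemma sin_seg: "sin (\<omega> * (t - a)) = (-1) ^ i * sin (\<omega> * (t - node i))"
proof -
  have "\<omega> * (t - a) = \<omega> * (t - node i) + real i * (\<omega> * l)" by (simp add: node_def algebra_simps)
  then show ?thesis using sin_add_npi[of "\<omega> * (t - node i)" i] l(3) by simp
qed

lemma wt_even: "even i \<Longrightarrow> t \<in> seg i \<Longrightarrow> wt \<mu> t = sin (\<omega> * (t - node i))"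
  using sin_seg[of t i] sin_nonneg[of "node i" t] by (simp add: wt_def weight_def pos_part_def neg_part_def)

lemma wt_odd: "odd i \<Longrightarrow> t \<in> seg i \<Longrightarrow> wt \<mu> t = - \<mu> * sin (\<omega> * (t - node i))"
  using sin_seg[of t i] sin_nonneg[of "node i" t] by (simp add: wt_def weight_def pos_part_def neg_part_def)

lemma wt_bound: "\<bar>wt \<mu> t\<bar> \<le> 1 + \<bar>\<mu>\<bar>"
proof -
  have *: "\<bar>(\<bar>s\<bar> + s) / 2\<bar> \<le> 1 \<and> \<bar>(\<bar>s\<bar> - s) / 2\<bar> \<le> 1" if "\<bar>s\<bar> \<le> 1" for s :: real
    using that by (auto simp: abs_if split: if_splits)
  have "\<bar>pos_part (\<lambda>t. sin (\<omega> * (t - a))) t\<bar> \<le> 1" "\<bar>neg_part (\<lambda>t. sin (\<omega> * (t - a))) t\<bar> \<le> 1"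
    using *[OF abs_sin_le_one] unfolding pos_part_def neg_part_def by auto
  then have "\<bar>pos_part (\<lambda>t. sin (\<omega> * (t - a))) t\<bar> + \<bar>\<mu>\<bar> * \<bar>neg_part (\<lambda>t. sin (\<omega> * (t - a))) t\<bar> \<le> 1 + \<bar>\<mu>\<bar> * 1"
    by (intro add_mono mult_left_mono) auto
  moreover have "\<bar>wt \<mu> t\<bar> \<le> \<bar>pos_part (\<lambda>t. sin (\<omega> * (t - a))) t\<bar> + \<bar>\<mu>\<bar> * \<bar>neg_part (\<lambda>t. sin (\<omega> * (t - a))) t\<bar>"
    unfolding wt_def weight_def abs_mult[symmetric] by (rule abs_triangle_ineq4)
  ultimately show ?thesis by simp
qed

lemma wt_cont: "continuous_on S (wt \<mu>)"
  unfolding wt_def weight_def pos_part_def neg_part_def by (intro continuous_intros) auto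

lemma eq_even:
  assumes "c2_on a b u v (\<lambda>t. - (wt \<mu> t * F t))" "even i" "i < k"
  shows "c2_on (node i) (node i + l) u v (\<lambda>t. - (sin (\<omega> * (t - node i)) * F t))"
  by (rule c2_on_cong[OF c2_on_subset[OF assms(1)]])
    (use assms seg_le_b node_ge_a wt_even in auto)

lemma eq_odd:
  assumes "c2_on a b u v (\<lambda>t. - (wt \<mu> t * F t))" "odd i" "i < k"
  shows "c2_on (node i) (node i + l) u v (\<lambda>t. \<mu> * sin (\<omega> * (t - node i)) * F t)"
  by (rule c2_on_cong[OF c2_on_subset[OF assms(1)]])
    (use assms seg_le_b node_ge_a wt_odd in auto)

section \<open>Bounds for positive solutions on the whole interval\<close>

text \<open>On a negative hump the solution is convex, hence bounded by its end values; each end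
  belongs to a positive hump or is \<open>b\<close>.\<close>

lemma positive_solution_bound:
  assumes u: "c2_on a b u v (\<lambda>t. - (wt \<mu> t * F (u t)))" and "0 \<le> \<mu>"
    and nn: "\<And>t. t \<in> {a..b} \<Longrightarrow> 0 \<le> u t" and F: "\<And>x. 0 \<le> x \<Longrightarrow> x * min x R powr (p - 1) \<le> F x"
    and "u b = 0" and t: "t \<in> {a..b}"
  shows "u t \<le> M0"
proof -
  have ev: "u t \<le> M0" if "even i" "i < k" "t \<in> seg i" for i t
    by (rule apriori_bound[OF eq_even[OF u that(1,2)] _ F MR that(3)])
      (use nn seg_subset[OF that(2)] in auto)
  have nd: "u (node i) \<le> M0" if "i \<le> k" for i
  proof -
    have "i = k \<or> i < k \<and> even i \<or> odd i" using that by (auto simp: le_less)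
    then consider "i = k" | "i < k" "even i" | "odd i" by blast
    then show ?thesis
    proof cases
      case 1 then show ?thesis using assms M0_pos by (simp add: b_def)
    next
      case 2 then show ?thesis using ev[of i "node i"] l by simp
    next
      case 3
      then obtain j where "i = Suc j" "even j" by (cases i) auto
      then show ?thesis using ev[of j "node i"] l that by (simp add: node_simps)
    qed
  qed
  obtain i where i: "i < k" "t \<in> seg i" using segs_cover[OF t] by blast
  show ?thesis
  proof (cases "even i")
    case False
    have acc: "0 \<le> \<mu> * sin (\<omega> * (s - node i)) * F (u s)" if s: "s \<in> seg i" for s
    proof -
      have us: "0 \<le> u s" using nn seg_subset[OF i(1) s] by simp
      then have "0 \<le> u s * min (u s) R powr (p - 1)" by simp
      then have "0 \<le> F (u s)" using F[OF us] by simp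
      then show ?thesis using sin_nonneg s \<open>0 \<le> \<mu>\<close> by simp
    qed
    have "(node i + l - node i) * u t \<le> (node i + l - t) * u (node i) + (t - node i) * u (node i + l)"
      by (rule convex_chord[OF eq_odd[OF u False i(1)] acc i(2)])
    also have "\<dots> \<le> (node i + l - t) * M0 + (t - node i) * M0"
      using nd[of i] nd[of "Suc i"] i by (intro add_mono mult_left_mono) (auto simp: node_simps)
    also have "\<dots> = (node i + l - node i) * M0" by (simp add: algebra_simps)
    finally show ?thesis using l by simp
  qed (use ev i in blast)
qed

lemma f_ge: "0 \<le> x \<Longrightarrow> x * min x R powr (p - 1) \<le> f x"
  by (simp add: f_eq)

lemma good_eq: "good \<mu> u v \<Longrightarrow> c2_on a b u v (\<lambda>t. - (wt \<mu> t * f (u t)))"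
  by (simp add: good_def sol_def)

lemma good_nonneg: "good \<mu> u v \<Longrightarrow> t \<in> {a..b} \<Longrightarrow> 0 \<le> u t"
  by (cases "t = a \<or> t = b") (auto simp: good_def less_imp_le)

lemma good_le: "good \<mu> u v \<Longrightarrow> 0 \<le> \<mu> \<Longrightarrow> t \<in> {a..b} \<Longrightarrow> u t \<le> M0"
  using positive_solution_bound[of u v \<mu> f t] good_nonneg f_ge by (auto simp: good_def sol_def)

lemma slope_even:
  assumes u: "c2_on (node i) (node i + l) u v (\<lambda>t. - (sin (\<omega> * (t - node i)) * f (u t)))"
    and nn: "\<And>t. t \<in> seg i \<Longrightarrow> 0 \<le> u t" and x: "x \<in> seg i"
  shows "\<bar>v x\<bar> \<le> Dv"
proof -
  have "\<bar>v x\<bar> \<le> 2 * M0 / (node i + l - node i) + K * M0 * (node i + l - node i)"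
  proof (rule slope_bound[OF u _ _ _ x])
    fix t assume t: "t \<in> seg i"
    have uM: "u t \<le> M0" by (rule apriori_bound[OF u nn f_ge MR t])
    then show "\<bar>u t\<bar> \<le> M0" using nn[OF t] by simp
    have "\<bar>sin (\<omega> * (t - node i)) * f (u t)\<bar> \<le> 1 * (K * \<bar>u t\<bar>)"
      unfolding abs_mult using f_bound[of "u t"] by (intro mult_mono) auto
    also have "\<dots> \<le> K * M0" using uM nn[OF t] K_pos by simp
    finally show "\<bar>- (sin (\<omega> * (t - node i)) * f (u t))\<bar> \<le> K * M0" by simp
  qed (use l in auto)
  then show ?thesis by (simp add: Dv_def)
qed

lemma good_slope:
  assumes "good \<mu> u v" "even i" "i < k" "x \<in> seg i"
  shows "\<bar>v x\<bar> \<le> Dv"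
  by (rule slope_even[OF eq_even[OF _ assms(2,3)] _ assms(4)])
    (use assms good_nonneg seg_subset in \<open>auto simp: good_def sol_def\<close>)

lemma node_small:
  assumes u: "good \<mu> u v" and \<mu>: "0 \<le> \<mu>" "blows \<delta> Dv \<mu>" and "0 < \<delta>" and i: "i \<le> k"
  shows "u (node i) \<le> \<delta>"
proof (rule ccontr)
  assume "\<not> u (node i) \<le> \<delta>"
  then have n: "\<delta> \<le> u (node i)" "\<delta> < u (node i)" by auto
  note uc = good_eq[OF u]
  have "u (node 0) = 0" "u (node k) = 0" using u by (auto simp: good_def b_def node_simps)
  then have "i \<noteq> 0" "i \<noteq> k" using n \<open>0 < \<delta>\<close> by (metis less_asym)+
  then obtain j where j: "i = Suc j" "i < k" using i by (cases i) auto
  have nn: "node i + l \<in> {a..b}" "node j \<in> {a..b}"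
    using seg_le_b[OF j(2)] seg_le_b[of j] j l node_ge_a[of j] node_ge_a[of i] by auto
  show False
  proof (cases "odd i")
    case True
    have "- Dv \<le> v (node i)"
      using good_slope[OF u, of j "node i"] True j l by (auto simp: node_simps abs_le_iff)
    then have "M0 + 1 \<le> u (node i + l)"
      using blowsD(2)[OF \<mu>(2) eq_odd[OF uc True j(2)]] n(1) by simp
    then show False using good_le[OF u \<mu>(1) nn(1)] by simp
  next
    case False
    have od: "odd j" and jk: "j < k" using False j by simp_all
    have "- Dv \<le> - v (node i)"
      using good_slope[OF u, of i "node i"] False j l by (auto simp: abs_le_iff)
    moreover have "node i = 2 * node j + l - node j" by (simp add: j node_simps)
    ultimately have "M0 + 1 \<le> u (2 * node j + l - (node j + l))"
      using blowsD(2)[OF \<mu>(2) blow_up_reflect[OF eq_odd[OF uc od jk]]] n(1) by simp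
    then show False using good_le[OF u \<mu>(1) nn(2)] by simp
  qed
qed

section \<open>The linear equation between two solutions with the same large humps\<close>

text \<open>\<open>boundary_layer\<close> is run from the end \<open>x\<close> of a large hump into
  the adjacent negative hump, in the direction \<sigma> that leads away from the large one. There
  \<open>u1\<close> is small by \<open>node_small\<close> and steep by
  \<open>end_slope\<close>.\<close>

lemma layer_end:
  assumes u1: "good \<mu> u1 v1" and u2: "good \<mu> u2 v2" and \<mu>: "0 \<le> \<mu>" "blows \<delta> Dv \<mu>"
    and z: "c2_on a b z z' (\<lambda>t. - (wt \<mu> t * (dq (u1 t) (u2 t) * z t)))" and z1: "\<And>t. t \<in> {a..b} \<Longrightarrow> z t \<le> 1"
    and i: "i \<in> big u1" and x: "x = node i \<and> 0 < i \<or> x = node i + l \<and> Suc i < k" and B: "\<bar>z' x\<bar> \<le> B"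
    and \<delta>: "0 < \<delta>" "\<delta> \<le> \<epsilon> / 2" "B * \<delta> \<le> \<eta> * (\<epsilon> / (2 * l)) / 2" "\<delta> < \<eta> * (\<epsilon> / (2 * l)) / 2 * (l / 2)" and "0 < \<eta>"
  shows "z x \<le> \<eta>"
proof -
  have ev: "even i" "i < k" using i by (auto simp: big_def)
  note uc = good_eq[OF u1]
  obtain s where s: "s \<in> seg i" "\<epsilon> \<le> u1 s" using i by (auto simp: big_def intro: less_imp_le)
  have "u1 (node i) \<le> \<delta>" "u1 (node (Suc i)) \<le> \<delta>" using node_small[OF u1 \<mu> \<delta>(1)] ev(2) by auto
  then have small: "u1 (node i) \<le> \<delta>" "u1 (node i + l) \<le> \<delta>" by (simp_all add: node_simps)
  have sl: "v1 (node i + l) \<le> - (\<epsilon> / (2 * l))" "\<epsilon> / (2 * l) \<le> v1 (node i)"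
    using end_slope[OF eq_even[OF uc ev] s \<epsilon>(1)] small \<delta>(2) by auto
  have "\<exists>j \<sigma>. odd j \<and> j < k \<and> x < b \<and> u1 x \<le> \<delta> \<and> \<sigma> * v1 x \<le> - (\<epsilon> / (2 * l)) \<and>
      (x = node j \<and> \<sigma> = 1 \<or> x = node j + l \<and> \<sigma> = - 1)"
    using x
  proof (elim disjE conjE)
    assume "x = node i" "0 < i"
    moreover then obtain j where "i = Suc j" by (cases i) auto
    ultimately show ?thesis using ev small sl l(1) seg_le_b[OF ev(2)]
      by (intro exI[of _ j] exI[of _ "- 1"]) (auto simp: node_simps)
  next
    assume "x = node i + l" "Suc i < k"
    then show ?thesis using ev small sl l(1) seg_le_b[of "Suc i"]
      by (intro exI[of _ "Suc i"] exI[of _ 1]) (auto simp: node_simps)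
  qed
  then obtain j \<sigma> where j: "odd j" "j < k" and xb: "x < b" "u1 x \<le> \<delta>" "\<sigma> * v1 x \<le> - (\<epsilon> / (2 * l))"
    and \<sigma>: "x = node j \<and> \<sigma> = 1 \<or> x = node j + l \<and> \<sigma> = - 1" by blast
  have aj: "a < node j" using node_less[of 0 j] j(1) by (cases j) (auto simp: node_simps)
  \<comment> \<open>Only half of the negative hump is traversed, since its far end may be
    \<open>b\<close>, where \<open>u1\<close> vanishes.\<close>
  have sub: "\<sigma> * t + x \<in> seg j" "\<sigma> * t + x \<in> {a<..<b}" if "t \<in> {0..l / 2}" for t
    using that \<sigma> l(1) aj seg_le_b[OF j(2)] xb(1) by auto
  have sin: "sin (\<omega> * (\<sigma> * t + x - node j)) = sin (\<omega> * t)" for t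
    using \<sigma> sin_reflect[of 0 t] by auto
  have aff: "c2_on 0 (l / 2) (\<lambda>t. y (\<sigma> * t + x)) (\<lambda>t. \<sigma> * y' (\<sigma> * t + x)) (\<lambda>t. \<mu> * sin (\<omega> * t) * F (\<sigma> * t + x))"
    if "c2_on a b y y' (\<lambda>t. - (wt \<mu> t * F t))" for y y' F
    by (rule c2_on_cong[OF c2_on_affine[OF eq_odd[OF that j]]]) (use sub \<sigma> sin in auto)
  have "z (\<sigma> * 0 + x) \<le> \<eta>"
  proof (rule boundary_layer[OF aff[OF uc], where m = "\<lambda>t. dq (u1 (\<sigma> * t + x)) (u2 (\<sigma> * t + x))" and D = "\<epsilon> / (2 * l)" and B = B])
    show "c2_on 0 (l / 2) (\<lambda>t. z (\<sigma> * t + x)) (\<lambda>t. \<sigma> * z' (\<sigma> * t + x))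
      (\<lambda>t. \<mu> * sin (\<omega> * t) * dq (u1 (\<sigma> * t + x)) (u2 (\<sigma> * t + x)) * z (\<sigma> * t + x))"
      using aff[OF z] by (simp add: mult.assoc)
    fix t assume t: "t \<in> {0..l / 2}"
    then have ab: "\<sigma> * t + x \<in> {a..b}" using sub(2) by force
    show "0 \<le> \<mu> * sin (\<omega> * t)" using \<mu>(1) sin_nonneg[of 0 t] t l(1) by simp
    show "0 < u1 (\<sigma> * t + x)" using u1 sub(2)[OF t] by (simp add: good_def)
    show "u1 (\<sigma> * t + x) \<le> R" using good_le[OF u1 \<mu>(1) ab] MR by simp
    show "u1 (\<sigma> * t + x) powr (p - 1) \<le> dq (u1 (\<sigma> * t + x)) (u2 (\<sigma> * t + x))"
      using good_le[OF u1 \<mu>(1) ab] good_le[OF u2 \<mu>(1) ab] MR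
        good_nonneg[OF u1 ab] good_nonneg[OF u2 ab] by (intro dq_ge) auto
  next
    show "z (\<sigma> * (l / 2) + x) \<le> 1" using sub(2)[of "l / 2"] l(1) by (intro z1) auto
    show "- B \<le> \<sigma> * z' (\<sigma> * 0 + x)" using B \<sigma> by auto
  qed (use xb \<delta> B \<epsilon>(1) l(1) \<open>0 < \<eta>\<close> in auto)
  then show ?thesis by simp
qed

lemma sin_centre: "sin (\<omega> * (t + (node i + H) - node i)) = cos (\<omega> * t)"
proof -
  have "\<omega> * (t + (node i + H) - node i) = \<omega> * t + pi / 2" using l(2,3) by (simp add: algebra_simps)
  then show ?thesis by (simp add: sin_add)
qed

lemma bump_shift:
  assumes u: "good \<mu> u v" and \<mu>: "0 \<le> \<mu>" "blows \<delta> Dv \<mu>" "0 < \<delta>" "\<delta> \<le> \<delta>'" and i: "i \<in> big u"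
  shows "bump M0 \<epsilon> \<delta>' (\<lambda>t. u (t + (node i + H))) (\<lambda>t. v (t + (node i + H)))"
proof -
  have ev: "even i" "i < k" using i by (auto simp: big_def)
  note uc = good_eq[OF u]
  have sub: "t + (node i + H) \<in> {a..b}" if "t \<in> {-H..H}" for t
    using seg_subset[OF ev(2), of "t + (node i + H)"] that l(2) by auto
  have "c2_on (-H) H (\<lambda>t. u (t + (node i + H))) (\<lambda>t. v (t + (node i + H)))
     (\<lambda>t. - (sin (\<omega> * (t + (node i + H) - node i)) * f (u (t + (node i + H)))))"
    using c2_on_shift[OF eq_even[OF uc ev], of "node i + H"] l(2) by simp
  then have 1: "c2_on (-H) H (\<lambda>t. u (t + (node i + H))) (\<lambda>t. v (t + (node i + H)))
     (\<lambda>t. - (cos (\<omega> * t) * f (u (t + (node i + H)))))" by (simp only: sin_centre)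
  have "u (node i) \<le> \<delta>'" "u (node (Suc i)) \<le> \<delta>'"
    using node_small[OF u \<mu>(1,2,3), of i] node_small[OF u \<mu>(1,2,3), of "Suc i"] ev \<mu>(4) by auto
  then have 2: "u (-H + (node i + H)) \<le> \<delta>'" "u (H + (node i + H)) \<le> \<delta>'"
    using l(2) by (auto simp: node_simps add.commute)
  obtain s where s: "s \<in> seg i" "\<epsilon> < u s" using i by (auto simp: big_def)
  have 3: "\<exists>t\<in>{-H..H}. \<epsilon> \<le> u (t + (node i + H))"
    using s l(2) by (intro bexI[of _ "s - (node i + H)"]) auto
  show ?thesis unfolding bump_def using 1 2 3 good_nonneg[OF u sub] good_le[OF u \<mu>(1) sub] by blast
qed

lemma bump_shift_linear:
  assumes z: "c2_on a b z z' (\<lambda>t. - (wt \<mu> t * (dq (u1 t) (u2 t) * z t)))" and i: "even i" "i < k"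
  shows "c2_on (-H) H (\<lambda>t. z (t + (node i + H))) (\<lambda>t. z' (t + (node i + H)))
     (\<lambda>t. - (cos (\<omega> * t) * dq (u1 (t + (node i + H))) (u2 (t + (node i + H))) * z (t + (node i + H))))"
proof -
  have "c2_on (-H) H (\<lambda>t. z (t + (node i + H))) (\<lambda>t. z' (t + (node i + H)))
     (\<lambda>t. - (sin (\<omega> * (t + (node i + H) - node i)) * (dq (u1 (t + (node i + H))) (u2 (t + (node i + H))) * z (t + (node i + H)))))"
    using c2_on_shift[OF eq_even[OF z i], of "node i + H"] l(2) by simp
  then show ?thesis by (simp only: sin_centre mult.assoc)
qed

lemma not_big: "i \<notin> big u \<Longrightarrow> even i \<Longrightarrow> i < k \<Longrightarrow> t \<in> seg i \<Longrightarrow> u t \<le> \<epsilon>"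
  by (auto simp: big_def not_less)

lemma deriv_zero_at_max:
  assumes u: "c2_on a b u v A" and s: "s \<in> {a<..<b}" and "\<And>t. t \<in> {a..b} \<Longrightarrow> u t \<le> u s"
  shows "v s = 0"
proof (rule DERIV_local_max)
  have "(u has_real_derivative v s) (at s within {a..b})" using c2_onD(1)[OF u] s by auto
  moreover have "at s within {a..b} = at s" using s by (intro at_within_interior) auto
  ultimately show "(u has_real_derivative v s) (at s)" by simp
  show "0 < min (s - a) (b - s)" using s by simp
  show "\<forall>y. \<bar>s - y\<bar> < min (s - a) (b - s) \<longrightarrow> u y \<le> u s"
  proof (intro allI impI)
    fix y assume "\<bar>s - y\<bar> < min (s - a) (b - s)"
    then have "y \<in> {a..b}" by (auto simp: abs_less_iff)
    then show "u y \<le> u s" by (rule assms(3))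
  qed
qed

text \<open>The second-order Taylor loss is at most g(\<epsilon>) (k l)^2 / 2, which the fourth
  condition on \<epsilon> keeps below 1/2.\<close>

lemma half_decay:
  assumes y: "c2_on s e y y' A" and "s \<le> e" "y s = 1" "y' s = 0" "e - s \<le> real k * l"
    and A: "\<And>t. t \<in> {s..e} \<Longrightarrow> - g \<epsilon> \<le> A t"
  shows "1 / 2 < y e"
proof -
  have "y s + y' s * (e - s) + (- g \<epsilon>) * (e - s)\<^sup>2 / 2 \<le> y e"
    by (rule taylor_ge[OF y _ _ A]) (use assms in auto)
  moreover have "g \<epsilon> * (e - s)\<^sup>2 \<le> g \<epsilon> * (real k * l)\<^sup>2"
    using assms g_nonneg by (intro mult_left_mono power_mono) auto
  ultimately show ?thesis using \<epsilon>(4) assms by simp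
qed

text \<open>Taking \<open>u1 = u2\<close> yields non-degeneracy, and taking
  \<open>w = u1 - u2\<close> yields injectivity of \<open>big\<close>.\<close>

lemma linear_trivial:
  shows "\<exists>\<mu>0>0. \<forall>\<mu>\<ge>\<mu>0. \<forall>u1 v1 u2 v2 w w'. good \<mu> u1 v1 \<longrightarrow> good \<mu> u2 v2 \<longrightarrow> big u1 = big u2 \<longrightarrow>
    c2_on a b w w' (\<lambda>t. - (wt \<mu> t * (dq (u1 t) (u2 t) * w t))) \<longrightarrow> w a = 0 \<longrightarrow> w b = 0 \<longrightarrow>
    (\<forall>t\<in>{a..b}. w t = 0)"
proof -
  obtain \<delta>S where \<delta>S: "\<delta>S > 0" "\<And>u1 v1 u2 v2 w w'. bump M0 \<epsilon> \<delta>S u1 v1 \<Longrightarrow> bump M0 \<epsilon> \<delta>S u2 v2 \<Longrightarrow>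
    c2_on (-H) H w w' (\<lambda>t. - (cos (\<omega> * t) * dq (u1 t) (u2 t) * w t)) \<Longrightarrow> (\<forall>t\<in>{-H..H}. \<bar>w t\<bar> \<le> 1) \<Longrightarrow>
    \<bar>w (-H)\<bar> \<le> \<delta>S \<Longrightarrow> \<bar>w H\<bar> \<le> \<delta>S \<Longrightarrow> (\<forall>t\<in>{-H..H}. \<bar>w t\<bar> < 1)"
    using bump_estimate[OF MR \<epsilon>(1)] by blast
  \<comment> \<open>At most \<delta>S, so that the compactness estimate applies to \<open>y\<close>;
    at most 1/4, to be clearly below the level 1/2 of \<open>half_decay\<close>.\<close>
  define \<eta> where "\<eta> = min \<delta>S (1 / 4)"
  define B where "B = 2 * 1 / l + K * l"
  define E where "E = \<eta> * (\<epsilon> / (2 * l)) / 2"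
  define \<delta> where "\<delta> = min (min (\<epsilon> / 2) \<delta>S) (min (E / B) (E * l / 4))"
  have \<eta>: "0 < \<eta>" "\<eta> \<le> \<delta>S" "\<eta> \<le> 1 / 4" using \<delta>S by (auto simp: \<eta>_def)
  have B: "0 < B" using l K_pos by (auto simp: B_def intro!: add_pos_pos)
  have E: "0 < E" using \<eta> \<epsilon> l by (simp add: E_def)
  have \<delta>: "0 < \<delta>" "\<delta> \<le> \<epsilon> / 2" "\<delta> \<le> \<delta>S" "\<delta> \<le> E / B" "\<delta> \<le> E * l / 4"
    using \<delta>S(1) \<epsilon>(1) E B l(1) unfolding \<delta>_def by (simp, linarith+)
  have \<delta>': "B * \<delta> \<le> \<eta> * (\<epsilon> / (2 * l)) / 2" "\<delta> < \<eta> * (\<epsilon> / (2 * l)) / 2 * (l / 2)"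
  proof -
    have "B * \<delta> \<le> E" using \<delta>(4) B by (simp add: field_simps)
    then show "B * \<delta> \<le> \<eta> * (\<epsilon> / (2 * l)) / 2" by (simp add: E_def)
    have "E * l / 4 < E * (l / 2)" using E l by simp
    then show "\<delta> < \<eta> * (\<epsilon> / (2 * l)) / 2 * (l / 2)" using \<delta>(5) unfolding E_def by linarith
  qed
  obtain \<mu>0 where \<mu>0: "\<mu>0 > 0" "\<And>\<mu>. \<mu>0 \<le> \<mu> \<Longrightarrow> blows \<delta> Dv \<mu>"
    using blow_up[OF \<delta>(1), of Dv "M0 + 1"] unfolding blows_def by blast
  show ?thesis
  proof (intro exI[of _ \<mu>0] conjI allI impI ballI)
    fix \<mu> u1 v1 u2 v2 w w' t0
    assume "\<mu>0 \<le> \<mu>" and u1: "good \<mu> u1 v1" and u2: "good \<mu> u2 v2" and bg: "big u1 = big u2"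
      and w: "c2_on a b w w' (\<lambda>t. - (wt \<mu> t * (dq (u1 t) (u2 t) * w t)))" and w0: "w a = 0" "w b = 0"
      and t0: "t0 \<in> {a..b}"
    have \<mu>: "0 \<le> \<mu>" "blows \<delta> Dv \<mu>" using \<mu>0 \<open>\<mu>0 \<le> \<mu>\<close> by auto
    show "w t0 = 0"
    proof (rule ccontr)
      assume wt0: "w t0 \<noteq> 0"
      have "continuous_on {a..b} (\<lambda>t. \<bar>w t\<bar>)" using c2_on_cont(1)[OF w] by (intro continuous_intros)
      then obtain s where s: "s \<in> {a..b}" "\<And>t. t \<in> {a..b} \<Longrightarrow> \<bar>w t\<bar> \<le> \<bar>w s\<bar>"
        using continuous_attains_sup[of "{a..b}" "\<lambda>t. \<bar>w t\<bar>"] a_less_b by auto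
      have ws: "w s \<noteq> 0" using s(2)[OF t0] wt0 by auto
      define y where "y = (\<lambda>t. (1 / w s) * w t)"
      define y' where "y' = (\<lambda>t. (1 / w s) * w' t)"
      have y: "c2_on a b y y' (\<lambda>t. - (wt \<mu> t * (dq (u1 t) (u2 t) * y t)))"
        unfolding y_def y'_def by (rule c2_on_cong[OF c2_on_scale[OF w]]) (simp add: mult_ac)
      have y1: "\<bar>y t\<bar> \<le> 1" if "t \<in> {a..b}" for t using s(2)[OF that] ws by (simp add: y_def)
      have ys: "y s = 1" "y a = 0" "y b = 0" using ws w0 by (auto simp: y_def)
      have s': "s \<in> {a<..<b}" using s(1) w0 ws by (cases "s = a \<or> s = b") auto
      have y's: "y' s = 0"
      proof (rule deriv_zero_at_max[OF y s'])
        fix t assume "t \<in> {a..b}"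
        then show "y t \<le> y s" using y1[of t] ys by simp
      qed
      have u12: "0 \<le> u1 t" "u1 t \<le> M0" "0 \<le> u2 t" "u2 t \<le> M0" if "t \<in> {a..b}" for t
        using good_nonneg[OF u1 that] good_nonneg[OF u2 that] good_le[OF u1 \<mu>(1) that] good_le[OF u2 \<mu>(1) that] by auto
      have dqK: "0 \<le> dq (u1 t) (u2 t)" "dq (u1 t) (u2 t) \<le> K" if "t \<in> {a..b}" for t
        using dq_nonneg dq_le_K[of "u1 t" "u2 t"] u12[OF that] MR by auto
      have slope: "\<bar>y' x\<bar> \<le> B" if i: "even i" "i < k" and x: "x \<in> seg i" for i x
      proof -
        have "\<bar>y' x\<bar> \<le> 2 * 1 / (node i + l - node i) + K * (node i + l - node i)"
        proof (rule slope_bound[OF eq_even[OF y i] _ _ _ x])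
          fix t assume t: "t \<in> seg i"
          then have tab: "t \<in> {a..b}" by (rule seg_subset[OF i(2)])
          show "\<bar>y t\<bar> \<le> 1" by (rule y1[OF tab])
          have "\<bar>sin (\<omega> * (t - node i)) * (dq (u1 t) (u2 t) * y t)\<bar> \<le> 1 * (K * 1)"
            unfolding abs_mult using dqK[OF tab] y1[OF tab] K_pos by (intro mult_mono) auto
          then show "\<bar>- (sin (\<omega> * (t - node i)) * (dq (u1 t) (u2 t) * y t))\<bar> \<le> K" by simp
        qed (use l in auto)
        then show ?thesis by (simp add: B_def)
      qed
      have ny: "c2_on a b (\<lambda>t. - y t) (\<lambda>t. - y' t) (\<lambda>t. - (wt \<mu> t * (dq (u1 t) (u2 t) * - y t)))"
        by (rule c2_on_cong[OF c2_on_minus[OF y]]) simp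
      have ends: "\<bar>y x\<bar> \<le> \<eta>" if i: "i \<in> big u1" and x: "x = node i \<or> x = node i + l" for i x
      proof -
        have ev: "even i" "i < k" using i by (auto simp: big_def)
        have sl: "\<bar>y' x\<bar> \<le> B" using l x by (intro slope[OF ev]) auto
        have ub: "y t \<le> 1" "- y t \<le> 1" if "t \<in> {a..b}" for t using y1[OF that] by auto
        have "x = a \<or> x = b \<or> x = node i \<and> 0 < i \<or> x = node i + l \<and> Suc i < k"
          \<comment> \<open>At the outer ends \<open>a\<close> and \<open>b\<close> the boundary
            values already vanish, so only inner ends call for a boundary layer.\<close>
          using x ev(2) node_simps(1) node_simps(2)[of i] unfolding b_def by (metis Suc_lessI gr_zeroI)
        then consider "x = a \<or> x = b" | (inner) "x = node i \<and> 0 < i \<or> x = node i + l \<and> Suc i < k" by blast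
        then show ?thesis
        proof cases
          case inner
          have "y x \<le> \<eta>"
            by (rule layer_end[OF u1 u2 \<mu> y ub(1) i inner sl \<delta>(1,2) \<delta>' \<eta>(1)])
          moreover have "- y x \<le> \<eta>"
            by (rule layer_end[OF u1 u2 \<mu> ny ub(2) i inner _ \<delta>(1,2) \<delta>' \<eta>(1)]) (use sl in auto)
          ultimately show ?thesis by simp
        qed (use ys \<eta> in auto)
      qed
      have inside: "s \<notin> seg i" if i: "i \<in> big u1" for i
      proof
        assume si: "s \<in> seg i"
        have ev: "even i" "i < k" using i by (auto simp: big_def)
        have "\<forall>t\<in>{-H..H}. \<bar>y (t + (node i + H))\<bar> < 1"
        proof (rule \<delta>S(2)[OF bump_shift[OF u1 \<mu> \<delta>(1,3) i] bump_shift[OF u2 \<mu> \<delta>(1,3) i[unfolded bg]] bump_shift_linear[OF y ev]])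
          show "\<forall>t\<in>{-H..H}. \<bar>y (t + (node i + H))\<bar> \<le> 1"
          proof
            fix t assume "t \<in> {-H..H}"
            then have "t + (node i + H) \<in> seg i" using l(2) by auto
            then show "\<bar>y (t + (node i + H))\<bar> \<le> 1" using y1 seg_subset[OF ev(2)] by blast
          qed
          show "\<bar>y (- H + (node i + H))\<bar> \<le> \<delta>S" using ends[OF i, of "node i"] \<eta> by simp
          have "H + (node i + H) = node i + l" using l(2) by simp
          then show "\<bar>y (H + (node i + H))\<bar> \<le> \<delta>S" using ends[OF i, of "node i + l"] \<eta>(2) by (simp only:) simp
        qed
        moreover have "s - (node i + H) \<in> {-H..H}" using si l(2) by auto
        ultimately have "\<bar>y (s - (node i + H) + (node i + H))\<bar> < 1" by blast
        then show False using ys by simp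
      qed
      \<comment> \<open>The first point to the right of the maximum where \<open>y\<close> has
        dropped to 1/2; it exists because \<open>y b = 0\<close>. Before it \<open>y\<close> cannot
        meet the left end of a large hump, where it is at most 1/4, so only small and negative humps
        occur and \<open>half_decay\<close> gives \<open>y z > 1/2\<close>.\<close>
      obtain z where z: "s < z" "z \<le> b" "y z - 1 / 2 = 0" "\<And>t. s \<le> t \<Longrightarrow> t < z \<Longrightarrow> y t - 1 / 2 > 0"
      proof (rule first_zero[of s b "\<lambda>t. y t - 1 / 2"])
        show "continuous_on {s..b} (\<lambda>t. y t - 1 / 2)"
          using s' by (intro continuous_intros continuous_on_subset[OF c2_on_cont(1)[OF y]]) auto
      qed (use s' ys in auto)
      have "1 / 2 < y z"
      proof (rule half_decay[OF c2_on_subset[OF y, of s z] _ ys(1) y's])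
        show "z - s \<le> real k * l" using z s' by (simp add: b_eq)
        fix t assume t: "t \<in> {s..z}"
        have tab: "t \<in> {a..b}" using t z s' by auto
        have yt: "0 \<le> y t" "y t \<le> 1" using z(4)[of t] z(3) t y1[OF tab] by (cases "t = z"; auto)+
        obtain i where i: "i < k" "t \<in> seg i" using segs_cover[OF tab] by blast
        show "- g \<epsilon> \<le> - (wt \<mu> t * (dq (u1 t) (u2 t) * y t))"
        proof (cases "even i")
          case False
          have "0 \<le> \<mu> * sin (\<omega> * (t - node i)) * (dq (u1 t) (u2 t) * y t)"
            using \<mu>(1) yt dq_nonneg sin_nonneg i(2) by simp
          then show ?thesis using wt_odd[OF False i(2), of \<mu>] g_nonneg[of \<epsilon>] by simp
        next
          case True
          have "i \<notin> big u1"
          proof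
            assume ib: "i \<in> big u1"
            have "s < node i" using inside[OF ib] i(2) t by auto
            moreover have "node i \<le> t" using i by simp
            ultimately have "1 / 2 \<le> y (node i)"
              using z(3) z(4)[of "node i"] t by (cases "node i = z") auto
            moreover have "y (node i) \<le> 1 / 4" using ends[OF ib, of "node i"] \<eta> by simp
            ultimately show False by simp
          qed
          then have small: "u1 t \<le> \<epsilon>" "u2 t \<le> \<epsilon>" using not_big True i bg by auto
          have "\<exists>x. min (u1 t) (u2 t) \<le> x \<and> x \<le> max (u1 t) (u2 t) \<and> dq (u1 t) (u2 t) = g x"
            using u12[OF tab] MR by (intro dq_mvt) auto
          then have "dq (u1 t) (u2 t) \<le> g \<epsilon>" using small by (metis g_mono max.bounded_iff order_trans)
          then have "sin (\<omega> * (t - node i)) * (dq (u1 t) (u2 t) * y t) \<le> 1 * (g \<epsilon> * 1)"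
            using yt dq_nonneg g_nonneg by (intro mult_mono) auto
          then show ?thesis using wt_even[OF True i(2), of \<mu>] by simp
        qed
      qed (use z s' in auto)
      then show False using z(3) by simp
    qed
  qed (use \<mu>0 in auto)
qed

text \<open>If no hump were large, \<open>u\<close> divided by its maximum would satisfy
  \<open>half_decay\<close> up to \<open>b\<close>, where it vanishes.\<close>

lemma big_nonempty:
  assumes u: "good \<mu> u v" and "0 \<le> \<mu>"
  shows "big u \<noteq> {}"
proof
  assume e: "big u = {}"
  note uc = good_eq[OF u]
  obtain s where s: "s \<in> {a..b}" "\<And>t. t \<in> {a..b} \<Longrightarrow> u t \<le> u s"
    using continuous_attains_sup[OF _ _ c2_on_cont(1)[OF uc]] a_less_b by auto
  have "u ((a + b) / 2) > 0" "(a + b) / 2 \<in> {a..b}" using u a_less_b by (auto simp: good_def)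
  then have us: "u s > 0" using s(2) by (meson order.strict_trans2)
  have s': "s \<in> {a<..<b}" using s(1) us u by (cases "s = a \<or> s = b") (auto simp: good_def)
  define y where "y = (\<lambda>t. (1 / u s) * u t)"
  define y' where "y' = (\<lambda>t. (1 / u s) * v t)"
  have y: "c2_on a b y y' (\<lambda>t. - (wt \<mu> t * (f (u t) / u s)))"
    unfolding y_def y'_def by (rule c2_on_cong[OF c2_on_scale[OF uc]]) simp
  have v0: "v s = 0" by (rule deriv_zero_at_max[OF uc s' s(2)])
  have "1 / 2 < y b"
  proof (rule half_decay[OF c2_on_subset[OF y, of s b]])
    show "b - s \<le> real k * l" using s' by (simp add: b_eq)
    show "y s = 1" "y' s = 0" using us v0 by (auto simp: y_def y'_def)
    fix t assume t: "t \<in> {s..b}"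
    have tab: "t \<in> {a..b}" using t s' by auto
    have ut: "0 \<le> u t" "u t \<le> u s" using good_nonneg[OF u tab] s(2)[OF tab] by auto
    obtain i where i: "i < k" "t \<in> seg i" using segs_cover[OF tab] by blast
    show "- g \<epsilon> \<le> - (wt \<mu> t * (f (u t) / u s))"
    proof (cases "even i")
      case False
      have "0 \<le> \<mu> * sin (\<omega> * (t - node i)) * (f (u t) / u s)"
        using \<open>0 \<le> \<mu>\<close> us f_nonneg sin_nonneg i(2) by simp
      then show ?thesis using wt_odd[OF False i(2), of \<mu>] g_nonneg[of \<epsilon>] by simp
    next
      case True
      then have small: "u t \<le> \<epsilon>" using e i by (auto simp: big_def not_less)
      have "f (u t) \<le> g \<epsilon> * u s"
      proof -
        have "f (u t) = u t powr (p - 1) * u t" using ut small \<epsilon> MR by (simp add: f_eq min_def)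
        also have "\<dots> \<le> g (u t) * u t"
          using ut p by (intro mult_right_mono) (auto simp: g_def mult_le_cancel_right1)
        also have "\<dots> \<le> g \<epsilon> * u s" using ut g_mono[OF small] g_nonneg by (intro mult_mono) auto
        finally show ?thesis .
      qed
      then have "f (u t) / u s \<le> g \<epsilon>" using us by (simp add: field_simps)
      then have "sin (\<omega> * (t - node i)) * (f (u t) / u s) \<le> 1 * g \<epsilon>"
        using us f_nonneg by (intro mult_mono) auto
      then show ?thesis using wt_even[OF True i(2), of \<mu>] by simp
    qed
  qed (use s' in auto)
  then show False using u by (simp add: y_def good_def)
qed

end

section \<open>Existence by shooting\<close>

text \<open>This is the crossing of the level closest to \<open>y\<close>. Segments replace
  intervals because the end points exchange roles during the shooting and their order is not
  controlled.\<close>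

lemma closed_segment_crossing:
  fixes \<phi> :: "real \<Rightarrow> real"
  assumes "continuous_on (closed_segment x y) \<phi>" "\<phi> x \<le> e" "e < \<phi> y"
  shows "\<exists>z\<in>closed_segment x y. \<phi> z = e \<and> (\<forall>s\<in>closed_segment z y. s \<noteq> z \<longrightarrow> e < \<phi> s)"
proof (cases "x \<le> y")
  case True
  obtain z where z: "- y < z" "z \<le> - x" "\<phi> (- z) - e = 0" "\<And>t. - y \<le> t \<Longrightarrow> t < z \<Longrightarrow> \<phi> (- t) - e > 0"
  proof (rule first_zero[of "- y" "- x" "\<lambda>t. \<phi> (- t) - e"])
    show "continuous_on {- y..- x} (\<lambda>t. \<phi> (- t) - e)"
      by (intro continuous_intros continuous_on_compose2[OF assms(1)])
        (use True in \<open>auto simp: closed_segment_eq_real_ivl\<close>)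
  qed (use assms True in auto)
  have "e < \<phi> s" if "- z < s" "s \<le> y" for s using z(4)[of "- s"] that by simp
  then show ?thesis using z(1-3) True
    by (intro bexI[of _ "- z"]) (auto simp: closed_segment_eq_real_ivl)
next
  case False
  obtain z where z: "y < z" "z \<le> x" "\<phi> z - e = 0" "\<And>t. y \<le> t \<Longrightarrow> t < z \<Longrightarrow> \<phi> t - e > 0"
  proof (rule first_zero[of y x "\<lambda>t. \<phi> t - e"])
    show "continuous_on {y..x} (\<lambda>t. \<phi> t - e)"
      using assms(1) False by (intro continuous_intros) (auto simp: closed_segment_eq_real_ivl)
  qed (use assms False in auto)
  have "e < \<phi> s" if "s < z" "y \<le> s" for s using z(4)[of s] that by simp
  then show ?thesis using z(1-3) False
    by (intro bexI[of _ z]) (auto simp: closed_segment_eq_real_ivl)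
qed

lemma closed_segment_subset_left:
  fixes x y z :: real
  assumes "z \<in> closed_segment x y"
  shows "closed_segment x z \<subseteq> closed_segment x y" "closed_segment z y \<subseteq> closed_segment x y"
  using assms by (auto simp: closed_segment_eq_real_ivl split: if_splits)

context indefinite
begin

section \<open>Signs of solutions of the initial value problem\<close>

lemma sol_unique:
  assumes "sol \<mu> u v" "sol \<mu> u' v'" "s \<in> {a..b}" "u s = u' s" "v s = v' s" "t \<in> {a..b}"
  shows "u t = u' t" "v t = v' t"
  using force_unique[OF assms(1,2)[unfolded sol_def] wt_bound assms(3-)] by auto

lemma sol_zero: "sol \<mu> (\<lambda>t. 0) (\<lambda>t. 0)"
  unfolding sol_def by (rule c2_on_cong[OF c2_on_linear[of a b 0 0, simplified]]) (simp add: f_nonpos)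

lemma sol_exists:
  obtains u v where "sol \<mu> u v" "u a = 0" "v a = \<alpha>"
  by (rule force_ivp[of a b "wt \<mu>" "1 + \<bar>\<mu>\<bar>" 0 \<alpha>])
    (use that a_less_b wt_cont wt_bound in \<open>auto simp: sol_def\<close>)

text \<open>Below 0 the truncated nonlinearity vanishes, so beyond its first zero the solution is a
  straight line. The slope there is nonzero by uniqueness.\<close>

lemma after_zero:
  assumes u: "sol \<mu> u v" "u a = 0" "0 < v a" and t0: "a < t0" "t0 \<le> b" "u t0 \<le> 0"
    and t: "t0 < t" "t \<le> b"
  shows "u t < 0"
proof -
  have uc: "c2_on a b u v (\<lambda>t. - (wt \<mu> t * f (u t)))" using u by (simp add: sol_def)
  obtain z where z: "a < z" "z \<le> t0" "u z = 0" "\<And>t. a < t \<Longrightarrow> t < z \<Longrightarrow> u t > 0"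
  proof (rule first_zero_deriv[of a t0 u "v a"])
    show "continuous_on {a..t0} u"
      using t0 by (intro continuous_on_subset[OF c2_on_cont(1)[OF uc]]) auto
    show "(u has_real_derivative v a) (at a within {a..t0})"
      by (rule DERIV_subset[OF c2_onD(1)[OF uc]]) (use t0 in auto)
  qed (use u t0 in auto)
  have "v z \<le> 0"
    by (rule deriv_at_first_zero[OF c2_onD(1)[OF uc], of z a]) (use z t0 in auto)
  moreover have "v z \<noteq> 0"
  proof
    assume "v z = 0"
    then have "v a = 0"
      using sol_unique(2)[OF u(1) sol_zero, of z a] z t0 by auto
    then show False using u by simp
  qed
  ultimately have vz: "v z < 0" by simp
  define L where "L = (\<lambda>t. 0 + v z * (t - z))"
  have Lneg: "L t \<le> 0" if "z \<le> t" for t using that vz by (simp add: L_def mult_nonpos_nonneg)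
  have Lc: "c2_on z b L (\<lambda>t. v z) (\<lambda>t. - (wt \<mu> t * f (L t)))"
    unfolding L_def by (rule c2_on_cong[OF c2_on_linear]) (use Lneg in \<open>simp add: f_nonpos L_def\<close>)
  have "u t = L t"
    by (rule force_unique(1)[OF c2_on_subset[OF uc] Lc wt_bound, of z]) (use z t in \<open>auto simp: L_def\<close>)
  then show "u t < 0" using vz z t by (simp add: L_def mult_neg_pos)
qed

lemma stays_nonpos:
  assumes u: "sol \<mu> u v" "u a = 0" "0 \<le> v a" and t0: "a < t0" "t0 \<le> b" "u t0 \<le> 0" and t: "t \<in> {t0..b}"
  shows "u t \<le> 0"
proof (cases "v a = 0")
  case True
  then show ?thesis using sol_unique(1)[OF u(1) sol_zero, of a t] u t t0 by auto
next
  case False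
  then show ?thesis using after_zero[OF u(1,2) _ t0, of t] t t0 u(3) by (cases "t = t0") auto
qed

lemma pos_before:
  assumes u: "sol \<mu> u v" "u a = 0" "0 \<le> v a" and T: "T \<in> {a..b}" "0 < u T"
  shows "0 < v a" "\<And>t. a < t \<Longrightarrow> t \<le> T \<Longrightarrow> 0 < u t"
proof -
  have aT: "a < T" using T u by (cases "T = a") auto
  show "0 < v a"
  proof (rule ccontr)
    assume "\<not> 0 < v a"
    then have "u T = 0" using sol_unique(1)[OF u(1) sol_zero, of a T] u T by auto
    then show False using T by simp
  qed
  fix t assume t: "a < t" "t \<le> T"
  show "0 < u t"
  proof (rule ccontr)
    assume "\<not> 0 < u t"
    then have "u T \<le> 0" using stays_nonpos[OF u, of t T] t T by auto
    then show False using T by simp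
  qed
qed

text \<open>The point is that \<open>v (node i)\<close> is nonnegative. Otherwise concavity on
  \<open>seg i\<close> gives u \<ge> \<epsilon> at \<open>node i\<close>, and convexity makes
  \<open>u\<close> decrease on the preceding negative hump; so it starts that hump at \<epsilon> or
  more and would have blown up to \<open>M0 + 1\<close> at \<open>node i\<close>. Then
  \<open>threshold_end\<close> applies; \<open>max Dv (\<epsilon> / l)\<close> covers this blow-up
  and the next one.\<close>

lemma threshold_blow_up:
  assumes u: "sol \<mu> u v" "u a = 0" "0 \<le> v a" and \<mu>: "0 \<le> \<mu>" "blows (\<epsilon> / 2) (max Dv (\<epsilon> / l)) \<mu>"
    and i: "even i" "i < k" and pos: "\<And>t. a < t \<Longrightarrow> t \<le> node i \<Longrightarrow> 0 < u t"
    and le: "\<And>t. t \<in> seg i \<Longrightarrow> u t \<le> \<epsilon>" and s: "s \<in> seg i" "u s = \<epsilon>"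
  shows "\<epsilon> / 2 \<le> u (node (Suc i))" "Suc i < k \<Longrightarrow> M0 + 1 \<le> u (node (Suc (Suc i)))"
proof -
  have uc: "c2_on a b u v (\<lambda>t. - (wt \<mu> t * f (u t)))" using u by (simp add: sol_def)
  note ui = eq_even[OF uc i]
  have vi: "0 \<le> v (node i)"
  proof (cases "i = 0")
    case False
    then obtain j where j: "i = Suc (Suc j)" "even j"
      using i(1) by (metis even_Suc not0_implies_Suc even_zero)
    have jk: "j < k" "Suc j < k" using j i by auto
    have oj: "odd (Suc j)" using j by simp
    show ?thesis
    proof (rule ccontr)
      assume n: "\<not> 0 \<le> v (node i)"
      note uj = eq_odd[OF uc oj jk(2)]
      have ni: "node i = node (Suc j) + l" by (simp add: j node_simps)
      have mono: "v t \<le> v (node i)" if t: "t \<in> seg (Suc j)" for t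
      proof -
        have "0 * (node i - t) \<le> v (node i) - v t"
          by (rule deriv_ge[OF c2_onD(2)[OF uj]])
            (use t ni \<mu>(1) f_nonneg sin_nonneg in auto)
        then show ?thesis by simp
      qed
      have "u (node i) - u (node (Suc j)) \<le> 0 * (node i - node (Suc j))"
      proof (rule deriv_le[OF c2_onD(1)[OF uj]])
        fix t assume "node (Suc j) < t" "t < node i"
        then show "v t \<le> 0" using mono[of t] n ni by auto
      qed (use ni l in auto)
      moreover have "\<epsilon> \<le> u (node i)"
      proof -
        have neg: "- (sin (\<omega> * (t - node i)) * f (u t)) \<le> 0" if "t \<in> seg i" for t
          using f_nonneg sin_nonneg that by simp
        have "u s \<le> u (node i) + v (node i) * (s - node i) + 0 * (s - node i)\<^sup>2 / 2"
          by (rule taylor_le[OF ui _ s(1) neg]) (use l in auto)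
        moreover have "v (node i) * (s - node i) \<le> 0" using n s by (intro mult_nonpos_nonneg) auto
        ultimately show ?thesis using s(2) by simp
      qed
      ultimately have "\<epsilon> / 2 \<le> u (node (Suc j))" using \<epsilon>(1) by simp
      moreover have "- max Dv (\<epsilon> / l) \<le> v (node (Suc j))"
      proof -
        have "\<bar>v (node (Suc j))\<bar> \<le> Dv"
        proof (rule slope_even[OF eq_even[OF uc j(2) jk(1)]])
          fix t assume t: "t \<in> seg j"
          show "0 \<le> u t"
          proof (cases "t = a")
            case False
            then show ?thesis using pos[of t] t node_ge_a[of j] l by (auto simp: j node_simps)
          qed (use u in simp)
        qed (use l in \<open>auto simp: node_simps\<close>)
        then show ?thesis by auto
      qed
      ultimately have "M0 + 1 \<le> u (node i)"
        using blowsD(2)[OF \<mu>(2) uj] ni by simp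
      moreover have "u (node i) \<le> \<epsilon>" using l by (intro le) auto
      ultimately show False using \<epsilon>(2) by simp
    qed
  qed (use u in \<open>simp add: node_simps\<close>)
  have en: "\<epsilon> / 2 \<le> u (node i + l)" "- (\<epsilon> / l) \<le> v (node i + l)"
    using threshold_end[OF ui vi le s \<epsilon>(1) _ \<epsilon>(3)] \<epsilon>(2) MR by auto
  then show "\<epsilon> / 2 \<le> u (node (Suc i))" by (simp add: node_simps)
  assume ik: "Suc i < k"
  have "M0 + 1 \<le> u (node (Suc i) + l)"
    by (rule blowsD(2)[OF \<mu>(2) eq_odd[OF uc _ ik]]) (use i en in \<open>auto simp: node_simps\<close>)
  then show "M0 + 1 \<le> u (node (Suc (Suc i)))" by (simp add: node_simps)
qed

text \<open>In both \<open>claim i\<close> and \<open>split i\<close> the initial slopes between the two end points of a segment give solutions that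
  follow the pattern \<open>S\<close> so far, and the solution at the first end point has already become nonpositive. At the
  second end point of \<open>claim i\<close> the solution has a large hump on \<open>seg i\<close> and vanishes within it, so the maximum over
  \<open>seg i\<close> crosses \<open>\<epsilon>\<close>; at the second end point of \<open>split i\<close> this maximum is \<open>\<epsilon>\<close>.\<close>

lemma pattern_exists:
  assumes \<mu>: "0 \<le> \<mu>" "blows (\<epsilon> / 2) (max Dv (\<epsilon> / l)) \<mu>" and S: "S \<subseteq> {i. even i \<and> i < k}" "S \<noteq> {}"
  shows "\<exists>u v. good \<mu> u v \<and> big u = S"
proof -
  have "\<exists>u v. sol \<mu> u v \<and> u a = 0 \<and> v a = \<alpha>" for \<alpha> using sol_exists by metis
  then obtain U V where U: "\<And>\<alpha>. sol \<mu> (U \<alpha>) (V \<alpha>)" "\<And>\<alpha>. U \<alpha> a = 0" "\<And>\<alpha>. V \<alpha> a = \<alpha>" by metis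
  have Uc: "c2_on a b (U \<alpha>) (V \<alpha>) (\<lambda>t. - (wt \<mu> t * f (U \<alpha> t)))" for \<alpha> using U(1) by (simp add: sol_def)
  have U0: "U 0 t = 0" if "t \<in> {a..b}" for t
    using sol_unique(1)[OF U(1) sol_zero, of a 0 t] U that by auto
  define C where "C = 2 * exp (((1 + \<bar>\<mu>\<bar>) * K + 2) * (b - a))"
  have lip: "\<bar>U \<alpha> t - U \<beta> t\<bar> \<le> C * \<bar>\<alpha> - \<beta>\<bar>" if "t \<in> {a..b}" for \<alpha> \<beta> t
    unfolding C_def by (rule force_stable[OF Uc Uc wt_bound]) (use that U in auto)
  have C: "0 \<le> C" by (simp add: C_def)
  have cont: "continuous_on X (\<lambda>\<alpha>. U \<alpha> t)" if "t \<in> {a..b}" for X t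
    by (rule lipschitz_on_continuous_on[of C])
      (use lip[OF that] C in \<open>auto intro!: lipschitz_onI simp: dist_real_def\<close>)
  define N where "N = (\<lambda>i \<alpha>. Sup (U \<alpha> ` seg i))"
  have bdd: "bdd_above (U \<alpha> ` seg i)" if "i < k" for i \<alpha>
    by (intro bounded_imp_bdd_above compact_imp_bounded compact_continuous_image
        continuous_on_subset[OF c2_on_cont(1)[OF Uc]]) (use seg_subset[OF that] in auto)
  have ne: "seg i \<noteq> {}" for i using l by simp
  have N_ge: "U \<alpha> t \<le> N i \<alpha>" if "i < k" "t \<in> seg i" for i \<alpha> t
    unfolding N_def using that bdd by (intro cSUP_upper)
  have N_at: "\<exists>t\<in>seg i. U \<alpha> t = N i \<alpha>" if i: "i < k" for i \<alpha>
  proof -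
    obtain s where s: "s \<in> seg i" "\<And>t. t \<in> seg i \<Longrightarrow> U \<alpha> t \<le> U \<alpha> s"
      using continuous_attains_sup[of "seg i" "U \<alpha>"] ne[of i]
        continuous_on_subset[OF c2_on_cont(1)[OF Uc]] seg_subset[OF i] by (metis compact_Icc subsetI)
    then have "N i \<alpha> = U \<alpha> s" unfolding N_def by (intro cSup_eq_maximum) auto
    then show ?thesis using s by metis
  qed
  have N_lip: "N i \<alpha> \<le> N i \<beta> + C * \<bar>\<alpha> - \<beta>\<bar>" if i: "i < k" for i \<alpha> \<beta>
  proof -
    obtain t where t: "t \<in> seg i" "U \<alpha> t = N i \<alpha>" using N_at[OF i] by blast
    then show ?thesis using N_ge[OF i t(1), of \<beta>] lip[OF seg_subset[OF i t(1)], of \<alpha> \<beta>] by auto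
  qed
  have N_cont: "continuous_on X (N i)" if i: "i < k" for X i
  proof (rule lipschitz_on_continuous_on[of C])
    show "C-lipschitz_on X (N i)"
    proof (rule lipschitz_onI)
      fix x y
      show "dist (N i x) (N i y) \<le> C * dist x y"
        using N_lip[OF i, of x y] N_lip[OF i, of y x] by (simp add: dist_real_def abs_le_iff abs_minus_commute)
    qed (rule C)
  qed
  \<comment> \<open>Both alternatives are closed conditions and so hold up to the end points of a
    segment. A maximum equal to \<epsilon> fits either; it is excluded for the final solution
    only.\<close>
  define pat where "pat = (\<lambda>i \<alpha>. \<forall>j<i. even j \<longrightarrow> (if j \<in> S then \<exists>t\<in>seg j. \<epsilon> \<le> U \<alpha> t else \<forall>t\<in>seg j. U \<alpha> t \<le> \<epsilon>))"
  define claim where "claim = (\<lambda>i. \<exists>c\<ge>0. \<exists>d\<ge>0. (\<forall>t\<in>{node i..b}. U c t \<le> 0) \<and> (\<forall>t\<in>{node (Suc i)..b}. U d t \<le> 0) \<and>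
    (\<exists>t\<in>seg i. \<epsilon> < U d t) \<and> (\<forall>\<alpha>\<in>closed_segment c d. \<alpha> \<noteq> c \<longrightarrow> (\<forall>t. a < t \<longrightarrow> t \<le> node i \<longrightarrow> 0 < U \<alpha> t)) \<and>
    (\<forall>\<alpha>\<in>closed_segment c d. pat i \<alpha>))"
  define split where "split = (\<lambda>i. \<exists>c\<ge>0. \<exists>z\<ge>0. (\<forall>t\<in>{node (Suc i)..b}. U c t \<le> 0) \<and>
    (\<forall>\<alpha>\<in>closed_segment c z. pat (Suc i) \<alpha>) \<and> \<epsilon> / 2 \<le> U z (node (Suc i)) \<and>
    (Suc i < k \<longrightarrow> M0 + 1 \<le> U z (node (Suc (Suc i)))))"
  have seg_nonneg: "0 \<le> \<alpha>" if "\<alpha> \<in> closed_segment c d" "0 \<le> c" "0 \<le> d" for \<alpha> c d :: real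
    using that by (auto simp: closed_segment_eq_real_ivl split: if_splits)
  have splitting: "split i" if cl: "claim i" and i: "even i" "i < k" for i
  proof -
    obtain c d where cd: "0 \<le> c" "0 \<le> d" and cneg: "\<And>t. t \<in> {node i..b} \<Longrightarrow> U c t \<le> 0"
      and dneg: "\<And>t. t \<in> {node (Suc i)..b} \<Longrightarrow> U d t \<le> 0" and dbig: "\<exists>t\<in>seg i. \<epsilon> < U d t"
      and pos: "\<And>\<alpha> t. \<alpha> \<in> closed_segment c d \<Longrightarrow> \<alpha> \<noteq> c \<Longrightarrow> a < t \<Longrightarrow> t \<le> node i \<Longrightarrow> 0 < U \<alpha> t"
      and pt: "\<And>\<alpha>. \<alpha> \<in> closed_segment c d \<Longrightarrow> pat i \<alpha>"
      using cl unfolding claim_def by blast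
    have Nc: "N i c \<le> 0"
    proof -
      obtain t where "t \<in> seg i" "U c t = N i c" using N_at[OF i(2)] by blast
      then show ?thesis using cneg[of t] seg_le_b[OF i(2)] by auto
    qed
    have Nd: "\<epsilon> < N i d" using dbig N_ge[OF i(2)] by (meson less_le_trans)
    have z_end: "\<epsilon> / 2 \<le> U z (node (Suc i))" "Suc i < k \<longrightarrow> M0 + 1 \<le> U z (node (Suc (Suc i)))"
      if z: "z \<in> closed_segment c d" "N i z = \<epsilon>" for z
    proof -
      have "z \<noteq> c" using Nc z \<epsilon>(1) by auto
      have z0: "0 \<le> z" using seg_nonneg z(1) cd by blast
      obtain s where s: "s \<in> seg i" "U z s = \<epsilon>" using N_at[OF i(2), of z] z(2) by auto
      have le: "U z t \<le> \<epsilon>" if "t \<in> seg i" for t using N_ge[OF i(2) that, of z] z(2) by simp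
      show "\<epsilon> / 2 \<le> U z (node (Suc i))" "Suc i < k \<longrightarrow> M0 + 1 \<le> U z (node (Suc (Suc i)))"
        using threshold_blow_up[OF U(1,2) _ \<mu> i pos[OF z(1) \<open>z \<noteq> c\<close>] le s] U(3) z0 by auto
    qed
    show ?thesis
    proof (cases "i \<in> S")
      case True
      \<comment> \<open>The crossing closest to \<open>d\<close>: between them the maximum exceeds
        \<epsilon>. The nonpositive end of the new segment is \<open>d\<close>, so the end points
        exchange roles.\<close>
      obtain z where z: "z \<in> closed_segment c d" "N i z = \<epsilon>" "\<forall>s\<in>closed_segment z d. s \<noteq> z \<longrightarrow> \<epsilon> < N i s"
        using closed_segment_crossing[OF N_cont[OF i(2)], of c \<epsilon> d] Nc Nd \<epsilon>(1) by auto
      have pt': "pat (Suc i) \<alpha>" if \<alpha>: "\<alpha> \<in> closed_segment d z" for \<alpha>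
      proof -
        have \<alpha>': "\<alpha> \<in> closed_segment z d" using \<alpha> by (simp add: closed_segment_commute)
        then have "\<epsilon> \<le> N i \<alpha>" using z(2,3) by (cases "\<alpha> = z") (auto intro: less_imp_le)
        then have "\<exists>t\<in>seg i. \<epsilon> \<le> U \<alpha> t" using N_at[OF i(2), of \<alpha>] by metis
        moreover have "pat i \<alpha>" using pt closed_segment_subset_left(2)[OF z(1)] \<alpha>' by blast
        ultimately show ?thesis using True by (auto simp: pat_def less_Suc_eq)
      qed
      show ?thesis unfolding split_def
        using cd(2) dneg z_end[OF z(1,2)] pt' seg_nonneg[OF z(1) cd] by blast
    next
      case False
      \<comment> \<open>The crossing closest to \<open>c\<close>, found by negating
        \<open>N i\<close>: between them the maximum is below \<epsilon>, and \<open>c\<close> stays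
        the nonpositive end.\<close>
      obtain z where z: "z \<in> closed_segment d c" "- N i z = - \<epsilon>" "\<forall>s\<in>closed_segment z c. s \<noteq> z \<longrightarrow> - \<epsilon> < - N i s"
        using closed_segment_crossing[OF continuous_on_minus[OF N_cont[OF i(2)]], of d "- \<epsilon>" c] Nc Nd \<epsilon>(1) by auto
      have z': "z \<in> closed_segment c d" "N i z = \<epsilon>" using z by (auto simp: closed_segment_commute)
      have pt': "pat (Suc i) \<alpha>" if \<alpha>: "\<alpha> \<in> closed_segment c z" for \<alpha>
      proof -
        have \<alpha>': "\<alpha> \<in> closed_segment z c" using \<alpha> by (simp add: closed_segment_commute)
        then have "N i \<alpha> \<le> \<epsilon>" using z(2,3) by (cases "\<alpha> = z") (auto intro: less_imp_le)
        then have "\<forall>t\<in>seg i. U \<alpha> t \<le> \<epsilon>" using N_ge[OF i(2), of _ \<alpha>] by (meson order_trans)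
        moreover have "pat i \<alpha>" using pt closed_segment_subset_left(1)[OF z'(1)] \<alpha> by blast
        ultimately show ?thesis using False by (auto simp: pat_def less_Suc_eq)
      qed
      have "\<forall>t\<in>{node (Suc i)..b}. U c t \<le> 0" using cneg node_mono[of i "Suc i"] by auto
      then show ?thesis unfolding split_def
        using cd(1) z_end[OF z'] pt' seg_nonneg[OF z'(1) cd] by blast
    qed
  qed
  have base: "claim 0"
  proof -
    \<comment> \<open>Above \<open>Dv\<close>, hence too steep to stay positive through the first
      hump; above \<open>\<epsilon> / l\<close>, hence steep enough to exceed \<epsilon>.\<close>
    define d where "d = Dv + 1 + \<epsilon> / l"
    have "0 < d"
      using l M0_pos K_pos \<epsilon> by (auto simp: d_def Dv_def intro!: add_pos_pos add_nonneg_pos divide_pos_pos mult_pos_pos)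
    have k0: "0 < k" using k by simp
    have n1: "node (Suc 0) \<in> {a..b}" "a < node (Suc 0)" using node_ge_a[of 0] seg_le_b[OF k0] l by (auto simp: node_simps)
    note u0 = eq_even[OF Uc _ k0, simplified]
    have 1: "U d (node (Suc 0)) \<le> 0"
    proof (rule ccontr)
      assume "\<not> U d (node (Suc 0)) \<le> 0"
      then have p: "0 < U d t" if "a < t" "t \<le> node (Suc 0)" for t
        using pos_before(2)[OF U(1,2), of d "node (Suc 0)" t] n1 that U(3) \<open>0 < d\<close> by auto
      have "\<bar>V d a\<bar> \<le> Dv"
      proof (rule slope_even[OF u0])
        fix t assume "t \<in> seg 0"
        then show "0 \<le> U d t" using p[of t] U(2)[of d] by (cases "t = a") (auto simp: node_simps)
      qed (use l in \<open>auto simp: node_simps\<close>)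
      moreover have "0 < \<epsilon> / l" using \<epsilon> l by simp
      ultimately show False using U(3)[of d] by (simp add: d_def)
    qed
    then have neg: "\<forall>t\<in>{node (Suc 0)..b}. U d t \<le> 0"
      using stays_nonpos[OF U(1,2), of d "node (Suc 0)"] U(3) \<open>0 < d\<close> n1 by auto
    have "\<exists>t\<in>seg 0. \<epsilon> < U d t"
    proof (rule ccontr)
      assume "\<not> ?thesis"
      then have small: "U d t \<le> \<epsilon>" if "t \<in> seg 0" for t using that by (meson not_less)
      have f\<epsilon>: "f \<epsilon> = \<epsilon> * \<epsilon> powr (p - 1)" using \<epsilon> MR by (simp add: f_eq)
      have acc: "- f \<epsilon> \<le> - (sin (\<omega> * (t - node 0)) * f (U d t))" if t: "t \<in> seg 0" for t
      proof -
        have "sin (\<omega> * (t - node 0)) * f (U d t) \<le> 1 * f \<epsilon>"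
          using f_mono[OF small[OF t]] f_nonneg by (intro mult_mono) auto
        then show ?thesis by simp
      qed
      have "U d a + V d a * (a + l - a) + (- f \<epsilon>) * (a + l - a)\<^sup>2 / 2 \<le> U d (a + l)"
        by (rule taylor_ge[OF u0 _ _ acc, unfolded node_simps]) (use l in auto)
      moreover have "f \<epsilon> * l\<^sup>2 \<le> \<epsilon> / 2"
      proof -
        have "\<epsilon> * (\<epsilon> powr (p - 1) * l\<^sup>2) \<le> \<epsilon> * (1 / 2)" using \<epsilon> by (intro mult_left_mono) auto
        then show ?thesis by (simp add: f\<epsilon> mult.assoc)
      qed
      moreover have "\<epsilon> < d * l"
      proof -
        have "\<epsilon> / l < d" using l M0_pos K_pos by (auto simp: d_def Dv_def intro!: add_pos_pos add_nonneg_pos)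
        then show ?thesis using l by (simp add: field_simps)
      qed
      ultimately show False using 1 U(2,3)[of d] \<epsilon>(1) by (simp add: node_simps)
    qed
    then show ?thesis unfolding claim_def
      using neg U0 \<open>0 < d\<close> by (intro exI[of _ 0] exI[of _ d] conjI) (auto simp: node_simps pat_def)
  qed
  have step: "claim (Suc (Suc i))" if cl: "claim i" and i: "even i" "Suc (Suc i) < k" for i
  proof -
    have ik: "i < k" "Suc i < k" using i by auto
    obtain c z where cz: "0 \<le> c" "0 \<le> z" and cneg: "\<And>t. t \<in> {node (Suc i)..b} \<Longrightarrow> U c t \<le> 0"
      and pt: "\<And>\<alpha>. \<alpha> \<in> closed_segment c z \<Longrightarrow> pat (Suc i) \<alpha>" and zbig: "M0 + 1 \<le> U z (node (Suc (Suc i)))"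
      using splitting[OF cl i(1) ik(1)] ik(2) unfolding split_def by blast
    define T where "T = node (Suc (Suc i))"
    define T' where "T' = node (Suc (Suc (Suc i)))"
    have T: "T \<in> {a..b}" "a < T" "node (Suc i) \<le> T" "T < T'" "T' \<le> b" "T' = T + l"
      using node_ge_a[of i] l seg_le_b[OF i(2)] by (auto simp: T_def T'_def node_simps)
    \<comment> \<open>The slope closest to \<open>z\<close> whose solution vanishes at
      \<open>T\<close>: it is the new nonpositive end, and all other slopes up to \<open>z\<close>
      give solutions positive up to \<open>T\<close>.\<close>
    obtain \<beta> where \<beta>: "\<beta> \<in> closed_segment c z" "U \<beta> T = 0" "\<forall>s\<in>closed_segment \<beta> z. s \<noteq> \<beta> \<longrightarrow> 0 < U s T"
      using closed_segment_crossing[OF cont[OF T(1)], of c 0 z] cneg[of T] zbig M0_pos T by (auto simp: T_def)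
    have \<beta>0: "0 \<le> \<beta>" using seg_nonneg[OF \<beta>(1) cz] .
    have sub: "\<alpha> \<in> closed_segment c z" if "\<alpha> \<in> closed_segment \<beta> z" for \<alpha>
      using closed_segment_subset_left(2)[OF \<beta>(1)] that by blast
    have 1: "\<forall>t\<in>{T..b}. U \<beta> t \<le> 0"
      using stays_nonpos[OF U(1,2), of \<beta> T] U(3) \<beta>0 \<beta>(2) T by auto
    \<comment> \<open>A solution positive through the next positive hump obeys the a priori bound
      there, whereas this one enters it at \<open>M0 + 1\<close> or more.\<close>
    have "U z T' \<le> 0"
    proof (rule ccontr)
      assume "\<not> U z T' \<le> 0"
      then have pz: "0 < U z t" if "a < t" "t \<le> T'" for t
        using pos_before(2)[OF U(1,2), of z T' t] U(3) cz(2) T that by auto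
      have "U z T \<le> M0"
        by (rule apriori_bound[OF eq_even[OF Uc _ i(2)] _ f_ge MR])
          (use i pz T l in \<open>auto simp: T_def[symmetric] intro!: less_imp_le[OF pz]\<close>)
      then show False using zbig by (simp add: T_def)
    qed
    then have 2: "\<forall>t\<in>{T'..b}. U z t \<le> 0"
      using stays_nonpos[OF U(1,2), of z T'] U(3) cz(2) T by auto
    have 3: "\<exists>t\<in>seg (Suc (Suc i)). \<epsilon> < U z t"
      using zbig \<epsilon>(2) l by (intro bexI[of _ T]) (auto simp: T_def)
    have 4: "0 < U \<alpha> t" if "\<alpha> \<in> closed_segment \<beta> z" "\<alpha> \<noteq> \<beta>" "a < t" "t \<le> T" for \<alpha> t
      using pos_before(2)[OF U(1,2), of \<alpha> T t] U(3) seg_nonneg[OF sub[OF that(1)] cz] \<beta>(3) T that by auto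
    have 5: "pat (Suc (Suc i)) \<alpha>" if "\<alpha> \<in> closed_segment \<beta> z" for \<alpha>
      using pt[OF sub[OF that]] i(1) by (auto simp: pat_def less_Suc_eq)
    show ?thesis unfolding claim_def T_def[symmetric] T'_def[symmetric]
      by (rule exI[of _ \<beta>], rule conjI[OF \<beta>0], rule exI[of _ z], rule conjI[OF cz(2)])
        (intro conjI 1 2 3[folded T_def] ballI impI allI 4 5)
  qed
  have claims: "claim (2 * n)" if "2 * n < k" for n
    using that
  proof (induction n)
    case 0
    then show ?case using base by simp
  next
    case (Suc n)
    then show ?case using step[of "2 * n"] by simp
  qed
  \<comment> \<open>The last positive hump: it ends at \<open>b\<close> if \<open>k\<close> is odd,
    and one negative hump follows if \<open>k\<close> is even.\<close>
  define i where "i = 2 * ((k - 1) div 2)"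
  have i: "even i" "i < k" "k = Suc i \<or> k = Suc (Suc i)" using k by (auto simp: i_def)
  obtain c z where cz: "0 \<le> c" "0 \<le> z" and cneg: "\<And>t. t \<in> {node (Suc i)..b} \<Longrightarrow> U c t \<le> 0"
    and pt: "\<And>\<alpha>. \<alpha> \<in> closed_segment c z \<Longrightarrow> pat (Suc i) \<alpha>" and z1: "\<epsilon> / 2 \<le> U z (node (Suc i))"
    and z2: "Suc i < k \<longrightarrow> M0 + 1 \<le> U z (node (Suc (Suc i)))"
    using splitting[of i] claims[of "(k - 1) div 2"] i unfolding i_def split_def by blast
  have zb: "0 < U z b" using z1 z2 i(3) \<epsilon>(1) M0_pos by (auto simp: b_def)
  have "node (Suc i) \<le> b" using i(2) by (intro node_le_b) auto
  then have cb: "U c b \<le> 0" by (intro cneg) auto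
  obtain \<beta> where \<beta>: "\<beta> \<in> closed_segment c z" "U \<beta> b = 0"
    using closed_segment_crossing[of c z "\<lambda>\<alpha>. U \<alpha> b" 0] cont[of b] cb zb a_less_b by auto
  have \<beta>0: "0 \<le> \<beta>" using seg_nonneg[OF \<beta>(1) cz] .
  have pt\<beta>: "if j \<in> S then \<exists>t\<in>seg j. \<epsilon> \<le> U \<beta> t else \<forall>t\<in>seg j. U \<beta> t \<le> \<epsilon>" if "even j" "j < k" for j
  proof -
    have "j < Suc i" using i(1,3) that by (auto simp: less_Suc_eq)
    then show ?thesis using pt[OF \<beta>(1)] that unfolding pat_def by blast
  qed
  have "\<beta> \<noteq> 0"
  proof
    assume "\<beta> = 0"
    obtain j where j: "j \<in> S" using S(2) by blast
    then have "\<exists>t\<in>seg j. \<epsilon> \<le> U \<beta> t" "j < k" using pt\<beta>[of j] S(1) by auto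
    then show False using U0 seg_subset[of j] \<epsilon>(1) \<open>\<beta> = 0\<close> by force
  qed
  then have \<beta>p: "0 < \<beta>" using \<beta>0 by simp
  have gd: "good \<mu> (U \<beta>) (V \<beta>)"
    unfolding good_def
  proof (intro conjI ballI)
    fix t assume t: "t \<in> {a<..<b}"
    show "0 < U \<beta> t"
    proof (rule ccontr)
      assume "\<not> 0 < U \<beta> t"
      then have "U \<beta> b < 0" using after_zero[OF U(1,2), of \<beta> t b] U(3) \<beta>p t by auto
      then show False using \<beta>(2) by simp
    qed
  qed (use U \<beta> in auto)
  have "big (U \<beta>) = S"
  proof (intro set_eqI iffI)
    fix j assume "j \<in> big (U \<beta>)"
    then show "j \<in> S" using pt\<beta>[of j] by (force simp: big_def split: if_splits)
  next
    fix j assume j: "j \<in> S"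
    then have ev: "even j" "j < k" using S(1) by auto
    then obtain s where s: "s \<in> seg j" "\<epsilon> \<le> U \<beta> s" using pt\<beta>[of j] j by auto
    show "j \<in> big (U \<beta>)"
    proof (rule ccontr)
      assume "j \<notin> big (U \<beta>)"
      then have le: "U \<beta> t \<le> \<epsilon>" if "t \<in> seg j" for t using ev that by (auto simp: big_def not_less)
      have pos: "0 < U \<beta> t" if "a < t" "t \<le> node j" for t
        using gd that node_less[of j k] ev(2) by (auto simp: good_def b_def)
      \<comment> \<open>A maximum of exactly \<epsilon> would force a value of at least
        \<open>M0 + 1\<close> after the next negative hump, or of at least \<epsilon>/2 at
        \<open>b\<close> if none follows.\<close>
      have se: "U \<beta> s = \<epsilon>" using le[OF s(1)] s(2) by simp
      note tb = threshold_blow_up[OF U(1,2) _ \<mu> ev pos le s(1) se]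
      show False
      proof (cases "Suc j < k")
        case True
        have "M0 + 1 \<le> U \<beta> (node (Suc (Suc j)))" using tb(2) True U(3) \<beta>0 by simp
        moreover have "U \<beta> (node (Suc (Suc j))) \<le> M0"
          using True node_ge_a node_le_b by (intro good_le[OF gd \<mu>(1)]) auto
        ultimately show False by simp
      next
        case False
        then have "Suc j = k" using ev by simp
        then have "\<epsilon> / 2 \<le> U \<beta> b" using tb(1) U(3) \<beta>0 by (simp add: b_def)
        then show False using \<beta>(2) \<epsilon>(1) by simp
      qed
    qed
  qed
  then show ?thesis using gd by blast
qed

end

section \<open>Exact multiplicity\<close>

context indefinite
begin

context
  fixes h :: "real \<Rightarrow> real"
  assumes h: "\<And>t. t \<in> {a..b} \<Longrightarrow> h t = sin (\<omega> * (t - a))"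
begin

lemma weight_wt: "t \<in> {a..b} \<Longrightarrow> weight h \<mu> t = wt \<mu> t"
  by (simp add: weight_def wt_def pos_part_def neg_part_def h)

lemma power_term: "0 \<le> x \<Longrightarrow> \<bar>x\<bar> powr (p - 1) * x = x powr p"
  by (cases "x = 0") (auto simp: powr_diff)

text \<open>Phrased through the values of \<open>F\<close> along \<open>u\<close>, so that it covers
  both the nonlinear and the linearised problem.\<close>

lemma dirichlet_solution_iff:
  assumes "\<And>t. t \<in> {a..b} \<Longrightarrow> F t (u t) = wt \<mu> t * G t"
  shows "dirichlet_solution a b F u \<longleftrightarrow> (\<exists>v. c2_on a b u v (\<lambda>t. - (wt \<mu> t * G t))) \<and> u a = 0 \<and> u b = 0"
proof -
  have "((\<exists>v'. (v has_real_derivative v') (at t within {a..b}) \<and> v' + F t (u t) = 0) \<longleftrightarrow>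
      (v has_real_derivative - (wt \<mu> t * G t)) (at t within {a..b}))" if "t \<in> {a..b}" for t v
    using assms[OF that] by (metis add.left_inverse add_eq_0_iff2)
  then show ?thesis unfolding dirichlet_solution_def c2_on_def by simp
qed

text \<open>The a priori bound also holds for the original power and places every positive solution
  below \<open>R\<close>, where \<open>f\<close> agrees with that power.\<close>

lemma positive_solution_good:
  assumes "positive_solution a b p h \<mu> u" "0 \<le> \<mu>"
  shows "\<exists>v. good \<mu> u v"
proof -
  have pos: "0 < u t" if "t \<in> {a<..<b}" for t using assms that by (auto simp: positive_solution_def)
  have "dirichlet_solution a b (\<lambda>t x. weight h \<mu> t * \<bar>x\<bar> powr (p - 1) * x) u"
    using assms(1) by (simp add: positive_solution_def)
  moreover have "weight h \<mu> t * \<bar>u t\<bar> powr (p - 1) * u t = wt \<mu> t * (\<bar>u t\<bar> powr (p - 1) * u t)" if "t \<in> {a..b}" for t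
    by (simp only: weight_wt[OF that] mult.assoc)
  ultimately obtain v where v: "c2_on a b u v (\<lambda>t. - (wt \<mu> t * (\<bar>u t\<bar> powr (p - 1) * u t)))" and bd: "u a = 0" "u b = 0"
    using dirichlet_solution_iff[of "\<lambda>t x. weight h \<mu> t * \<bar>x\<bar> powr (p - 1) * x" u \<mu> "\<lambda>t. \<bar>u t\<bar> powr (p - 1) * u t"] by blast
  have nn: "0 \<le> u t" if "t \<in> {a..b}" for t
    using pos[of t] bd that by (cases "t = a \<or> t = b") auto
  have le: "u t \<le> M0" if "t \<in> {a..b}" for t
  proof (rule positive_solution_bound[OF v assms(2) nn _ bd(2) that])
    fix x :: real assume "0 \<le> x"
    then show "x * min x R powr (p - 1) \<le> \<bar>x\<bar> powr (p - 1) * x"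
      using p R by (subst mult.commute, intro mult_right_mono powr_mono2) auto
  qed
  have "sol \<mu> u v" unfolding sol_def
  proof (rule c2_on_cong[OF v])
    fix t assume t: "t \<in> {a..b}"
    have "f (u t) = \<bar>u t\<bar> powr (p - 1) * u t"
      using nn[OF t] le[OF t] MR power_term[of "u t"] by (simp add: f_powr)
    then show "- (wt \<mu> t * (\<bar>u t\<bar> powr (p - 1) * u t)) = - (wt \<mu> t * f (u t))" by simp
  qed
  then show ?thesis using bd pos by (auto simp: good_def)
qed

lemma good_positive_solution:
  assumes u: "good \<mu> u v" and "0 \<le> \<mu>"
  shows "positive_solution a b p h \<mu> u"
proof -
  have "weight h \<mu> t * \<bar>u t\<bar> powr (p - 1) * u t = wt \<mu> t * f (u t)" if t: "t \<in> {a..b}" for t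
    using good_nonneg[OF u t] good_le[OF u assms(2) t] MR power_term[of "u t"] weight_wt[OF t]
    by (simp add: f_powr mult.assoc)
  then have "dirichlet_solution a b (\<lambda>t x. weight h \<mu> t * \<bar>x\<bar> powr (p - 1) * x) u"
    using u by (subst dirichlet_solution_iff[of _ _ \<mu> "\<lambda>t. f (u t)"]) (auto simp: good_def sol_def)
  then show ?thesis using u by (simp add: positive_solution_def good_def)
qed

lemma card_even: "card {i. even i \<and> i < k} = (k + 1) div 2"
proof -
  have "{i. even i \<and> i < k} = (\<lambda>j. 2 * j) ` {..<(k + 1) div 2}"
    by (auto simp: image_iff elim!: evenE)
  moreover have "inj_on (\<lambda>j::nat. 2 * j) {..<(k + 1) div 2}" by (auto simp: inj_on_def)
  ultimately show ?thesis by (simp add: card_image)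
qed

lemma exact_multiplicity:
  "\<exists>\<mu>2 :: real. \<mu>2 > 0 \<and> (\<forall>\<mu> > \<mu>2.
     finite (positive_solutions a b p h \<mu>) \<and>
     card (positive_solutions a b p h \<mu>) = 2 ^ ((k + 1) div 2) - 1 \<and>
     (\<forall>u \<in> positive_solutions a b p h \<mu>. nondegenerate a b p h \<mu> u))"
proof -
  obtain \<mu>0 where *: "\<mu>0 > 0 \<and> (\<forall>\<mu>\<ge>\<mu>0. \<forall>u1 v1 u2 v2 w w'. good \<mu> u1 v1 \<longrightarrow> good \<mu> u2 v2 \<longrightarrow> big u1 = big u2 \<longrightarrow>
    c2_on a b w w' (\<lambda>t. - (wt \<mu> t * (dq (u1 t) (u2 t) * w t))) \<longrightarrow> w a = 0 \<longrightarrow> w b = 0 \<longrightarrow>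
    (\<forall>t\<in>{a..b}. w t = 0))"
    using linear_trivial by (rule exE)
  note \<mu>0 = conjunct1[OF *] conjunct2[OF *, rule_format]
  have "0 < \<epsilon> / 2" using \<epsilon> by simp
  then obtain \<mu>1 where \<mu>1: "\<And>\<mu>. \<mu>1 \<le> \<mu> \<Longrightarrow> blows (\<epsilon> / 2) (max Dv (\<epsilon> / l)) \<mu>"
    using blow_up[of "\<epsilon> / 2" "max Dv (\<epsilon> / l)" "M0 + 1"] unfolding blows_def by blast
  show ?thesis
  proof (intro exI[of _ "max \<mu>0 \<mu>1"] conjI allI impI)
    show "0 < max \<mu>0 \<mu>1" using \<mu>0(1) by simp
  next
    fix \<mu> assume "max \<mu>0 \<mu>1 < \<mu>"
    then have \<mu>: "\<mu>0 \<le> \<mu>" "0 \<le> \<mu>" "blows (\<epsilon> / 2) (max Dv (\<epsilon> / l)) \<mu>" using \<mu>0(1) \<mu>1 by auto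
    define P where "P = positive_solutions a b p h \<mu>"
    have Pg: "\<exists>v. good \<mu> u v" if "u \<in> P" for u
      using that positive_solution_good[OF _ \<mu>(2)] by (simp add: P_def positive_solutions_def)
    have "bij_betw big P (Pow {i. even i \<and> i < k} - {{}})"
    proof (rule bij_betw_imageI)
      show "inj_on big P"
      proof (rule inj_onI)
        fix u1 u2 assume u: "u1 \<in> P" "u2 \<in> P" "big u1 = big u2"
        obtain v1 v2 where v: "good \<mu> u1 v1" "good \<mu> u2 v2" using Pg u by blast
        have c: "c2_on a b (\<lambda>t. u1 t - u2 t) (\<lambda>t. v1 t - v2 t) (\<lambda>t. - (wt \<mu> t * (dq (u1 t) (u2 t) * (u1 t - u2 t))))"
        proof (rule c2_on_cong[OF c2_on_diff])
          show "c2_on a b u1 v1 (\<lambda>t. - (wt \<mu> t * f (u1 t)))" "c2_on a b u2 v2 (\<lambda>t. - (wt \<mu> t * f (u2 t)))"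
            by (rule good_eq[OF v(1)], rule good_eq[OF v(2)])
        qed (subst dq_mult, simp add: right_diff_distrib)
        have "u1 t = u2 t" if "t \<in> {a..b}" for t
          using \<mu>0(2)[OF \<mu>(1) v u(3) c _ _ that] v by (simp add: good_def)
        then show "u1 = u2"
          using u by (intro extensionalityI[of _ "{a..b}"]) (auto simp: P_def positive_solutions_def)
      qed
      show "big ` P = Pow {i. even i \<and> i < k} - {{}}"
      proof (intro equalityI subsetI)
        fix S assume "S \<in> big ` P"
        then obtain u v where u: "S = big u" "good \<mu> u v" using Pg by blast
        then show "S \<in> Pow {i. even i \<and> i < k} - {{}}"
          using big_nonempty[OF u(2) \<mu>(2)] by (auto simp: big_def)
      next
        fix S assume "S \<in> Pow {i. even i \<and> i < k} - {{}}"
        then obtain u v where u: "good \<mu> u v" "big u = S"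
          using pattern_exists[OF \<mu>(2,3), of S] by auto
        \<comment> \<open>The shot solution has arbitrary values outside [a, b]; restricting it
          makes it extensional and leaves its set of large humps unchanged.\<close>
        define y where "y = restrict u {a..b}"
        have uy: "y t = u t" if "t \<in> {a..b}" for t using that by (simp add: y_def)
        have "c2_on a b y v (\<lambda>t. - (wt \<mu> t * f (u t)))"
          by (rule c2_on_cong_fun[of a b u]) (use u uy in \<open>auto simp: good_def sol_def\<close>)
        then have "sol \<mu> y v" unfolding sol_def by (rule c2_on_cong) (simp add: uy)
        then have "good \<mu> y v" using u uy a_less_b by (auto simp: good_def)
        then have "y \<in> P"
          using good_positive_solution[OF _ \<mu>(2)] by (auto simp: P_def positive_solutions_def y_def)
        moreover have "big y = S"
        proof -
          have "(\<exists>t\<in>seg i. \<epsilon> < y t) \<longleftrightarrow> (\<exists>t\<in>seg i. \<epsilon> < u t)" if "i < k" for i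
            using uy seg_subset[OF that] by auto
          then show ?thesis using u(2) by (auto simp: big_def)
        qed
        ultimately show "S \<in> big ` P" by blast
      qed
    qed
    moreover have "finite (Pow {i. even i \<and> i < k} - {{}})" by simp
    moreover have "card (Pow {i. even i \<and> i < k} - {{}}) = 2 ^ ((k + 1) div 2) - 1"
      by (simp add: card_Diff_subset card_Pow card_even)
    ultimately show "finite (positive_solutions a b p h \<mu>)" "card (positive_solutions a b p h \<mu>) = 2 ^ ((k + 1) div 2) - 1"
      unfolding P_def[symmetric] using bij_betw_finite bij_betw_same_card by fastforce+
    show "\<forall>u\<in>positive_solutions a b p h \<mu>. nondegenerate a b p h \<mu> u"
      unfolding nondegenerate_def P_def[symmetric]
    proof (intro ballI allI impI)
      fix u w t assume "u \<in> P" and w: "dirichlet_solution a b (\<lambda>t x. weight h \<mu> t * p * u t powr (p - 1) * x) w"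
        and t: "t \<in> {a..b}"
      then obtain v where v: "good \<mu> u v" using Pg by blast
      have "weight h \<mu> t * p * u t powr (p - 1) * w t = wt \<mu> t * (dq (u t) (u t) * w t)" if "t \<in> {a..b}" for t
        using good_nonneg[OF v that] by (simp add: weight_wt[OF that] dq_self g_def mult.assoc)
      then have "(\<exists>w'. c2_on a b w w' (\<lambda>t. - (wt \<mu> t * (dq (u t) (u t) * w t)))) \<and> w a = 0 \<and> w b = 0"
        using w by (subst (asm) dirichlet_solution_iff[of _ _ \<mu> "\<lambda>t. dq (u t) (u t) * w t"]) auto
      then show "w t = 0" using \<mu>0(2)[OF \<mu>(1) v v refl _ _ _ t] by blast
    qed
  qed
qed

end

end

theorem theorem1p2:
  fixes a b p :: real and k :: nat and h :: "real \<Rightarrow> real"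
  assumes "a < b" and "p > 1" and "k \<ge> 2"
    and "\<forall>t\<in>{a..b}. h t = sin (real k * pi * (t - a) / (b - a))"
  shows "\<exists>\<mu>2 :: real. \<mu>2 > 0 \<and>
    (\<forall>\<mu> > \<mu>2.
       finite (positive_solutions a b p h \<mu>) \<and>
       card (positive_solutions a b p h \<mu>) = 2 ^ ((k + 1) div 2) - 1 \<and>
       (\<forall>u \<in> positive_solutions a b p h \<mu>. nondegenerate a b p h \<mu> u))"
proof -
  define L where "L = (b - a) / real k"
  define \<omega> where "\<omega> = pi / L"
  \<comment> \<open>The value of \<open>M0\<close> for hump length \<open>L\<close>, written out
    because \<open>R = M + 1\<close> is a parameter of the locale in which \<open>M0\<close> is
    defined.\<close>
  define M where "M = 4 * (256 / L\<^sup>2) powr (1 / (p - 1))"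
  have L: "L > 0" "real k * L = b - a" using assms(1,3) by (auto simp: L_def)
  have M: "M > 0" using L by (simp add: M_def)
  interpret cos_problem p "M + 1" \<omega>
    by unfold_locales (use assms(2) L M in \<open>auto simp: \<omega>_def\<close>)
  have lL: "l = L" unfolding l_def by (simp add: \<omega>_def)
  \<comment> \<open>One entry for each smallness condition on \<epsilon>; both expressions then come
    out as at most 1/2.\<close>
  define \<kappa> where "\<kappa> = min (1 / (2 * L\<^sup>2)) (1 / (2 * p * (b - a)\<^sup>2))"
  define \<epsilon> where "\<epsilon> = min M (\<kappa> powr (1 / (p - 1)))"
  have \<kappa>: "\<kappa> > 0" using L assms by (simp add: \<kappa>_def)
  have \<epsilon>: "0 < \<epsilon>" "\<epsilon> \<le> M" using M \<kappa> by (auto simp: \<epsilon>_def)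
  have "\<epsilon> powr (p - 1) \<le> (\<kappa> powr (1 / (p - 1))) powr (p - 1)"
    using \<epsilon> assms(2) by (intro powr_mono2) (auto simp: \<epsilon>_def)
  also have "\<dots> = \<kappa>" using \<kappa> assms(2) by (simp add: powr_powr)
  finally have \<epsilon>\<kappa>: "\<epsilon> powr (p - 1) \<le> 1 / (2 * L\<^sup>2)" "\<epsilon> powr (p - 1) \<le> 1 / (2 * p * (b - a)\<^sup>2)"
    by (auto simp: \<kappa>_def)
  interpret indefinite p "M + 1" \<omega> a \<epsilon> k
  proof
    show "M0 < M + 1" "\<epsilon> \<le> M0" using \<epsilon> by (auto simp: M0_def M_def lL)
    have "\<epsilon> powr (p - 1) * L\<^sup>2 \<le> 1 / (2 * L\<^sup>2) * L\<^sup>2" using \<epsilon>\<kappa>(1) by (rule mult_right_mono) simp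
    also have "\<dots> = 1 / 2" using L by simp
    finally show "\<epsilon> powr (p - 1) * l\<^sup>2 \<le> 1 / 2" by (simp only: lL)
    have "p * \<epsilon> powr (p - 1) * (b - a)\<^sup>2 \<le> p * (1 / (2 * p * (b - a)\<^sup>2)) * (b - a)\<^sup>2"
      using \<epsilon>\<kappa>(2) assms(2) by (intro mult_right_mono mult_left_mono) auto
    also have "\<dots> = 1 / 2" using assms(1,2) by simp
    finally show "g \<epsilon> * (real k * l)\<^sup>2 < 1" using \<epsilon> by (simp add: g_def lL L)
  qed (use assms \<epsilon> in auto)
  have beq: "indefinite.b \<omega> a k = b" using L by (simp add: b_eq lL)
  have "h t = sin (\<omega> * (t - a))" if "t \<in> {a..b}" for t
    using assms that L by (simp add: \<omega>_def L_def mult.commute[of pi])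
  then show ?thesis using exact_multiplicity[of h] unfolding beq by blast
qed

end
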